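(* Let $\mathcal{A}$ be an abelian category and let $\mathcal{C}$ be a subcategory of $\mathcal{A}$ such that $\mathcal{C}\perp\mathcal{C}$ and $\mathcal{P}(\mathcal{A})$ is a generator for $\mathcal{C}$. If $\mathcal{C}$ is a generator for $\mathcal{G}(\mathcal{C})^{\perp_1}$, then $\mathrm{SPC}(\mathcal{G}(\mathcal{C}))$ is $\mathcal{C}$-resolving in $\mathcal{A}$ with a $\mathcal{C}$-proper generator $\mathcal{C}$.
   Context: All subcategories of the abelian category $\mathcal{A}$ are full, additive and closed under isomorphisms. $\mathcal{P}(\mathcal{A})$ is the subcategory of projective objects of $\mathcal{A}$. For subcategories $\mathcal{X},\mathcal{Y}$ of $\mathcal{A}$, $\mathcal{X}\perp\mathcal{Y}$ means $\mathrm{Ext}^{i}_{\mathcal{A}}(X,Y)=0$ for all $i\geq 1$, $X\in\mathcal{X}$, $Y\in\mathcal{Y}$. For subcategories $\mathcal{X}\subseteq\mathcal{T}$ of $\mathcal{A}$, $\mathcal{X}$ is a generator for $\mathcal{T}$ if for every $T\in\mathcal{T}$ there is an exact sequence $0\to T'\to X\to T\to 0$ in $\mathcal{A}$ with $X\in\mathcal{X}$ and $T'\in\mathcal{T}$ (in particular, $\mathcal{P}(\mathcal{A})$ being a generator for $\mathcal{C}$ includes $\mathcal{P}(\mathcal{A})\subseteq\mathcal{C}$). A sequence in $\mathcal{A}$ is $\mathrm{Hom}_{\mathcal{A}}(\mathcal{X},-)$-exact (resp. $\mathrm{Hom}_{\mathcal{A}}(-,\mathcal{X})$-exact) if it is exact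 after applying $\mathrm{Hom}_{\mathcal{A}}(X,-)$ (resp. $\mathrm{Hom}_{\mathcal{A}}(-,X)$) for every $X\in\mathcal{X}$. The Gorenstein subcategory $\mathcal{G}(\mathcal{C})$ consists of the objects $M$ of $\mathcal{A}$ for which there is an exact sequence $\cdots\to C_1\to C_0\to C^0\to C^1\to\cdots$ in $\mathcal{A}$ with all terms in $\mathcal{C}$, which is both $\mathrm{Hom}_{\mathcal{A}}(\mathcal{C},-)$-exact and $\mathrm{Hom}_{\mathcal{A}}(-,\mathcal{C})$-exact, such that $M\cong\mathrm{Im}(C_0\to C^0)$. $\mathcal{X}^{\perp_1}:=\{M\in\mathcal{A}\mid \mathrm{Ext}^1_{\mathcal{A}}(X,M)=0 \text{ for all } X\in\mathcal{X}\}$. A morphism $f:X\to Y$ with $X\in\mathcal{X}$ is an $\mathcal{X}$-precover of $Y$ if $\mathrm{Hom}_{\mathcal{A}}(X',f)$ is surjective for all $X'\in\mathcal{X}$; it is special if moreover $f$ is an epimorphism and $\mathrm{Ker}\,f\in\mathcal{X}^{\perp_1}$. $\mathrm{SPC}(\mathcal{G}(\mathcal{C}))$ is the subcategory of $\mathcal{A}$ consisting of the objects admitting a special $\mathcal{G}(\mathcal{C})$-precover. Let $\mathcal{X}\subseteq\mathcal{T}$ and $\mathcal{E}$ be subcategories of $\mathcal{A}$. $\mathcal{X}$ is an $\mathcal{E}$-proper generator for $\mathcal{T}$ if for every $T\in\mathcal{T}$ there is a $\mathrm{Hom}_{\mathcal{A}}(\mathcal{E},-)$-exact exact sequence $0\to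 T'\to X\to T\to 0$ in $\mathcal{A}$ with $X\in\mathcal{X}$ and $T'\in\mathcal{T}$. $\mathcal{T}$ is $\mathcal{E}$-resolving in $\mathcal{A}$ if: (i) $\mathcal{T}$ admits an $\mathcal{E}$-proper generator; (ii) $\mathcal{T}$ is closed under $\mathcal{E}$-proper extensions, i.e. for any $\mathrm{Hom}_{\mathcal{A}}(\mathcal{E},-)$-exact exact sequence $0\to A_1\to A_2\to A_3\to 0$ in $\mathcal{A}$, $A_1,A_3\in\mathcal{T}$ implies $A_2\in\mathcal{T}$; (iii) $\mathcal{T}$ is closed under kernels of $\mathcal{E}$-proper epimorphisms, i.e. for any such sequence, $A_2,A_3\in\mathcal{T}$ implies $A_1\in\mathcal{T}$. *)

theory Defs
  imports "HOL-Algebra.Coset"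
begin

section \<open>Abelian categories\<close>

text \<open>
  Composition is written in applicative order and is only specified on composable arrows.
  \<open>Add\<close> is only specified on parallel arrows, and \<open>Zero X Y\<close> is the zero morphism from X to Y.
\<close>

record ('o, 'm) cat =
  Ob :: "'o set"
  Arr :: "'m set"
  Dom :: "'m \<Rightarrow> 'o"
  Cod :: "'m \<Rightarrow> 'o"
  Ident :: "'o \<Rightarrow> 'm"
  Comp :: "'m \<Rightarrow> 'm \<Rightarrow> 'm"  (infixl "\<cdot>\<index>" 70)
  Add :: "'m \<Rightarrow> 'm \<Rightarrow> 'm"
  Zero :: "'o \<Rightarrow> 'o \<Rightarrow> 'm"

definition Hom :: "('o, 'm) cat \<Rightarrow> 'o \<Rightarrow> 'o \<Rightarrow> 'm set" where
  "Hom \<A> X Y = {f \<in> Arr \<A>. Dom \<A> f = X \<and> Cod \<A> f = Y}"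

definition hom_group :: "('o, 'm) cat \<Rightarrow> 'o \<Rightarrow> 'o \<Rightarrow> 'm monoid" where
  "hom_group \<A> X Y = \<lparr>carrier = Hom \<A> X Y, monoid.mult = Add \<A>, one = Zero \<A> X Y\<rparr>"

locale category =
  fixes \<A> :: "('o, 'm) cat" (structure)
  assumes Dom_Ob: "f \<in> Arr \<A> \<Longrightarrow> Dom \<A> f \<in> Ob \<A>"
    and Cod_Ob: "f \<in> Arr \<A> \<Longrightarrow> Cod \<A> f \<in> Ob \<A>"
    and Ident_Hom: "X \<in> Ob \<A> \<Longrightarrow> Ident \<A> X \<in> Hom \<A> X X"
    and Comp_Hom: "\<lbrakk>f \<in> Hom \<A> X Y; g \<in> Hom \<A> Y Z\<rbrakk> \<Longrightarrow> g \<cdot> f \<in> Hom \<A> X Z"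
    and Comp_assoc: "\<lbrakk>f \<in> Hom \<A> W X; g \<in> Hom \<A> X Y; h \<in> Hom \<A> Y Z\<rbrakk>
      \<Longrightarrow> (h \<cdot> g) \<cdot> f = h \<cdot> (g \<cdot> f)"
    and Comp_Ident_right: "f \<in> Hom \<A> X Y \<Longrightarrow> f \<cdot> Ident \<A> X = f"
    and Comp_Ident_left: "f \<in> Hom \<A> X Y \<Longrightarrow> Ident \<A> Y \<cdot> f = f"

locale preadditive_category = category +
  assumes Hom_comm_group: "\<lbrakk>X \<in> Ob \<A>; Y \<in> Ob \<A>\<rbrakk> \<Longrightarrow> comm_group (hom_group \<A> X Y)"
    and Comp_Add_right: "\<lbrakk>f \<in> Hom \<A> X Y; f' \<in> Hom \<A> X Y; g \<in> Hom \<A> Y Z\<rbrakk>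
      \<Longrightarrow> g \<cdot> Add \<A> f f' = Add \<A> (g \<cdot> f) (g \<cdot> f')"
    and Comp_Add_left: "\<lbrakk>f \<in> Hom \<A> X Y; g \<in> Hom \<A> Y Z; g' \<in> Hom \<A> Y Z\<rbrakk>
      \<Longrightarrow> Add \<A> g g' \<cdot> f = Add \<A> (g \<cdot> f) (g' \<cdot> f)"

definition is_zero_object :: "('o, 'm) cat \<Rightarrow> 'o \<Rightarrow> bool" where
  "is_zero_object \<A> Z \<longleftrightarrow> Z \<in> Ob \<A> \<and>
     (\<forall>X \<in> Ob \<A>. (\<exists>!f. f \<in> Hom \<A> X Z) \<and> (\<exists>!f. f \<in> Hom \<A> Z X))"

definition is_biproduct ::
  "('o, 'm) cat \<Rightarrow> 'o \<Rightarrow> 'o \<Rightarrow> 'o \<Rightarrow> 'm \<Rightarrow> 'm \<Rightarrow> 'm \<Rightarrow> 'm \<Rightarrow> bool" where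
  "is_biproduct \<A> X Y S i\<^sub>1 i\<^sub>2 p\<^sub>1 p\<^sub>2 \<longleftrightarrow>
     i\<^sub>1 \<in> Hom \<A> X S \<and> i\<^sub>2 \<in> Hom \<A> Y S \<and> p\<^sub>1 \<in> Hom \<A> S X \<and> p\<^sub>2 \<in> Hom \<A> S Y \<and>
     p\<^sub>1 \<cdot>\<^bsub>\<A>\<^esub> i\<^sub>1 = Ident \<A> X \<and> p\<^sub>2 \<cdot>\<^bsub>\<A>\<^esub> i\<^sub>2 = Ident \<A> Y \<and>
     p\<^sub>1 \<cdot>\<^bsub>\<A>\<^esub> i\<^sub>2 = Zero \<A> Y X \<and> p\<^sub>2 \<cdot>\<^bsub>\<A>\<^esub> i\<^sub>1 = Zero \<A> X Y \<and>
     Add \<A> (i\<^sub>1 \<cdot>\<^bsub>\<A>\<^esub> p\<^sub>1) (i\<^sub>2 \<cdot>\<^bsub>\<A>\<^esub> p\<^sub>2) = Ident \<A> S"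

definition monic :: "('o, 'm) cat \<Rightarrow> 'm \<Rightarrow> bool" where
  "monic \<A> f \<longleftrightarrow> f \<in> Arr \<A> \<and>
     (\<forall>W. \<forall>g \<in> Hom \<A> W (Dom \<A> f). \<forall>h \<in> Hom \<A> W (Dom \<A> f).
        f \<cdot>\<^bsub>\<A>\<^esub> g = f \<cdot>\<^bsub>\<A>\<^esub> h \<longrightarrow> g = h)"

definition epic :: "('o, 'm) cat \<Rightarrow> 'm \<Rightarrow> bool" where
  "epic \<A> f \<longleftrightarrow> f \<in> Arr \<A> \<and>
     (\<forall>W. \<forall>g \<in> Hom \<A> (Cod \<A> f) W. \<forall>h \<in> Hom \<A> (Cod \<A> f) W.
        g \<cdot>\<^bsub>\<A>\<^esub> f = h \<cdot>\<^bsub>\<A>\<^esub> f \<longrightarrow> g = h)"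

definition is_kernel :: "('o, 'm) cat \<Rightarrow> 'm \<Rightarrow> 'm \<Rightarrow> bool" where
  "is_kernel \<A> k f \<longleftrightarrow> k \<in> Arr \<A> \<and> f \<in> Arr \<A> \<and> Cod \<A> k = Dom \<A> f \<and>
     f \<cdot>\<^bsub>\<A>\<^esub> k = Zero \<A> (Dom \<A> k) (Cod \<A> f) \<and>
     (\<forall>W. \<forall>h \<in> Hom \<A> W (Dom \<A> f). f \<cdot>\<^bsub>\<A>\<^esub> h = Zero \<A> W (Cod \<A> f) \<longrightarrow>
        (\<exists>!u. u \<in> Hom \<A> W (Dom \<A> k) \<and> k \<cdot>\<^bsub>\<A>\<^esub> u = h))"

definition is_cokernel :: "('o, 'm) cat \<Rightarrow> 'm \<Rightarrow> 'm \<Rightarrow> bool" where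
  "is_cokernel \<A> c f \<longleftrightarrow> c \<in> Arr \<A> \<and> f \<in> Arr \<A> \<and> Dom \<A> c = Cod \<A> f \<and>
     c \<cdot>\<^bsub>\<A>\<^esub> f = Zero \<A> (Dom \<A> f) (Cod \<A> c) \<and>
     (\<forall>W. \<forall>h \<in> Hom \<A> (Cod \<A> f) W. h \<cdot>\<^bsub>\<A>\<^esub> f = Zero \<A> (Dom \<A> f) W \<longrightarrow>
        (\<exists>!u. u \<in> Hom \<A> (Cod \<A> c) W \<and> u \<cdot>\<^bsub>\<A>\<^esub> c = h))"

locale abelian_category = preadditive_category +
  assumes ex_zero_object: "\<exists>Z. is_zero_object \<A> Z"
    and ex_biproduct: "\<lbrakk>X \<in> Ob \<A>; Y \<in> Ob \<A>\<rbrakk>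
      \<Longrightarrow> \<exists>S i\<^sub>1 i\<^sub>2 p\<^sub>1 p\<^sub>2. is_biproduct \<A> X Y S i\<^sub>1 i\<^sub>2 p\<^sub>1 p\<^sub>2"
    and ex_kernel: "f \<in> Arr \<A> \<Longrightarrow> \<exists>k. is_kernel \<A> k f"
    and ex_cokernel: "f \<in> Arr \<A> \<Longrightarrow> \<exists>c. is_cokernel \<A> c f"
    and monic_normal: "monic \<A> f \<Longrightarrow> \<exists>g. is_kernel \<A> f g"
    and epic_normal: "epic \<A> f \<Longrightarrow> \<exists>g. is_cokernel \<A> f g"

definition isomorphic :: "('o, 'm) cat \<Rightarrow> 'o \<Rightarrow> 'o \<Rightarrow> bool" where
  "isomorphic \<A> X Y \<longleftrightarrow> X \<in> Ob \<A> \<and> Y \<in> Ob \<A> \<and>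
     (\<exists>f \<in> Hom \<A> X Y. \<exists>g \<in> Hom \<A> Y X.
        g \<cdot>\<^bsub>\<A>\<^esub> f = Ident \<A> X \<and> f \<cdot>\<^bsub>\<A>\<^esub> g = Ident \<A> Y)"

text \<open>A full subcategory is given by its class of objects.\<close>

definition subcategory :: "('o, 'm) cat \<Rightarrow> 'o set \<Rightarrow> bool" where
  "subcategory \<A> \<X> \<longleftrightarrow> \<X> \<subseteq> Ob \<A> \<and>
     (\<exists>Z \<in> \<X>. is_zero_object \<A> Z) \<and>
     (\<forall>X \<in> \<X>. \<forall>Y \<in> \<X>. \<forall>S i\<^sub>1 i\<^sub>2 p\<^sub>1 p\<^sub>2. is_biproduct \<A> X Y S i\<^sub>1 i\<^sub>2 p\<^sub>1 p\<^sub>2 \<longrightarrow> S \<in> \<X>) \<and>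
     (\<forall>X \<in> \<X>. \<forall>Y. isomorphic \<A> X Y \<longrightarrow> Y \<in> \<X>)"

definition projectives :: "('o, 'm) cat \<Rightarrow> 'o set" where
  "projectives \<A> = {P \<in> Ob \<A>. \<forall>g. epic \<A> g \<longrightarrow>
     (\<forall>f \<in> Hom \<A> P (Cod \<A> g). \<exists>h \<in> Hom \<A> P (Dom \<A> g). g \<cdot>\<^bsub>\<A>\<^esub> h = f)}"


section \<open>Exact sequences\<close>

definition is_image :: "('o, 'm) cat \<Rightarrow> 'm \<Rightarrow> 'm \<Rightarrow> bool" where
  "is_image \<A> k f \<longleftrightarrow> (\<exists>c. is_cokernel \<A> c f \<and> is_kernel \<A> k c)"

text \<open>Im f = Ker g, as subobjects of the common middle term.\<close>

definition exact_at :: "('o, 'm) cat \<Rightarrow> 'm \<Rightarrow> 'm \<Rightarrow> bool" where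
  "exact_at \<A> f g \<longleftrightarrow> (\<exists>k. is_image \<A> k f \<and> is_kernel \<A> k g)"

text \<open>Exactness of Hom(E,W) \<open>\<rightarrow>\<close> Hom(E,X) \<open>\<rightarrow>\<close> Hom(E,Y), resp. of Hom(Y,E) \<open>\<rightarrow>\<close> Hom(X,E) \<open>\<rightarrow>\<close> Hom(W,E),
  for composable f : W \<open>\<rightarrow>\<close> X and g : X \<open>\<rightarrow>\<close> Y.\<close>

definition Hom_exact_at :: "('o, 'm) cat \<Rightarrow> 'o \<Rightarrow> 'm \<Rightarrow> 'm \<Rightarrow> bool" where
  "Hom_exact_at \<A> E f g \<longleftrightarrow>
     (\<lambda>h. f \<cdot>\<^bsub>\<A>\<^esub> h) ` Hom \<A> E (Dom \<A> f) =
     kernel (hom_group \<A> E (Dom \<A> g)) (hom_group \<A> E (Cod \<A> g)) (\<lambda>h. g \<cdot>\<^bsub>\<A>\<^esub> h)"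

definition Hom_op_exact_at :: "('o, 'm) cat \<Rightarrow> 'o \<Rightarrow> 'm \<Rightarrow> 'm \<Rightarrow> bool" where
  "Hom_op_exact_at \<A> E f g \<longleftrightarrow>
     (\<lambda>h. h \<cdot>\<^bsub>\<A>\<^esub> g) ` Hom \<A> (Cod \<A> g) E =
     kernel (hom_group \<A> (Cod \<A> f) E) (hom_group \<A> (Dom \<A> f) E) (\<lambda>h. h \<cdot>\<^bsub>\<A>\<^esub> f)"

text \<open>Finite sequences of composable morphisms are lists, in diagram order.\<close>

definition exact :: "('o, 'm) cat \<Rightarrow> 'm list \<Rightarrow> bool" where
  "exact \<A> fs \<longleftrightarrow> successively (exact_at \<A>) fs"

definition Hom_exact :: "('o, 'm) cat \<Rightarrow> 'o set \<Rightarrow> 'm list \<Rightarrow> bool" where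
  "Hom_exact \<A> \<E> fs \<longleftrightarrow> (\<forall>E \<in> \<E>. successively (Hom_exact_at \<A> E) fs)"

definition zero_object :: "('o, 'm) cat \<Rightarrow> 'o" where
  "zero_object \<A> = (SOME Z. is_zero_object \<A> Z)"

text \<open>The sequence \<open>0 \<rightarrow> Y \<rightarrow> \<dots> \<rightarrow> X \<rightarrow> 0\<close> obtained from a (nonempty) sequence \<open>Y \<rightarrow> \<dots> \<rightarrow> X\<close>.\<close>

definition zero_ends :: "('o, 'm) cat \<Rightarrow> 'm list \<Rightarrow> 'm list" where
  "zero_ends \<A> fs =
     Zero \<A> (zero_object \<A>) (Dom \<A> (hd fs)) # fs @ [Zero \<A> (Cod \<A> (last fs)) (zero_object \<A>)]"

definition short_exact :: "('o, 'm) cat \<Rightarrow> 'm \<Rightarrow> 'm \<Rightarrow> bool" where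
  "short_exact \<A> f g \<longleftrightarrow> exact \<A> (zero_ends \<A> [f, g])"

definition proper_short_exact :: "('o, 'm) cat \<Rightarrow> 'o set \<Rightarrow> 'm \<Rightarrow> 'm \<Rightarrow> bool" where
  "proper_short_exact \<A> \<E> f g \<longleftrightarrow> short_exact \<A> f g \<and> Hom_exact \<A> \<E> (zero_ends \<A> [f, g])"


section \<open>Yoneda Ext\<close>

text \<open>
  No enough projectives or injectives are assumed, so Ext is Yoneda's: for n \<open>\<ge>\<close> 1, the elements of
  \<open>Ext\<^sup>n(X, Y)\<close> are the n-fold extensions \<open>0 \<rightarrow> Y \<rightarrow> E\<^sub>n \<rightarrow> \<dots> \<rightarrow> E\<^sub>1 \<rightarrow> X \<rightarrow> 0\<close>, modulo the equivalence
  relation generated by morphisms of exact sequences which are the identity on X and on Y.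
\<close>

definition extensions :: "('o, 'm) cat \<Rightarrow> nat \<Rightarrow> 'o \<Rightarrow> 'o \<Rightarrow> 'm list set" where
  "extensions \<A> n X Y = {fs. length fs = Suc n \<and> Dom \<A> (hd fs) = Y \<and> Cod \<A> (last fs) = X \<and>
     exact \<A> (zero_ends \<A> fs)}"

definition extension_morphism ::
  "('o, 'm) cat \<Rightarrow> nat \<Rightarrow> 'o \<Rightarrow> 'o \<Rightarrow> 'm list \<Rightarrow> 'm list \<Rightarrow> bool" where
  "extension_morphism \<A> n X Y fs gs \<longleftrightarrow> (\<exists>h :: nat \<Rightarrow> 'm.
     h 0 = Ident \<A> Y \<and> h (Suc n) = Ident \<A> X \<and>
     (\<forall>i \<le> n. h i \<in> Hom \<A> (Dom \<A> (fs ! i)) (Dom \<A> (gs ! i)) \<and>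
        h (Suc i) \<cdot>\<^bsub>\<A>\<^esub> fs ! i = gs ! i \<cdot>\<^bsub>\<A>\<^esub> h i))"

definition extension_rel :: "('o, 'm) cat \<Rightarrow> nat \<Rightarrow> 'o \<Rightarrow> 'o \<Rightarrow> ('m list \<times> 'm list) set" where
  "extension_rel \<A> n X Y = {(fs, gs). fs \<in> extensions \<A> n X Y \<and> gs \<in> extensions \<A> n X Y \<and>
     extension_morphism \<A> n X Y fs gs}"

definition Ext :: "('o, 'm) cat \<Rightarrow> nat \<Rightarrow> 'o \<Rightarrow> 'o \<Rightarrow> 'm list set set" where
  "Ext \<A> n X Y =
     extensions \<A> n X Y // (extension_rel \<A> n X Y \<union> (extension_rel \<A> n X Y)\<inverse>)\<^sup>*"

text \<open>
  The Baer sum makes Ext an abelian group; it is not needed here, because a group is trivial exactly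
  if its underlying set is a singleton.
\<close>

definition Ext_zero :: "('o, 'm) cat \<Rightarrow> nat \<Rightarrow> 'o \<Rightarrow> 'o \<Rightarrow> bool" where
  "Ext_zero \<A> n X Y \<longleftrightarrow> is_singleton (Ext \<A> n X Y)"

definition ext_orthogonal :: "('o, 'm) cat \<Rightarrow> 'o set \<Rightarrow> 'o set \<Rightarrow> bool" where
  "ext_orthogonal \<A> \<X> \<Y> \<longleftrightarrow> (\<forall>X \<in> \<X>. \<forall>Y \<in> \<Y>. \<forall>i \<ge> 1. Ext_zero \<A> i X Y)"

definition right_perp1 :: "('o, 'm) cat \<Rightarrow> 'o set \<Rightarrow> 'o set" where
  "right_perp1 \<A> \<X> = {M \<in> Ob \<A>. \<forall>X \<in> \<X>. Ext_zero \<A> 1 X M}"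


section \<open>Generators, Gorenstein subcategories, special precovers, resolving subcategories\<close>

definition generator :: "('o, 'm) cat \<Rightarrow> 'o set \<Rightarrow> 'o set \<Rightarrow> bool" where
  "generator \<A> \<X> \<T> \<longleftrightarrow> \<X> \<subseteq> \<T> \<and>
     (\<forall>T \<in> \<T>. \<exists>f g. short_exact \<A> f g \<and> Dom \<A> f \<in> \<T> \<and> Dom \<A> g \<in> \<X> \<and> Cod \<A> g = T)"

text \<open>
  The differential \<open>d 0\<close> is the map from \<open>C\<^sub>0\<close> to \<open>C\<^sup>0\<close>; thus \<open>C\<^sub>i\<close> is the domain of \<open>d (- i)\<close> and
  \<open>C\<^sup>i\<close> the domain of \<open>d (i + 1)\<close>.
\<close>

definition Gorenstein :: "('o, 'm) cat \<Rightarrow> 'o set \<Rightarrow> 'o set" where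
  "Gorenstein \<A> \<C> = {M \<in> Ob \<A>. \<exists>d :: int \<Rightarrow> 'm.
     (\<forall>i. Dom \<A> (d i) \<in> \<C>) \<and>
     (\<forall>i. exact_at \<A> (d i) (d (i + 1))) \<and>
     (\<forall>E \<in> \<C>. \<forall>i. Hom_exact_at \<A> E (d i) (d (i + 1))) \<and>
     (\<forall>E \<in> \<C>. \<forall>i. Hom_op_exact_at \<A> E (d i) (d (i + 1))) \<and>
     (\<exists>k. is_image \<A> k (d 0) \<and> isomorphic \<A> M (Dom \<A> k))}"

definition precover :: "('o, 'm) cat \<Rightarrow> 'o set \<Rightarrow> 'm \<Rightarrow> 'o \<Rightarrow> bool" where
  "precover \<A> \<X> f Y \<longleftrightarrow> f \<in> Arr \<A> \<and> Dom \<A> f \<in> \<X> \<and> Cod \<A> f = Y \<and>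
     (\<forall>X' \<in> \<X>. (\<lambda>h. f \<cdot>\<^bsub>\<A>\<^esub> h) ` Hom \<A> X' (Dom \<A> f) = Hom \<A> X' Y)"

definition special_precover :: "('o, 'm) cat \<Rightarrow> 'o set \<Rightarrow> 'm \<Rightarrow> 'o \<Rightarrow> bool" where
  "special_precover \<A> \<X> f Y \<longleftrightarrow> precover \<A> \<X> f Y \<and> epic \<A> f \<and>
     (\<exists>k. is_kernel \<A> k f \<and> Dom \<A> k \<in> right_perp1 \<A> \<X>)"

definition SPC :: "('o, 'm) cat \<Rightarrow> 'o set \<Rightarrow> 'o set" where
  "SPC \<A> \<X> = {Y \<in> Ob \<A>. \<exists>f. special_precover \<A> \<X> f Y}"

definition proper_generator :: "('o, 'm) cat \<Rightarrow> 'o set \<Rightarrow> 'o set \<Rightarrow> 'o set \<Rightarrow> bool" where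
  "proper_generator \<A> \<E> \<X> \<T> \<longleftrightarrow> \<X> \<subseteq> \<T> \<and>
     (\<forall>T \<in> \<T>. \<exists>f g. proper_short_exact \<A> \<E> f g \<and>
        Dom \<A> f \<in> \<T> \<and> Dom \<A> g \<in> \<X> \<and> Cod \<A> g = T)"

definition resolving :: "('o, 'm) cat \<Rightarrow> 'o set \<Rightarrow> 'o set \<Rightarrow> bool" where
  "resolving \<A> \<E> \<T> \<longleftrightarrow> subcategory \<A> \<T> \<and>
     (\<exists>\<X>. subcategory \<A> \<X> \<and> proper_generator \<A> \<E> \<X> \<T>) \<and>
     (\<forall>f g. proper_short_exact \<A> \<E> f g \<and> Dom \<A> f \<in> \<T> \<and> Cod \<A> g \<in> \<T> \<longrightarrow> Dom \<A> g \<in> \<T>) \<and>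
     (\<forall>f g. proper_short_exact \<A> \<E> f g \<and> Dom \<A> g \<in> \<T> \<and> Cod \<A> g \<in> \<T> \<longrightarrow> Dom \<A> f \<in> \<T>)"

end

theory Submission
  imports Defs
begin

text \<open>
  If \<open>G' \<rightarrow> C \<rightarrow> G\<close> is one step of a resolution of a Gorenstein object, self-orthogonality of \<open>\<C>\<close> gives
  \<open>Ext\<^sup>1(\<G>, \<C>) = 0 = Ext\<^sup>1(\<C>, \<G>)\<close>, and \<open>\<G>\<close> is the largest class of objects with this property that is
  closed under steps of resolutions and coresolutions by \<open>\<C>\<close>. By the horseshoe lemma it is therefore
  closed under extensions. Write \<open>\<R> = \<G>\<^sup>\<bottom>\<close> and let T be an object with a special precover \<open>K \<rightarrow> G \<rightarrow> T\<close>.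

  The composite \<open>C \<rightarrow> G \<rightarrow> T\<close> is \<open>\<C>\<close>-proper, and its kernel is an extension of \<open>K \<in> \<R>\<close> by \<open>G'\<close>; since K is a
  quotient of an object of \<open>\<C>\<close> with kernel in \<open>\<R>\<close>, a pullback gives a special precover of this kernel.
  For a \<open>\<C>\<close>-proper extension of T by X, pull back to an extension B of G by X. Properness
  exhibits B as the pushout of \<open>G' \<rightarrow> C\<close> along a map \<open>G' \<rightarrow> X\<close>. This map lifts to the special precover of X,
  and the pushout along the lift is a special precover of B, of which the extension is the quotient
  by \<open>K \<in> \<R>\<close>. Finally, if \<open>X \<rightarrow> Y \<rightarrow> Z\<close> is \<open>\<C>\<close>-proper and \<open>N \<rightarrow> C \<rightarrow> Z\<close> is as in the first step, then
  \<open>X \<oplus> C\<close> is a \<open>\<C>\<close>-proper extension of Y by N, and X is its quotient by \<open>C \<in> \<R>\<close>.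
\<close>

section \<open>Abelian categories\<close>

text \<open>The category may lack enough projectives and injectives, so Ext^1 is not computed from
  resolutions. Its vanishing is read as the splitting of short exact sequences; pulling back or
  pushing out along a morphism turns a splitting into a lift or an extension of that morphism. A
  special precover is likewise handled as a bare short exact sequence with kernel in \<R> and middle
  term in \<G>. The obstacle in the extension step is that a morphism into X is guaranteed to lift
  to the special precover of X only if it starts at an object of \<G>. An extension of G by X is not
  such a morphism, but properness encodes it as a morphism from the syzygy G', which is. A direct
  treatment of kernels would have to compare special precovers of Y and Z and control the kernel of
  the comparison; the detour through X \<oplus> C leaves only an extension step and a quotient
  step.\<close>

lemma Hom_iff [simp]: "f \<in> Hom \<A> X Y \<longleftrightarrow> f \<in> Arr \<A> \<and> Dom \<A> f = X \<and> Cod \<A> f = Y"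
  by (simp add: Hom_def)

context category
begin

lemma Ob_Dom_Cod [simp]: "f \<in> Arr \<A> \<Longrightarrow> Dom \<A> f \<in> Ob \<A>" "f \<in> Arr \<A> \<Longrightarrow> Cod \<A> f \<in> Ob \<A>"
  by (auto intro: Dom_Ob Cod_Ob)

lemma Ident_simps [simp]:
  assumes "X \<in> Ob \<A>"
  shows "Ident \<A> X \<in> Arr \<A>" "Dom \<A> (Ident \<A> X) = X" "Cod \<A> (Ident \<A> X) = X"
  using Ident_Hom[OF assms] by simp_all

lemma Comp_simps [simp]:
  assumes "f \<in> Arr \<A>" "g \<in> Arr \<A>" "Cod \<A> f = Dom \<A> g"
  shows "g \<cdot> f \<in> Arr \<A>" "Dom \<A> (g \<cdot> f) = Dom \<A> f" "Cod \<A> (g \<cdot> f) = Cod \<A> g"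
  using Comp_Hom[of f "Dom \<A> f" "Dom \<A> g" g "Cod \<A> g"] assms by simp_all

lemma Comp_assoc_simp [simp]:
  assumes "f \<in> Arr \<A>" "g \<in> Arr \<A>" "h \<in> Arr \<A>" "Cod \<A> f = Dom \<A> g" "Cod \<A> g = Dom \<A> h"
  shows "(h \<cdot> g) \<cdot> f = h \<cdot> (g \<cdot> f)"
  using Comp_assoc[of f "Dom \<A> f" "Dom \<A> g" g "Dom \<A> h" h "Cod \<A> h"] assms by simp

lemma Comp_Ident_simps [simp]:
  assumes "f \<in> Arr \<A>"
  shows "Dom \<A> f = X \<Longrightarrow> f \<cdot> Ident \<A> X = f" "Cod \<A> f = Y \<Longrightarrow> Ident \<A> Y \<cdot> f = f"
  using Comp_Ident_left[of f] Comp_Ident_right[of f] assms by auto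

text \<open>The simplifier keeps composites right-associated, so an equation for
  \<open>g \<cdot> f\<close> does not match inside \<open>g \<cdot> (f \<cdot> x)\<close>. This form
  supplies the missing rewrite rule for the commuting squares below.\<close>

lemma Comp_reassoc:
  assumes "g \<cdot> f = k" "f \<in> Arr \<A>" "g \<in> Arr \<A>" "Cod \<A> f = Dom \<A> g"
    "x \<in> Arr \<A>" "Cod \<A> x = Dom \<A> f"
  shows "g \<cdot> (f \<cdot> x) = k \<cdot> x"
  using Comp_assoc_simp[of x f g] assms by simp

end

section \<open>Arithmetic of morphisms\<close>

context preadditive_category
begin

lemma Zero_simps [simp]:
  assumes "X \<in> Ob \<A>" "Y \<in> Ob \<A>"
  shows "Zero \<A> X Y \<in> Arr \<A>" "Dom \<A> (Zero \<A> X Y) = X" "Cod \<A> (Zero \<A> X Y) = Y"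
  using monoid.one_closed[OF group.is_monoid[OF comm_group.axioms(2)[OF Hom_comm_group[OF assms]]]]
  by (simp_all add: hom_group_def)

lemma Add_simps [simp]:
  assumes "f \<in> Arr \<A>" "g \<in> Arr \<A>" "Dom \<A> f = Dom \<A> g" "Cod \<A> f = Cod \<A> g"
  shows "Add \<A> f g \<in> Arr \<A>" "Dom \<A> (Add \<A> f g) = Dom \<A> g" "Cod \<A> (Add \<A> f g) = Cod \<A> g"
  using monoid.m_closed[OF group.is_monoid[OF comm_group.axioms(2)[OF
    Hom_comm_group[of "Dom \<A> g" "Cod \<A> g"]]], of f g] assms
  by (simp_all add: hom_group_def)

lemma Add_Zero [simp]:
  assumes "f \<in> Arr \<A>" "Dom \<A> f = X" "Cod \<A> f = Y"
  shows "Add \<A> f (Zero \<A> X Y) = f" "Add \<A> (Zero \<A> X Y) f = f"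
proof -
  interpret comm_group "hom_group \<A> X Y" using Hom_comm_group assms by fastforce
  show "Add \<A> f (Zero \<A> X Y) = f" "Add \<A> (Zero \<A> X Y) f = f"
    using r_one[of f] l_one[of f] assms by (simp_all add: hom_group_def)
qed

lemma Add_assoc:
  assumes "f \<in> Arr \<A>" "g \<in> Arr \<A>" "h \<in> Arr \<A>"
    "Dom \<A> f = Dom \<A> h" "Cod \<A> f = Cod \<A> h" "Dom \<A> g = Dom \<A> h" "Cod \<A> g = Cod \<A> h"
  shows "Add \<A> (Add \<A> f g) h = Add \<A> f (Add \<A> g h)"
proof -
  interpret comm_group "hom_group \<A> (Dom \<A> h) (Cod \<A> h)" using Hom_comm_group assms by fastforce
  show ?thesis using m_assoc[of f g h] assms by (simp add: hom_group_def)
qed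

lemma Add_commute:
  assumes "f \<in> Arr \<A>" "g \<in> Arr \<A>" "Dom \<A> f = Dom \<A> g" "Cod \<A> f = Cod \<A> g"
  shows "Add \<A> f g = Add \<A> g f"
proof -
  interpret comm_group "hom_group \<A> (Dom \<A> g) (Cod \<A> g)" using Hom_comm_group assms by fastforce
  show ?thesis using m_comm[of f g] assms by (simp add: hom_group_def)
qed

definition neg :: "'b \<Rightarrow> 'b" where
  "neg f = inv\<^bsub>hom_group \<A> (Dom \<A> f) (Cod \<A> f)\<^esub> f"

lemma neg_simps [simp]:
  assumes "f \<in> Arr \<A>"
  shows "neg f \<in> Arr \<A>" "Dom \<A> (neg f) = Dom \<A> f" "Cod \<A> (neg f) = Cod \<A> f"
    "\<lbrakk>Dom \<A> f = X; Cod \<A> f = Y\<rbrakk> \<Longrightarrow> Add \<A> f (neg f) = Zero \<A> X Y"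
    "\<lbrakk>Dom \<A> f = X; Cod \<A> f = Y\<rbrakk> \<Longrightarrow> Add \<A> (neg f) f = Zero \<A> X Y"
proof -
  interpret comm_group "hom_group \<A> (Dom \<A> f) (Cod \<A> f)" using Hom_comm_group assms by fastforce
  show "neg f \<in> Arr \<A>" "Dom \<A> (neg f) = Dom \<A> f" "Cod \<A> (neg f) = Cod \<A> f"
    "\<lbrakk>Dom \<A> f = X; Cod \<A> f = Y\<rbrakk> \<Longrightarrow> Add \<A> f (neg f) = Zero \<A> X Y"
    "\<lbrakk>Dom \<A> f = X; Cod \<A> f = Y\<rbrakk> \<Longrightarrow> Add \<A> (neg f) f = Zero \<A> X Y"
    using inv_closed[of f] r_inv[of f] l_inv[of f] assms by (simp_all add: hom_group_def neg_def)
qed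

lemma neg_unique:
  assumes "f \<in> Arr \<A>" "g \<in> Arr \<A>" "Dom \<A> f = X" "Cod \<A> f = Y" "Dom \<A> g = X" "Cod \<A> g = Y"
    and "Add \<A> f g = Zero \<A> X Y"
  shows "g = neg f"
proof -
  have "g = Add \<A> (Add \<A> (neg f) f) g" using assms by simp
  also have "\<dots> = Add \<A> (neg f) (Add \<A> f g)" using assms by (subst Add_assoc) simp_all
  finally show ?thesis using assms by simp
qed

lemma Comp_distrib [simp]:
  assumes "f \<in> Arr \<A>" "f' \<in> Arr \<A>" "g \<in> Arr \<A>" "Cod \<A> f = Dom \<A> g"
    "Dom \<A> f = Dom \<A> f'" "Cod \<A> f = Cod \<A> f'"
  shows "g \<cdot> Add \<A> f f' = Add \<A> (g \<cdot> f) (g \<cdot> f')"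
  using Comp_Add_right[of f "Dom \<A> f" "Cod \<A> f" f' g "Cod \<A> g"] assms by simp

lemma Comp_distrib' [simp]:
  assumes "g \<in> Arr \<A>" "g' \<in> Arr \<A>" "f \<in> Arr \<A>" "Cod \<A> f = Dom \<A> g"
    "Dom \<A> g = Dom \<A> g'" "Cod \<A> g = Cod \<A> g'"
  shows "Add \<A> g g' \<cdot> f = Add \<A> (g \<cdot> f) (g' \<cdot> f)"
  using Comp_Add_left[of f "Dom \<A> f" "Cod \<A> f" g "Cod \<A> g" g'] assms by simp

lemma Add_idem_Zero:
  assumes "f \<in> Arr \<A>" "Add \<A> f f = f"
  shows "f = Zero \<A> (Dom \<A> f) (Cod \<A> f)"
proof -
  have "Add \<A> (Add \<A> f f) (neg f) = Add \<A> f (Add \<A> f (neg f))"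
    using assms(1) by (subst Add_assoc) simp_all
  then show ?thesis using assms by simp
qed

text \<open>Absorption by zero is not among the axioms: bilinearity makes the composite additively
  idempotent, and the only idempotent of a group is its unit.\<close>

lemma Comp_Zero [simp]:
  assumes "g \<in> Arr \<A>" "X \<in> Ob \<A>" "Dom \<A> g = Y"
  shows "g \<cdot> Zero \<A> X Y = Zero \<A> X (Cod \<A> g)"
proof -
  have "g \<cdot> Add \<A> (Zero \<A> X Y) (Zero \<A> X Y) = Add \<A> (g \<cdot> Zero \<A> X Y) (g \<cdot> Zero \<A> X Y)"
    using assms by (subst Comp_distrib) auto
  then show ?thesis using Add_idem_Zero[of "g \<cdot> Zero \<A> X Y"] assms by auto
qed

lemma Comp_Zero' [simp]:
  assumes "f \<in> Arr \<A>" "Z \<in> Ob \<A>" "Cod \<A> f = Y"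
  shows "Zero \<A> Y Z \<cdot> f = Zero \<A> (Dom \<A> f) Z"
proof -
  have "Add \<A> (Zero \<A> Y Z) (Zero \<A> Y Z) \<cdot> f = Add \<A> (Zero \<A> Y Z \<cdot> f) (Zero \<A> Y Z \<cdot> f)"
    using assms by (subst Comp_distrib') auto
  then show ?thesis using Add_idem_Zero[of "Zero \<A> Y Z \<cdot> f"] assms by auto
qed

lemma Comp_neg [simp]:
  assumes "f \<in> Arr \<A>" "g \<in> Arr \<A>" "Cod \<A> f = Dom \<A> g"
  shows "g \<cdot> neg f = neg (g \<cdot> f)" "neg g \<cdot> f = neg (g \<cdot> f)"
proof -
  have "Add \<A> (g \<cdot> f) (g \<cdot> neg f) = g \<cdot> Add \<A> f (neg f)"
    \<comment> \<open>\<open>neg_simps(4)\<close> would collapse the sum to zero before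
      distributivity can apply.\<close>
    using assms by (simp del: neg_simps(4))
  then show "g \<cdot> neg f = neg (g \<cdot> f)"
    using assms by (intro neg_unique[where X = "Dom \<A> f" and Y = "Cod \<A> g"]) auto
  have "Add \<A> (g \<cdot> f) (neg g \<cdot> f) = Add \<A> g (neg g) \<cdot> f"
    using assms by (simp del: neg_simps(4))
  then show "neg g \<cdot> f = neg (g \<cdot> f)"
    using assms by (intro neg_unique[where X = "Dom \<A> f" and Y = "Cod \<A> g"]) auto
qed

lemma neg_Zero [simp]:
  assumes "X \<in> Ob \<A>" "Y \<in> Ob \<A>"
  shows "neg (Zero \<A> X Y) = Zero \<A> X Y"
  using neg_unique[of "Zero \<A> X Y" "Zero \<A> X Y" X Y] assms by simp

lemma neg_neg [simp]: "f \<in> Arr \<A> \<Longrightarrow> neg (neg f) = f"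
  using neg_unique[of "neg f" f "Dom \<A> f" "Cod \<A> f"] by simp

lemma Add_neg_eq_Zero:
  assumes "f \<in> Arr \<A>" "g \<in> Arr \<A>" "Dom \<A> f = X" "Cod \<A> f = Y" "Dom \<A> g = X" "Cod \<A> g = Y"
  shows "Add \<A> f (neg g) = Zero \<A> X Y \<longleftrightarrow> f = g"
  using neg_unique[of "f" "neg g" X Y] assms neg_neg by (metis neg_simps)

end

section \<open>Duality\<close>

text \<open>The axioms of an abelian category are self-dual, so every lemma of the locale can be
  instantiated at the opposite category. The simp rules that follow translate the result back, and
  most dual statements are obtained in this way.\<close>

definition op_cat :: "('o, 'm) cat \<Rightarrow> ('o, 'm) cat" where
  "op_cat \<A> = \<lparr>Ob = Ob \<A>, Arr = Arr \<A>, Dom = Cod \<A>, Cod = Dom \<A>, Ident = Ident \<A>,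
     Comp = (\<lambda>g f. Comp \<A> f g), Add = Add \<A>, Zero = (\<lambda>X Y. Zero \<A> Y X)\<rparr>"

lemma op_cat_simps [simp]:
  "Ob (op_cat \<A>) = Ob \<A>" "Arr (op_cat \<A>) = Arr \<A>" "Dom (op_cat \<A>) = Cod \<A>"
  "Cod (op_cat \<A>) = Dom \<A>" "Ident (op_cat \<A>) = Ident \<A>" "Comp (op_cat \<A>) g f = Comp \<A> f g"
  "Add (op_cat \<A>) = Add \<A>" "Zero (op_cat \<A>) X Y = Zero \<A> Y X"
  "hom_group (op_cat \<A>) X Y = hom_group \<A> Y X"
  "Hom (op_cat \<A>) X Y = Hom \<A> Y X"
  by (auto simp: op_cat_def hom_group_def Hom_def)

lemma op_cat_iffs [simp]:
  "is_kernel (op_cat \<A>) k f \<longleftrightarrow> is_cokernel \<A> k f"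
  "is_cokernel (op_cat \<A>) k f \<longleftrightarrow> is_kernel \<A> k f"
  "monic (op_cat \<A>) f \<longleftrightarrow> epic \<A> f"
  "epic (op_cat \<A>) f \<longleftrightarrow> monic \<A> f"
  "is_biproduct (op_cat \<A>) X Y S p\<^sub>1 p\<^sub>2 i\<^sub>1 i\<^sub>2 \<longleftrightarrow> is_biproduct \<A> X Y S i\<^sub>1 i\<^sub>2 p\<^sub>1 p\<^sub>2"
  by (simp_all add: is_kernel_def is_cokernel_def monic_def epic_def is_biproduct_def conj_ac
    del: Hom_iff)

lemma is_zero_object_op_cat [simp]: "is_zero_object (op_cat \<A>) Z \<longleftrightarrow> is_zero_object \<A> Z"
  by (auto simp: is_zero_object_def simp del: Hom_iff)

lemma (in abelian_category) abelian_category_op_cat: "abelian_category (op_cat \<A>)"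
proof (intro abelian_category.intro preadditive_category.intro category.intro
    preadditive_category_axioms.intro abelian_category_axioms.intro)
  show "\<exists>Z. is_zero_object (op_cat \<A>) Z" using ex_zero_object by simp
  show "\<exists>S i\<^sub>1 i\<^sub>2 p\<^sub>1 p\<^sub>2. is_biproduct (op_cat \<A>) X Y S i\<^sub>1 i\<^sub>2 p\<^sub>1 p\<^sub>2"
    if "X \<in> Ob (op_cat \<A>)" "Y \<in> Ob (op_cat \<A>)" for X Y
    using ex_biproduct[of X Y] that op_cat_iffs(5) by fastforce
qed (simp_all add: ex_kernel ex_cokernel monic_normal epic_normal Hom_comm_group)

section \<open>Short exact sequences\<close>

text \<open>Naming all three objects and demanding both universal properties makes the notion
  symmetric under duality and independent of the chosen zero object that \<open>zero_ends\<close>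
  inserts. Agreement with \<open>short_exact\<close> is \<open>short_exact_iff\<close>.\<close>

definition SES :: "('o, 'm) cat \<Rightarrow> 'o \<Rightarrow> 'm \<Rightarrow> 'o \<Rightarrow> 'm \<Rightarrow> 'o \<Rightarrow> bool" where
  "SES \<A> X f Y g Z \<longleftrightarrow>
     f \<in> Hom \<A> X Y \<and> g \<in> Hom \<A> Y Z \<and> is_kernel \<A> f g \<and> is_cokernel \<A> g f"

lemma SES_op_cat [simp]: "SES (op_cat \<A>) Z g Y f X \<longleftrightarrow> SES \<A> X f Y g Z"
  by (auto simp: SES_def)

lemma is_kernel_lift:
  assumes "is_kernel \<A> k f" "h \<in> Arr \<A>" "Cod \<A> h = Dom \<A> f"
    "f \<cdot>\<^bsub>\<A>\<^esub> h = Zero \<A> (Dom \<A> h) (Cod \<A> f)"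
  shows "\<exists>!u. u \<in> Hom \<A> (Dom \<A> h) (Dom \<A> k) \<and> k \<cdot>\<^bsub>\<A>\<^esub> u = h"
proof -
  have "h \<in> Hom \<A> (Dom \<A> h) (Dom \<A> f)" using assms by simp
  then show ?thesis using assms(1,4) unfolding is_kernel_def by blast
qed

context abelian_category
begin

lemma SES_simps:
  assumes "SES \<A> X f Y g Z"
  shows "f \<in> Arr \<A>" "Dom \<A> f = X" "Cod \<A> f = Y" "g \<in> Arr \<A>" "Dom \<A> g = Y" "Cod \<A> g = Z"
    "g \<cdot> f = Zero \<A> X Z" "X \<in> Ob \<A>" "Y \<in> Ob \<A>" "Z \<in> Ob \<A>"
    "\<lbrakk>u \<in> Arr \<A>; Cod \<A> u = X\<rbrakk> \<Longrightarrow> g \<cdot> (f \<cdot> u) = Zero \<A> (Dom \<A> u) Z"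
proof -
  show *: "f \<in> Arr \<A>" "Dom \<A> f = X" "Cod \<A> f = Y" "g \<in> Arr \<A>" "Dom \<A> g = Y" "Cod \<A> g = Z"
    "g \<cdot> f = Zero \<A> X Z"
    using assms by (auto simp: SES_def is_kernel_def)
  then show "X \<in> Ob \<A>" "Y \<in> Ob \<A>" "Z \<in> Ob \<A>"
    by auto
  then show "\<lbrakk>u \<in> Arr \<A>; Cod \<A> u = X\<rbrakk> \<Longrightarrow> g \<cdot> (f \<cdot> u) = Zero \<A> (Dom \<A> u) Z"
    using * by (simp add: Comp_reassoc)
qed

lemma SES_mono:
  assumes "SES \<A> X f Y g Z" "u \<in> Arr \<A>" "v \<in> Arr \<A>" "Cod \<A> u = X" "Cod \<A> v = X" "f \<cdot> u = f \<cdot> v"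
  shows "u = v"
proof -
  note [simp] = SES_simps[OF assms(1)]
  have d: "Dom \<A> u = Dom \<A> v"
    using assms Comp_simps(2)[of u f] Comp_simps(2)[of v f] by simp
  have "\<exists>!w. w \<in> Hom \<A> (Dom \<A> u) (Dom \<A> f) \<and> f \<cdot> w = f \<cdot> u"
    using assms(1-5) d unfolding SES_def is_kernel_def by auto
  then show ?thesis using assms d by auto
qed

lemma SES_mono_Zero:
  assumes "SES \<A> X f Y g Z" "u \<in> Arr \<A>" "Cod \<A> u = X" "f \<cdot> u = Zero \<A> (Dom \<A> u) Y"
  shows "u = Zero \<A> (Dom \<A> u) X"
  by (rule SES_mono[OF assms(1)]) (use assms SES_simps[OF assms(1)] in simp_all)

lemma SES_lift:
  assumes "SES \<A> X f Y g Z" "h \<in> Arr \<A>" "Cod \<A> h = Y" "g \<cdot> h = Zero \<A> (Dom \<A> h) Z"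
  obtains u where "u \<in> Arr \<A>" "Dom \<A> u = Dom \<A> h" "Cod \<A> u = X" "f \<cdot> u = h"
proof -
  note [simp] = SES_simps[OF assms(1)]
  have "\<exists>!u. u \<in> Hom \<A> (Dom \<A> h) (Dom \<A> f) \<and> f \<cdot> u = h"
    using assms unfolding SES_def is_kernel_def by auto
  then show ?thesis using that by auto
qed

lemma SES_epi:
  assumes "SES \<A> X f Y g Z" "u \<in> Arr \<A>" "v \<in> Arr \<A>" "Dom \<A> u = Z" "Dom \<A> v = Z" "u \<cdot> g = v \<cdot> g"
  shows "u = v"
  using abelian_category.SES_mono[OF abelian_category_op_cat, of Z g Y f X u v] assms by simp

lemma SES_epi_Zero:
  assumes "SES \<A> X f Y g Z" "u \<in> Arr \<A>" "Dom \<A> u = Z" "u \<cdot> g = Zero \<A> Y (Cod \<A> u)"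
  shows "u = Zero \<A> Z (Cod \<A> u)"
  using abelian_category.SES_mono_Zero[OF abelian_category_op_cat, of Z g Y f X u] assms by simp

lemma SES_desc:
  assumes "SES \<A> X f Y g Z" "h \<in> Arr \<A>" "Dom \<A> h = Y" "h \<cdot> f = Zero \<A> X (Cod \<A> h)"
  obtains u where "u \<in> Arr \<A>" "Dom \<A> u = Z" "Cod \<A> u = Cod \<A> h" "u \<cdot> g = h"
  using abelian_category.SES_lift[OF abelian_category_op_cat, of Z g Y f X h] assms by auto

lemma SES_epic: "SES \<A> X f Y g Z \<Longrightarrow> epic \<A> g"
  using SES_epi[of X f Y g Z] SES_simps[of X f Y g Z] unfolding epic_def by auto

lemma epic_cancel:
  assumes "epic \<A> g" "u \<in> Arr \<A>" "v \<in> Arr \<A>" "Dom \<A> u = Cod \<A> g" "Dom \<A> v = Cod \<A> g"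
    "Cod \<A> u = Cod \<A> v" "u \<cdot> g = v \<cdot> g"
  shows "u = v"
proof -
  have "u \<in> Hom \<A> (Cod \<A> g) (Cod \<A> v)" "v \<in> Hom \<A> (Cod \<A> g) (Cod \<A> v)" using assms by simp_all
  then show ?thesis using assms(1,7) unfolding epic_def by blast
qed

text \<open>The difference of two morphisms that agree after \<open>g\<close> is annihilated by
  \<open>g\<close>, so testing against zero is enough.\<close>

lemma epicI_Zero:
  assumes "g \<in> Arr \<A>"
    and "\<And>x. \<lbrakk>x \<in> Arr \<A>; Dom \<A> x = Cod \<A> g; x \<cdot> g = Zero \<A> (Dom \<A> g) (Cod \<A> x)\<rbrakk>
      \<Longrightarrow> x = Zero \<A> (Cod \<A> g) (Cod \<A> x)"
  shows "epic \<A> g"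
  unfolding epic_def
proof (intro conjI allI ballI impI)
  fix W u v
  assume *: "u \<in> Hom \<A> (Cod \<A> g) W" "v \<in> Hom \<A> (Cod \<A> g) W" "u \<cdot> g = v \<cdot> g"
  have "Add \<A> u (neg v) = Zero \<A> (Cod \<A> g) W"
    using assms(2)[of "Add \<A> u (neg v)"] assms(1) * by auto
  then show "u = v" using Add_neg_eq_Zero[of u v] * by simp
qed (use assms in simp)

text \<open>The cokernel property comes from normality of epimorphisms: \<open>g\<close> is the
  cokernel of some \<open>k\<close>, which factors through \<open>f\<close> by \<open>lift\<close>.
  Whatever annihilates \<open>f\<close> therefore annihilates \<open>k\<close> and descends along
  \<open>g\<close>.\<close>

lemma SESI:
  assumes f: "f \<in> Arr \<A>" "Dom \<A> f = X" "Cod \<A> f = Y"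
    and g: "g \<in> Arr \<A>" "Dom \<A> g = Y" "Cod \<A> g = Z"
    and gf: "g \<cdot> f = Zero \<A> X Z"
    and mono: "\<And>u. \<lbrakk>u \<in> Arr \<A>; Cod \<A> u = X; f \<cdot> u = Zero \<A> (Dom \<A> u) Y\<rbrakk> \<Longrightarrow> u = Zero \<A> (Dom \<A> u) X"
    and lift: "\<And>h. \<lbrakk>h \<in> Arr \<A>; Cod \<A> h = Y; g \<cdot> h = Zero \<A> (Dom \<A> h) Z\<rbrakk>
      \<Longrightarrow> \<exists>u. u \<in> Arr \<A> \<and> Dom \<A> u = Dom \<A> h \<and> Cod \<A> u = X \<and> f \<cdot> u = h"
    and epi: "\<And>x. \<lbrakk>x \<in> Arr \<A>; Dom \<A> x = Z; x \<cdot> g = Zero \<A> Y (Cod \<A> x)\<rbrakk> \<Longrightarrow> x = Zero \<A> Z (Cod \<A> x)"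
  shows "SES \<A> X f Y g Z"
proof -
  note [simp] = f g gf
  have "u = v" if "u \<in> Arr \<A>" "v \<in> Arr \<A>" "Cod \<A> u = X" "Cod \<A> v = X" "Dom \<A> u = Dom \<A> v" "f \<cdot> u = f \<cdot> v" for u v
  proof -
    have "f \<cdot> Add \<A> u (neg v) = Zero \<A> (Dom \<A> v) Y" using that by simp
    then have "Add \<A> u (neg v) = Zero \<A> (Dom \<A> v) X" using mono[of "Add \<A> u (neg v)"] that by simp
    then show ?thesis using Add_neg_eq_Zero[of u v] that by simp
  qed
  then have ker: "is_kernel \<A> f g"
    unfolding is_kernel_def by (auto dest: lift)
  have "epic \<A> g" using epi by (intro epicI_Zero) simp_all
  then obtain k where k: "is_cokernel \<A> g k" using epic_normal by blast
  then have [simp]: "k \<in> Arr \<A>" "Cod \<A> k = Y" "g \<cdot> k = Zero \<A> (Dom \<A> k) Z"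
    by (auto simp: is_cokernel_def)
  obtain w where [simp]: "w \<in> Arr \<A>" "Dom \<A> w = Dom \<A> k" "Cod \<A> w = X" "f \<cdot> w = k"
    using lift[of k] by auto
  have *: "\<exists>!u. u \<in> Hom \<A> Z W \<and> u \<cdot> g = h" if "h \<in> Hom \<A> Y W" "h \<cdot> f = Zero \<A> X W" for h W
  proof -
    have "h \<cdot> k = (h \<cdot> f) \<cdot> w" using that(1) by simp
    then have "h \<cdot> k = Zero \<A> (Dom \<A> k) W"
      unfolding that(2) using that(1) Cod_Ob[of h] Cod_Ob[of w] by simp
    then show ?thesis using k that unfolding is_cokernel_def by simp
  qed
  have "is_cokernel \<A> g f" unfolding is_cokernel_def using * by (simp del: Hom_iff)
  then show ?thesis using ker by (simp add: SES_def)
qed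

lemma SES_kernel_epic:
  assumes "is_kernel \<A> k g" "epic \<A> g"
  shows "SES \<A> (Dom \<A> k) k (Dom \<A> g) g (Cod \<A> g)"
proof -
  have [simp]: "k \<in> Arr \<A>" "g \<in> Arr \<A>" "Cod \<A> k = Dom \<A> g" "g \<cdot> k = Zero \<A> (Dom \<A> k) (Cod \<A> g)"
    using assms unfolding is_kernel_def by auto
  show ?thesis
  proof (rule SESI)
    show "u = Zero \<A> (Dom \<A> u) (Dom \<A> k)"
      if "u \<in> Arr \<A>" "Cod \<A> u = Dom \<A> k" "k \<cdot> u = Zero \<A> (Dom \<A> u) (Dom \<A> g)" for u
    proof -
      have "\<exists>!w. w \<in> Hom \<A> (Dom \<A> u) (Dom \<A> k) \<and> k \<cdot> w = Zero \<A> (Dom \<A> u) (Dom \<A> g)"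
        using assms that(1) unfolding is_kernel_def by simp
      moreover have "k \<cdot> Zero \<A> (Dom \<A> u) (Dom \<A> k) = Zero \<A> (Dom \<A> u) (Dom \<A> g)"
        using that(1) by simp
      moreover have "u \<in> Hom \<A> (Dom \<A> u) (Dom \<A> k)"
        "Zero \<A> (Dom \<A> u) (Dom \<A> k) \<in> Hom \<A> (Dom \<A> u) (Dom \<A> k)"
        using that(1,2) by simp_all
      ultimately show ?thesis using that(3) by blast
    qed
    show "\<exists>u. u \<in> Arr \<A> \<and> Dom \<A> u = Dom \<A> h \<and> Cod \<A> u = Dom \<A> k \<and> k \<cdot> u = h"
      if "h \<in> Arr \<A>" "Cod \<A> h = Dom \<A> g" "g \<cdot> h = Zero \<A> (Dom \<A> h) (Cod \<A> g)" for h
      using is_kernel_lift[OF assms(1) that] by auto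
    show "x = Zero \<A> (Cod \<A> g) (Cod \<A> x)"
      if "x \<in> Arr \<A>" "Dom \<A> x = Cod \<A> g" "x \<cdot> g = Zero \<A> (Dom \<A> g) (Cod \<A> x)" for x
      by (rule epic_cancel[OF assms(2)]) (use that in simp_all)
  qed simp_all
qed

lemma epic_SES: "epic \<A> g \<Longrightarrow> \<exists>X f. SES \<A> X f (Dom \<A> g) g (Cod \<A> g)"
  using SES_kernel_epic[of _ g] ex_kernel[of g] by (auto simp: epic_def[of \<A> g])

lemma monic_SES: "monic \<A> f \<Longrightarrow> \<exists>Z g. SES \<A> (Dom \<A> f) f (Cod \<A> f) g Z"
  using abelian_category.epic_SES[OF abelian_category_op_cat, of f] by simp

lemma SES_split:
  assumes s: "SES \<A> X f Y g Z" "s \<in> Hom \<A> Z Y" "g \<cdot> s = Ident \<A> Z"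
  obtains r where "r \<in> Hom \<A> Y X" "r \<cdot> f = Ident \<A> X" "r \<cdot> s = Zero \<A> Z X"
    "Add \<A> (f \<cdot> r) (s \<cdot> g) = Ident \<A> Y"
proof -
  note [simp] = SES_simps[OF s(1)] s(3) Comp_reassoc[OF s(3)]
  have [simp]: "s \<in> Arr \<A>" "Dom \<A> s = Z" "Cod \<A> s = Y" using s by auto
  \<comment> \<open>The complement of the idempotent \<open>s \<cdot> g\<close> is annihilated by
    \<open>g\<close> and hence factors through \<open>f\<close>; the factor is the
    retraction.\<close>
  let ?h = "Add \<A> (Ident \<A> Y) (neg (s \<cdot> g))"
  obtain r where r: "r \<in> Arr \<A>" "Dom \<A> r = Y" "Cod \<A> r = X" "f \<cdot> r = ?h"
    by (rule SES_lift[OF s(1), of ?h]) simp_all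
  note [simp] = r Comp_reassoc[OF r(4)]
  have "r \<cdot> f = Ident \<A> X" by (rule SES_mono[OF s(1)]) simp_all
  moreover have "r \<cdot> s = Zero \<A> Z X" by (rule SES_mono[OF s(1)]) simp_all
  moreover have "Add \<A> (f \<cdot> r) (s \<cdot> g) = Ident \<A> Y" by (simp add: Add_assoc)
  ultimately show ?thesis using r by (intro that) auto
qed

lemma biproduct_SES:
  assumes "is_biproduct \<A> X Y S i\<^sub>1 i\<^sub>2 p\<^sub>1 p\<^sub>2"
  shows "SES \<A> X i\<^sub>1 S p\<^sub>2 Y"
proof -
  have eq: "p\<^sub>1 \<cdot> i\<^sub>1 = Ident \<A> X" "p\<^sub>2 \<cdot> i\<^sub>2 = Ident \<A> Y"
    "p\<^sub>1 \<cdot> i\<^sub>2 = Zero \<A> Y X" "p\<^sub>2 \<cdot> i\<^sub>1 = Zero \<A> X Y"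
    "Add \<A> (i\<^sub>1 \<cdot> p\<^sub>1) (i\<^sub>2 \<cdot> p\<^sub>2) = Ident \<A> S"
    and [simp]: "i\<^sub>1 \<in> Arr \<A>" "i\<^sub>2 \<in> Arr \<A>" "p\<^sub>1 \<in> Arr \<A>" "p\<^sub>2 \<in> Arr \<A>" "Dom \<A> i\<^sub>1 = X" "Cod \<A> i\<^sub>1 = S"
    "Dom \<A> i\<^sub>2 = Y" "Cod \<A> i\<^sub>2 = S" "Dom \<A> p\<^sub>1 = S" "Cod \<A> p\<^sub>1 = X" "Dom \<A> p\<^sub>2 = S" "Cod \<A> p\<^sub>2 = Y"
    using assms by (auto simp: is_biproduct_def)
  have [simp]: "X \<in> Ob \<A>" "Y \<in> Ob \<A>" "S \<in> Ob \<A>" using Dom_Ob[of i\<^sub>1] Dom_Ob[of i\<^sub>2] Cod_Ob[of i\<^sub>1] by auto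
  note [simp] = eq eq(1-4)[THEN Comp_reassoc]
  show ?thesis
  proof (rule SESI)
    show "u = Zero \<A> (Dom \<A> u) X"
      if "u \<in> Arr \<A>" "Cod \<A> u = X" "i\<^sub>1 \<cdot> u = Zero \<A> (Dom \<A> u) S" for u
    proof -
      have "u = p\<^sub>1 \<cdot> (i\<^sub>1 \<cdot> u)" using that(1,2) by simp
      then show ?thesis unfolding that(3) using that(1) by simp
    qed
    show "x = Zero \<A> Y (Cod \<A> x)"
      if "x \<in> Arr \<A>" "Dom \<A> x = Y" "x \<cdot> p\<^sub>2 = Zero \<A> S (Cod \<A> x)" for x
    proof -
      have "x = (x \<cdot> p\<^sub>2) \<cdot> i\<^sub>2" using that(1,2) by simp
      then show ?thesis unfolding that(3) using that(1) by simp
    qed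
    show "\<exists>u. u \<in> Arr \<A> \<and> Dom \<A> u = Dom \<A> h \<and> Cod \<A> u = X \<and> i\<^sub>1 \<cdot> u = h"
      if h: "h \<in> Arr \<A>" "Cod \<A> h = S" "p\<^sub>2 \<cdot> h = Zero \<A> (Dom \<A> h) Y" for h
    proof (intro exI conjI)
      have "h = Add \<A> (i\<^sub>1 \<cdot> p\<^sub>1) (i\<^sub>2 \<cdot> p\<^sub>2) \<cdot> h" using h(1,2) by simp
      also have "\<dots> = Add \<A> (i\<^sub>1 \<cdot> (p\<^sub>1 \<cdot> h)) (i\<^sub>2 \<cdot> (p\<^sub>2 \<cdot> h))" using h(1,2) by (simp del: eq(5))
      finally show "i\<^sub>1 \<cdot> (p\<^sub>1 \<cdot> h) = h" using h by simp
    qed (use h in simp_all)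
  qed simp_all
qed

end

section \<open>Pullbacks and pushouts\<close>

text \<open>The leg \<open>p\<close> is parallel to \<open>g\<close>, and \<open>q\<close> is
  parallel to \<open>h\<close>. Uniqueness is kept apart from existence as a joint cancellation
  clause, because the proofs use the two separately.\<close>

definition is_pullback :: "('o, 'm) cat \<Rightarrow> 'm \<Rightarrow> 'm \<Rightarrow> 'm \<Rightarrow> 'm \<Rightarrow> bool" where
  "is_pullback \<A> q p g h \<longleftrightarrow> q \<in> Arr \<A> \<and> p \<in> Arr \<A> \<and> g \<in> Arr \<A> \<and> h \<in> Arr \<A> \<and>
     Dom \<A> q = Dom \<A> p \<and> Cod \<A> q = Dom \<A> g \<and> Cod \<A> p = Dom \<A> h \<and> Cod \<A> g = Cod \<A> h \<and>
     g \<cdot>\<^bsub>\<A>\<^esub> q = h \<cdot>\<^bsub>\<A>\<^esub> p \<and>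
     (\<forall>u \<in> Arr \<A>. \<forall>v \<in> Arr \<A>. Cod \<A> u = Dom \<A> p \<and> Cod \<A> v = Dom \<A> p \<and>
        q \<cdot>\<^bsub>\<A>\<^esub> u = q \<cdot>\<^bsub>\<A>\<^esub> v \<and> p \<cdot>\<^bsub>\<A>\<^esub> u = p \<cdot>\<^bsub>\<A>\<^esub> v \<longrightarrow> u = v) \<and>
     (\<forall>x \<in> Arr \<A>. \<forall>y \<in> Arr \<A>. Dom \<A> x = Dom \<A> y \<and> Cod \<A> x = Dom \<A> g \<and> Cod \<A> y = Dom \<A> h \<and>
        g \<cdot>\<^bsub>\<A>\<^esub> x = h \<cdot>\<^bsub>\<A>\<^esub> y \<longrightarrow>
        (\<exists>w \<in> Arr \<A>. Dom \<A> w = Dom \<A> y \<and> Cod \<A> w = Dom \<A> p \<and> q \<cdot>\<^bsub>\<A>\<^esub> w = x \<and> p \<cdot>\<^bsub>\<A>\<^esub> w = y))"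

context abelian_category
begin

lemma pullback_simps:
  assumes "is_pullback \<A> q p g h"
  shows "q \<in> Arr \<A>" "p \<in> Arr \<A>" "g \<in> Arr \<A>" "h \<in> Arr \<A>" "Dom \<A> q = Dom \<A> p"
    "Cod \<A> q = Dom \<A> g" "Cod \<A> p = Dom \<A> h" "Cod \<A> g = Cod \<A> h" "g \<cdot> q = h \<cdot> p"
    "\<lbrakk>u \<in> Arr \<A>; Cod \<A> u = Dom \<A> p\<rbrakk> \<Longrightarrow> g \<cdot> (q \<cdot> u) = h \<cdot> (p \<cdot> u)"
proof -
  show *: "q \<in> Arr \<A>" "p \<in> Arr \<A>" "g \<in> Arr \<A>" "h \<in> Arr \<A>" "Dom \<A> q = Dom \<A> p"
    "Cod \<A> q = Dom \<A> g" "Cod \<A> p = Dom \<A> h" "Cod \<A> g = Cod \<A> h" "g \<cdot> q = h \<cdot> p"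
    using assms unfolding is_pullback_def by simp_all
  show "\<lbrakk>u \<in> Arr \<A>; Cod \<A> u = Dom \<A> p\<rbrakk> \<Longrightarrow> g \<cdot> (q \<cdot> u) = h \<cdot> (p \<cdot> u)"
    using * by (simp add: Comp_reassoc[OF *(9)])
qed

lemma pullback_eqI:
  assumes "is_pullback \<A> q p g h" "u \<in> Arr \<A>" "v \<in> Arr \<A>" "Cod \<A> u = Dom \<A> p" "Cod \<A> v = Dom \<A> p"
    "q \<cdot> u = q \<cdot> v" "p \<cdot> u = p \<cdot> v"
  shows "u = v"
  using assms unfolding is_pullback_def by simp

lemma pullback_lift:
  assumes pb: "is_pullback \<A> q p g h" and *: "x \<in> Arr \<A>" "y \<in> Arr \<A>" "Dom \<A> x = Dom \<A> y"
    "Cod \<A> x = Dom \<A> g" "Cod \<A> y = Dom \<A> h" "g \<cdot> x = h \<cdot> y"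
  obtains w where "w \<in> Arr \<A>" "Dom \<A> w = Dom \<A> y" "Cod \<A> w = Dom \<A> p" "q \<cdot> w = x" "p \<cdot> w = y"
  using pb[unfolded is_pullback_def, THEN conjunct2, THEN conjunct2, THEN conjunct2, THEN conjunct2,
    THEN conjunct2, THEN conjunct2, THEN conjunct2, THEN conjunct2, THEN conjunct2, THEN conjunct2,
    THEN bspec, OF *(1), THEN bspec, OF *(2)] * by blast

lemma pullbackI:
  assumes *: "q \<in> Arr \<A>" "p \<in> Arr \<A>" "g \<in> Arr \<A>" "h \<in> Arr \<A>" "Dom \<A> q = Dom \<A> p"
    "Cod \<A> q = Dom \<A> g" "Cod \<A> p = Dom \<A> h" "Cod \<A> g = Cod \<A> h" "g \<cdot> q = h \<cdot> p"
    and eqI: "\<And>u v. \<lbrakk>u \<in> Arr \<A>; v \<in> Arr \<A>; Cod \<A> u = Dom \<A> p; Cod \<A> v = Dom \<A> p;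
      q \<cdot> u = q \<cdot> v; p \<cdot> u = p \<cdot> v\<rbrakk> \<Longrightarrow> u = v"
    and ex: "\<And>x y. \<lbrakk>x \<in> Arr \<A>; y \<in> Arr \<A>; Dom \<A> x = Dom \<A> y; Cod \<A> x = Dom \<A> g;
      Cod \<A> y = Dom \<A> h; g \<cdot> x = h \<cdot> y\<rbrakk> \<Longrightarrow>
      \<exists>w \<in> Arr \<A>. Dom \<A> w = Dom \<A> y \<and> Cod \<A> w = Dom \<A> p \<and> q \<cdot> w = x \<and> p \<cdot> w = y"
  shows "is_pullback \<A> q p g h"
  unfolding is_pullback_def
proof (intro conjI)
  show "\<forall>u \<in> Arr \<A>. \<forall>v \<in> Arr \<A>. Cod \<A> u = Dom \<A> p \<and> Cod \<A> v = Dom \<A> p \<and>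
      q \<cdot> u = q \<cdot> v \<and> p \<cdot> u = p \<cdot> v \<longrightarrow> u = v"
    by (blast intro: eqI)
  show "\<forall>x \<in> Arr \<A>. \<forall>y \<in> Arr \<A>. Dom \<A> x = Dom \<A> y \<and> Cod \<A> x = Dom \<A> g \<and> Cod \<A> y = Dom \<A> h \<and>
      g \<cdot> x = h \<cdot> y \<longrightarrow>
      (\<exists>w \<in> Arr \<A>. Dom \<A> w = Dom \<A> y \<and> Cod \<A> w = Dom \<A> p \<and> q \<cdot> w = x \<and> p \<cdot> w = y)"
    by (blast intro: ex)
qed (fact *)+

lemma is_pullback_sym:
  assumes pb: "is_pullback \<A> q p g h"
  shows "is_pullback \<A> p q h g"
proof (rule pullbackI)
  note [simp] = pullback_simps[OF pb]
  show "\<exists>w \<in> Arr \<A>. Dom \<A> w = Dom \<A> y \<and> Cod \<A> w = Dom \<A> q \<and> p \<cdot> w = x \<and> q \<cdot> w = y"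
    if "x \<in> Arr \<A>" "y \<in> Arr \<A>" "Dom \<A> x = Dom \<A> y" "Cod \<A> x = Dom \<A> h" "Cod \<A> y = Dom \<A> g"
      "h \<cdot> x = g \<cdot> y" for x y
    by (rule pullback_lift[OF pb, of y x]) (use that in auto)
  show "u = v" if "u \<in> Arr \<A>" "v \<in> Arr \<A>" "Cod \<A> u = Dom \<A> q" "Cod \<A> v = Dom \<A> q"
      "p \<cdot> u = p \<cdot> v" "q \<cdot> u = q \<cdot> v" for u v
    by (rule pullback_eqI[OF pb]) (use that in simp_all)
qed (simp_all add: pullback_simps[OF pb])

lemma biproduct_E:
  assumes "X \<in> Ob \<A>" "Y \<in> Ob \<A>"
  obtains S i\<^sub>1 i\<^sub>2 p\<^sub>1 p\<^sub>2 where "is_biproduct \<A> X Y S i\<^sub>1 i\<^sub>2 p\<^sub>1 p\<^sub>2"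
  using ex_biproduct[OF assms] by blast

lemma biproduct_simps:
  assumes "is_biproduct \<A> X Y S i\<^sub>1 i\<^sub>2 p\<^sub>1 p\<^sub>2"
  shows "i\<^sub>1 \<in> Arr \<A>" "i\<^sub>2 \<in> Arr \<A>" "p\<^sub>1 \<in> Arr \<A>" "p\<^sub>2 \<in> Arr \<A>" "Dom \<A> i\<^sub>1 = X" "Cod \<A> i\<^sub>1 = S"
    "Dom \<A> i\<^sub>2 = Y" "Cod \<A> i\<^sub>2 = S" "Dom \<A> p\<^sub>1 = S" "Cod \<A> p\<^sub>1 = X" "Dom \<A> p\<^sub>2 = S" "Cod \<A> p\<^sub>2 = Y"
    "X \<in> Ob \<A>" "Y \<in> Ob \<A>" "S \<in> Ob \<A>"
    "p\<^sub>1 \<cdot> i\<^sub>1 = Ident \<A> X" "p\<^sub>2 \<cdot> i\<^sub>2 = Ident \<A> Y" "p\<^sub>1 \<cdot> i\<^sub>2 = Zero \<A> Y X" "p\<^sub>2 \<cdot> i\<^sub>1 = Zero \<A> X Y"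
    "\<lbrakk>u \<in> Arr \<A>; Cod \<A> u = X\<rbrakk> \<Longrightarrow> p\<^sub>1 \<cdot> (i\<^sub>1 \<cdot> u) = u"
    "\<lbrakk>u \<in> Arr \<A>; Cod \<A> u = Y\<rbrakk> \<Longrightarrow> p\<^sub>2 \<cdot> (i\<^sub>2 \<cdot> u) = u"
    "\<lbrakk>u \<in> Arr \<A>; Cod \<A> u = Y\<rbrakk> \<Longrightarrow> p\<^sub>1 \<cdot> (i\<^sub>2 \<cdot> u) = Zero \<A> (Dom \<A> u) X"
    "\<lbrakk>u \<in> Arr \<A>; Cod \<A> u = X\<rbrakk> \<Longrightarrow> p\<^sub>2 \<cdot> (i\<^sub>1 \<cdot> u) = Zero \<A> (Dom \<A> u) Y"
proof -
  show *[simp]: "i\<^sub>1 \<in> Arr \<A>" "i\<^sub>2 \<in> Arr \<A>" "p\<^sub>1 \<in> Arr \<A>" "p\<^sub>2 \<in> Arr \<A>" "Dom \<A> i\<^sub>1 = X" "Cod \<A> i\<^sub>1 = S"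
    "Dom \<A> i\<^sub>2 = Y" "Cod \<A> i\<^sub>2 = S" "Dom \<A> p\<^sub>1 = S" "Cod \<A> p\<^sub>1 = X" "Dom \<A> p\<^sub>2 = S" "Cod \<A> p\<^sub>2 = Y"
    using assms by (auto simp: is_biproduct_def)
  show [simp]: "X \<in> Ob \<A>" "Y \<in> Ob \<A>" "S \<in> Ob \<A>"
    using Dom_Ob[of i\<^sub>1] Dom_Ob[of i\<^sub>2] Cod_Ob[of i\<^sub>1] by auto
  show eq: "p\<^sub>1 \<cdot> i\<^sub>1 = Ident \<A> X" "p\<^sub>2 \<cdot> i\<^sub>2 = Ident \<A> Y" "p\<^sub>1 \<cdot> i\<^sub>2 = Zero \<A> Y X" "p\<^sub>2 \<cdot> i\<^sub>1 = Zero \<A> X Y"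
    using assms by (auto simp: is_biproduct_def)
  note [simp] = eq[THEN Comp_reassoc]
  show "\<lbrakk>u \<in> Arr \<A>; Cod \<A> u = X\<rbrakk> \<Longrightarrow> p\<^sub>1 \<cdot> (i\<^sub>1 \<cdot> u) = u"
    "\<lbrakk>u \<in> Arr \<A>; Cod \<A> u = Y\<rbrakk> \<Longrightarrow> p\<^sub>2 \<cdot> (i\<^sub>2 \<cdot> u) = u"
    "\<lbrakk>u \<in> Arr \<A>; Cod \<A> u = Y\<rbrakk> \<Longrightarrow> p\<^sub>1 \<cdot> (i\<^sub>2 \<cdot> u) = Zero \<A> (Dom \<A> u) X"
    "\<lbrakk>u \<in> Arr \<A>; Cod \<A> u = X\<rbrakk> \<Longrightarrow> p\<^sub>2 \<cdot> (i\<^sub>1 \<cdot> u) = Zero \<A> (Dom \<A> u) Y"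
    by simp_all
qed

lemma biproduct_into:
  assumes b: "is_biproduct \<A> X Y S i\<^sub>1 i\<^sub>2 p\<^sub>1 p\<^sub>2" and "u \<in> Arr \<A>" "Cod \<A> u = S"
  shows "Add \<A> (i\<^sub>1 \<cdot> (p\<^sub>1 \<cdot> u)) (i\<^sub>2 \<cdot> (p\<^sub>2 \<cdot> u)) = u"
proof -
  note [simp] = biproduct_simps[OF b]
  have "Add \<A> (i\<^sub>1 \<cdot> (p\<^sub>1 \<cdot> u)) (i\<^sub>2 \<cdot> (p\<^sub>2 \<cdot> u)) = Add \<A> (i\<^sub>1 \<cdot> p\<^sub>1) (i\<^sub>2 \<cdot> p\<^sub>2) \<cdot> u"
    using assms(2,3) by simp
  also have "\<dots> = u" using b assms by (simp add: is_biproduct_def)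
  finally show ?thesis .
qed

lemma biproduct_into_eq:
  assumes b: "is_biproduct \<A> X Y S i\<^sub>1 i\<^sub>2 p\<^sub>1 p\<^sub>2" and "u \<in> Arr \<A>" "Cod \<A> u = S"
    "v \<in> Arr \<A>" "Cod \<A> v = S" "p\<^sub>1 \<cdot> u = p\<^sub>1 \<cdot> v" "p\<^sub>2 \<cdot> u = p\<^sub>2 \<cdot> v"
  shows "u = v"
  using biproduct_into[OF b, of u] biproduct_into[OF b, of v] assms by metis

text \<open>A pullback is the kernel of the difference of \<open>g\<close> and \<open>h\<close> on
  the direct sum. The difference is epic because its restriction to the first summand is
  \<open>g\<close>. The sequence serves to show that \<open>p\<close> inherits epimorphy from
  \<open>g\<close>.\<close>

lemma pullback_difference_SES:
  assumes b: "is_biproduct \<A> (Dom \<A> g) (Dom \<A> h) S i\<^sub>1 i\<^sub>2 p\<^sub>1 p\<^sub>2"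
    and pb: "is_pullback \<A> q p g h" and e: "epic \<A> g"
  shows "SES \<A> (Dom \<A> p) (Add \<A> (i\<^sub>1 \<cdot> q) (i\<^sub>2 \<cdot> p)) S (Add \<A> (g \<cdot> p\<^sub>1) (neg (h \<cdot> p\<^sub>2))) (Cod \<A> h)"
proof -
  note [simp] = pullback_simps[OF pb]
  note [simp] = biproduct_simps[OF b]
  obtain K k where gk: "SES \<A> K k (Dom \<A> g) g (Cod \<A> g)" using epic_SES[OF e] by blast
  show ?thesis
  proof (rule SESI)
    show "u = Zero \<A> (Dom \<A> u) (Dom \<A> p)"
      if u: "u \<in> Arr \<A>" "Cod \<A> u = Dom \<A> p" "Add \<A> (i\<^sub>1 \<cdot> q) (i\<^sub>2 \<cdot> p) \<cdot> u = Zero \<A> (Dom \<A> u) S" for u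
    proof -
      have 1: "q \<cdot> u = p\<^sub>1 \<cdot> (Add \<A> (i\<^sub>1 \<cdot> q) (i\<^sub>2 \<cdot> p) \<cdot> u)" using u(1,2) by simp
      have 2: "p \<cdot> u = p\<^sub>2 \<cdot> (Add \<A> (i\<^sub>1 \<cdot> q) (i\<^sub>2 \<cdot> p) \<cdot> u)" using u(1,2) by simp
      have 3: "q \<cdot> u = Zero \<A> (Dom \<A> u) (Dom \<A> g)" unfolding 1 u(3) using u(1) by simp
      have 4: "p \<cdot> u = Zero \<A> (Dom \<A> u) (Dom \<A> h)" unfolding 2 u(3) using u(1) by simp
      show ?thesis
        by (rule pullback_eqI[OF pb]) (simp_all add: u(1,2) 3 4)
    qed
    show "\<exists>u. u \<in> Arr \<A> \<and> Dom \<A> u = Dom \<A> w \<and> Cod \<A> u = Dom \<A> p \<and> Add \<A> (i\<^sub>1 \<cdot> q) (i\<^sub>2 \<cdot> p) \<cdot> u = w"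
      if w: "w \<in> Arr \<A>" "Cod \<A> w = S"
        "Add \<A> (g \<cdot> p\<^sub>1) (neg (h \<cdot> p\<^sub>2)) \<cdot> w = Zero \<A> (Dom \<A> w) (Cod \<A> h)" for w
    proof -
      have "Add \<A> (g \<cdot> (p\<^sub>1 \<cdot> w)) (neg (h \<cdot> (p\<^sub>2 \<cdot> w))) = Zero \<A> (Dom \<A> w) (Cod \<A> h)"
        using w by simp
      then have gh: "g \<cdot> (p\<^sub>1 \<cdot> w) = h \<cdot> (p\<^sub>2 \<cdot> w)"
        using w(1,2) Add_neg_eq_Zero[of "g \<cdot> (p\<^sub>1 \<cdot> w)" "h \<cdot> (p\<^sub>2 \<cdot> w)"] by simp
      obtain u where u: "u \<in> Arr \<A>" "Dom \<A> u = Dom \<A> (p\<^sub>2 \<cdot> w)" "Cod \<A> u = Dom \<A> p" "q \<cdot> u = p\<^sub>1 \<cdot> w" "p \<cdot> u = p\<^sub>2 \<cdot> w"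
        by (rule pullback_lift[OF pb, of "p\<^sub>1 \<cdot> w" "p\<^sub>2 \<cdot> w"]) (use w(1,2) gh in simp_all)
      have "Add \<A> (i\<^sub>1 \<cdot> q) (i\<^sub>2 \<cdot> p) \<cdot> u = w"
        using biproduct_into[OF b w(1,2)] w(1,2) u by simp
      then show ?thesis using u w by auto
    qed
    show "x = Zero \<A> (Cod \<A> h) (Cod \<A> x)"
      if x: "x \<in> Arr \<A>" "Dom \<A> x = Cod \<A> h" "x \<cdot> Add \<A> (g \<cdot> p\<^sub>1) (neg (h \<cdot> p\<^sub>2)) = Zero \<A> S (Cod \<A> x)" for x
    proof -
      have "(x \<cdot> Add \<A> (g \<cdot> p\<^sub>1) (neg (h \<cdot> p\<^sub>2))) \<cdot> i\<^sub>1 = x \<cdot> g" using x(1,2) by simp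
      then have "x \<cdot> g = Zero \<A> (Dom \<A> g) (Cod \<A> x)" unfolding x(3) using x(1) by simp
      then show ?thesis using x(1,2) by (intro SES_epi_Zero[OF gk, unfolded pullback_simps(8)[OF pb]])
    qed
  qed simp_all
qed

lemma ex_pullback:
  assumes "g \<in> Arr \<A>" "h \<in> Arr \<A>" "Cod \<A> g = Cod \<A> h"
  obtains q p where "is_pullback \<A> q p g h"
proof -
  note [simp] = assms
  obtain S i\<^sub>1 i\<^sub>2 p\<^sub>1 p\<^sub>2 where b: "is_biproduct \<A> (Dom \<A> g) (Dom \<A> h) S i\<^sub>1 i\<^sub>2 p\<^sub>1 p\<^sub>2"
    by (rule biproduct_E[of "Dom \<A> g" "Dom \<A> h"]) simp_all
  note [simp] = biproduct_simps[OF b]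
  let ?d = "Add \<A> (g \<cdot> p\<^sub>1) (neg (h \<cdot> p\<^sub>2))"
  obtain k where k: "is_kernel \<A> k ?d" using ex_kernel[of ?d] by auto
  have [simp]: "k \<in> Arr \<A>" "Cod \<A> k = S" and dk: "?d \<cdot> k = Zero \<A> (Dom \<A> k) (Cod \<A> h)"
    and lift: "\<And>W x. x \<in> Hom \<A> W S \<Longrightarrow> ?d \<cdot> x = Zero \<A> W (Cod \<A> h) \<Longrightarrow>
        (\<exists>!u. u \<in> Hom \<A> W (Dom \<A> k) \<and> k \<cdot> u = x)"
    using k unfolding is_kernel_def by simp_all
  have eq: "g \<cdot> (p\<^sub>1 \<cdot> k) = h \<cdot> (p\<^sub>2 \<cdot> k)"
    using dk Add_neg_eq_Zero[of "g \<cdot> (p\<^sub>1 \<cdot> k)" "h \<cdot> (p\<^sub>2 \<cdot> k)"] by simp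
  have "is_pullback \<A> (p\<^sub>1 \<cdot> k) (p\<^sub>2 \<cdot> k) g h"
  proof (rule pullbackI)
    show "u = v" if *: "u \<in> Arr \<A>" "v \<in> Arr \<A>" "Cod \<A> u = Dom \<A> (p\<^sub>2 \<cdot> k)" "Cod \<A> v = Dom \<A> (p\<^sub>2 \<cdot> k)"
      "p\<^sub>1 \<cdot> k \<cdot> u = p\<^sub>1 \<cdot> k \<cdot> v" "p\<^sub>2 \<cdot> k \<cdot> u = p\<^sub>2 \<cdot> k \<cdot> v" for u v
    proof -
      have kk: "k \<cdot> u = k \<cdot> v" by (rule biproduct_into_eq[OF b]) (use * in simp_all)
      have d: "Dom \<A> u = Dom \<A> v"
        using Comp_simps(2)[of u k] Comp_simps(2)[of v k] * kk by simp
      have "?d \<cdot> (k \<cdot> v) = (?d \<cdot> k) \<cdot> v" using * by (subst Comp_assoc_simp) simp_all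
      then have "?d \<cdot> (k \<cdot> v) = Zero \<A> (Dom \<A> v) (Cod \<A> h)" unfolding dk using * by simp
      then show ?thesis using lift[of "k \<cdot> v" "Dom \<A> v"] * kk d by auto
    qed
    show "\<exists>w \<in> Arr \<A>. Dom \<A> w = Dom \<A> y \<and> Cod \<A> w = Dom \<A> (p\<^sub>2 \<cdot> k) \<and> p\<^sub>1 \<cdot> k \<cdot> w = x \<and> p\<^sub>2 \<cdot> k \<cdot> w = y"
      if *: "x \<in> Arr \<A>" "y \<in> Arr \<A>" "Dom \<A> x = Dom \<A> y" "Cod \<A> x = Dom \<A> g" "Cod \<A> y = Dom \<A> h"
      "g \<cdot> x = h \<cdot> y" for x y
    proof -
      have "?d \<cdot> Add \<A> (i\<^sub>1 \<cdot> x) (i\<^sub>2 \<cdot> y) = Zero \<A> (Dom \<A> y) (Cod \<A> h)"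
        using * by simp
      then obtain w where "w \<in> Hom \<A> (Dom \<A> y) (Dom \<A> k)" and "k \<cdot> w = Add \<A> (i\<^sub>1 \<cdot> x) (i\<^sub>2 \<cdot> y)"
        using lift[of "Add \<A> (i\<^sub>1 \<cdot> x) (i\<^sub>2 \<cdot> y)" "Dom \<A> y"] * by auto
      then show ?thesis using * by (intro bexI[of _ w]) simp_all
    qed
  qed (simp_all add: eq)
  then show ?thesis by (rule that)
qed

text \<open>The content is that \<open>p\<close> is epic: if \<open>x \<cdot> p\<close> is zero,
  then \<open>x \<cdot> p\<^sub>2\<close> factors over the difference morphism, and restricting to
  each summand in turn forces first that factor and then \<open>x\<close> to vanish. The kernel is
  unchanged because a morphism into the pullback with zero component in \<open>Dom \<A> h\<close> is
  the same as a morphism into the kernel of \<open>g\<close>.\<close>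

lemma pullback_SES:
  assumes pb: "is_pullback \<A> q p g h" and s: "SES \<A> X f Y g Z"
  obtains j where "SES \<A> X j (Dom \<A> p) p (Dom \<A> h)" "q \<cdot> j = f"
proof -
  note [simp] = pullback_simps[OF pb] SES_simps(1-3,7-11)[OF s]
  have [simp]: "Dom \<A> g = Y" "Z = Cod \<A> h"
    using SES_simps(4-6)[OF s] pullback_simps(8)[OF pb] by simp_all
  obtain S i\<^sub>1 i\<^sub>2 p\<^sub>1 p\<^sub>2 where b: "is_biproduct \<A> (Dom \<A> g) (Dom \<A> h) S i\<^sub>1 i\<^sub>2 p\<^sub>1 p\<^sub>2"
    by (rule biproduct_E[of "Dom \<A> g" "Dom \<A> h"]) simp_all
  note [simp] = biproduct_simps[OF b]
  note ds = pullback_difference_SES[OF b pb SES_epic[OF s]]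
  obtain j where j [simp]: "j \<in> Arr \<A>" "Dom \<A> j = X" "Cod \<A> j = Dom \<A> p" and eqs: "q \<cdot> j = f" "p \<cdot> j = Zero \<A> X (Dom \<A> h)"
    by (rule pullback_lift[OF pb, of f "Zero \<A> X (Dom \<A> h)"]) simp_all
  note [simp] = eqs eqs[THEN Comp_reassoc]
  have "SES \<A> X j (Dom \<A> p) p (Dom \<A> h)"
  proof (rule SESI)
    show "u = Zero \<A> (Dom \<A> u) X"
      if u: "u \<in> Arr \<A>" "Cod \<A> u = X" "j \<cdot> u = Zero \<A> (Dom \<A> u) (Dom \<A> p)" for u
    proof (rule SES_mono_Zero[OF s u(1,2)])
      have "f \<cdot> u = q \<cdot> (j \<cdot> u)" using u(1,2) by simp
      then show "f \<cdot> u = Zero \<A> (Dom \<A> u) Y" unfolding u(3) using u(1) by simp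
    qed
    show "\<exists>u. u \<in> Arr \<A> \<and> Dom \<A> u = Dom \<A> w \<and> Cod \<A> u = X \<and> j \<cdot> u = w"
      if w: "w \<in> Arr \<A>" "Cod \<A> w = Dom \<A> p" "p \<cdot> w = Zero \<A> (Dom \<A> w) (Dom \<A> h)" for w
    proof -
      obtain u where u: "u \<in> Arr \<A>" "Dom \<A> u = Dom \<A> w" "Cod \<A> u = X" "f \<cdot> u = q \<cdot> w"
        by (rule SES_lift[OF s, of "q \<cdot> w"]) (use w in simp_all)
      have "j \<cdot> u = w" by (rule pullback_eqI[OF pb]) (use u w in simp_all)
      then show ?thesis using u by blast
    qed
    show "x = Zero \<A> (Dom \<A> h) (Cod \<A> x)"
      if x: "x \<in> Arr \<A>" "Dom \<A> x = Dom \<A> h" "x \<cdot> p = Zero \<A> (Dom \<A> p) (Cod \<A> x)" for x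
    proof -
      obtain y where y: "y \<in> Arr \<A>" "Dom \<A> y = Cod \<A> h" "Cod \<A> y = Cod \<A> x"
        and yd: "y \<cdot> Add \<A> (g \<cdot> p\<^sub>1) (neg (h \<cdot> p\<^sub>2)) = x \<cdot> p\<^sub>2"
        by (rule SES_desc[OF ds, of "x \<cdot> p\<^sub>2"]) (use x in simp_all)
      have "y \<cdot> g = (y \<cdot> Add \<A> (g \<cdot> p\<^sub>1) (neg (h \<cdot> p\<^sub>2))) \<cdot> i\<^sub>1" using x(1) y by simp
      then have "y \<cdot> g = Zero \<A> Y (Cod \<A> y)" unfolding yd using x y by simp
      then have y0: "y = Zero \<A> (Cod \<A> h) (Cod \<A> x)" using SES_epi_Zero[OF s, of y] y by simp
      have "x = (x \<cdot> p\<^sub>2) \<cdot> i\<^sub>2" using x by simp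
      also have "\<dots> = Zero \<A> (Dom \<A> h) (Cod \<A> x)" unfolding yd[symmetric] y0 using x by simp
      finally show ?thesis .
    qed
  qed simp_all
  then show ?thesis using eqs(1) by (rule that)
qed

text \<open>Everything that is later needed of one square is collected here, so that the square is
  chosen only once. The fifth conclusion exchanges the roles of the two morphisms into
  \<open>Z\<close>: when \<open>h\<close> is itself the epimorphism of a short exact sequence,
  \<open>q\<close> is one with the same kernel.\<close>

lemma SES_pullback:
  assumes s: "SES \<A> X f Y g Z" and h: "h \<in> Hom \<A> D Z"
  obtains P j p q where "SES \<A> X j P p D" "q \<in> Hom \<A> P Y" "g \<cdot> q = h \<cdot> p" "q \<cdot> j = f"
    "\<And>X' f'. SES \<A> X' f' D h Z \<Longrightarrow> \<exists>j'. SES \<A> X' j' P q Y"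
    "\<And>W x y. \<lbrakk>x \<in> Hom \<A> W Y; y \<in> Hom \<A> W D; g \<cdot> x = h \<cdot> y\<rbrakk>
      \<Longrightarrow> \<exists>w \<in> Hom \<A> W P. q \<cdot> w = x \<and> p \<cdot> w = y"
    "\<And>W u v. \<lbrakk>u \<in> Hom \<A> W P; v \<in> Hom \<A> W P; q \<cdot> u = q \<cdot> v; p \<cdot> u = p \<cdot> v\<rbrakk> \<Longrightarrow> u = v"
proof -
  note [simp] = SES_simps[OF s]
  obtain q p where pb: "is_pullback \<A> q p g h"
    by (rule ex_pullback[of g h]) (use h in simp_all)
  have D: "Dom \<A> h = D" using h by simp
  obtain j where j: "SES \<A> X j (Dom \<A> p) p (Dom \<A> h)" "q \<cdot> j = f"
    by (rule pullback_SES[OF pb s])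
  have 1: "\<exists>j'. SES \<A> X' j' (Dom \<A> p) q Y" if s': "SES \<A> X' f' D h Z" for X' f'
    by (rule pullback_SES[OF is_pullback_sym[OF pb] s']) (use pullback_simps[OF pb] in auto)
  have 2: "\<exists>w \<in> Hom \<A> W (Dom \<A> p). q \<cdot> w = x \<and> p \<cdot> w = y"
    if "x \<in> Hom \<A> W Y" "y \<in> Hom \<A> W D" "g \<cdot> x = h \<cdot> y" for W x y
    by (rule pullback_lift[OF pb, of x y]) (use that D in auto)
  have 3: "u = v"
    if "u \<in> Hom \<A> W (Dom \<A> p)" "v \<in> Hom \<A> W (Dom \<A> p)" "q \<cdot> u = q \<cdot> v" "p \<cdot> u = p \<cdot> v" for W u v
    by (rule pullback_eqI[OF pb]) (use that in simp_all)
  have "q \<in> Hom \<A> (Dom \<A> p) Y" using pullback_simps[OF pb] by simp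
  then show ?thesis
    by (rule that[OF j(1)[unfolded D] _ pullback_simps(9)[OF pb] j(2)]) (fact 1 2 3)+
qed

lemma SES_pushout:
  assumes s: "SES \<A> X f Y g Z" and h: "h \<in> Hom \<A> X D"
  obtains P j p q where "SES \<A> D p P j Z" "q \<in> Hom \<A> Y P" "q \<cdot> f = p \<cdot> h" "j \<cdot> q = g"
    "\<And>Z' f'. SES \<A> X h D f' Z' \<Longrightarrow> \<exists>j'. SES \<A> Y q P j' Z'"
    "\<And>W x y. \<lbrakk>x \<in> Hom \<A> Y W; y \<in> Hom \<A> D W; x \<cdot> f = y \<cdot> h\<rbrakk>
      \<Longrightarrow> \<exists>w \<in> Hom \<A> P W. w \<cdot> q = x \<and> w \<cdot> p = y"
    "\<And>W u v. \<lbrakk>u \<in> Hom \<A> P W; v \<in> Hom \<A> P W; u \<cdot> q = v \<cdot> q; u \<cdot> p = v \<cdot> p\<rbrakk> \<Longrightarrow> u = v"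
proof (rule abelian_category.SES_pullback[OF abelian_category_op_cat, of Z g Y f X h D],
    unfold op_cat_simps SES_op_cat, rule s, rule h)
  fix P j p q
  assume "SES \<A> D p P j Z" "q \<in> Hom \<A> Y P" "q \<cdot> f = p \<cdot> h" "j \<cdot> q = g"
    "\<And>Z' f'. SES \<A> X h D f' Z' \<Longrightarrow> \<exists>j'. SES \<A> Y q P j' Z'"
    "\<And>W x y. \<lbrakk>x \<in> Hom \<A> Y W; y \<in> Hom \<A> D W; x \<cdot> f = y \<cdot> h\<rbrakk>
      \<Longrightarrow> \<exists>w \<in> Hom \<A> P W. w \<cdot> q = x \<and> w \<cdot> p = y"
    "\<And>W u v. \<lbrakk>u \<in> Hom \<A> P W; v \<in> Hom \<A> P W; u \<cdot> q = v \<cdot> q; u \<cdot> p = v \<cdot> p\<rbrakk> \<Longrightarrow> u = v"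
  then show thesis by (rule that)
qed

section \<open>Kernels of composites, the horseshoe lemma and a snake lemma\<close>

text \<open>The kernel of the composite is the preimage under \<open>h\<close> of the kernel of
  \<open>g\<close>, formed as a pullback. Its projection to \<open>K\<close> is parallel to
  \<open>h\<close> and so has the same kernel \<open>L\<close>.\<close>

lemma SES_comp:
  assumes sg: "SES \<A> K \<kappa> Y g Z" and sh: "SES \<A> L l X h Y"
  obtains N n r l' where "SES \<A> N n X (g \<cdot> h) Z" "SES \<A> L l' N r K" "\<kappa> \<cdot> r = h \<cdot> n" "n \<cdot> l' = l"
proof -
  note [simp] = SES_simps[OF sg] SES_simps[OF sh]
  obtain n r where pb: "is_pullback \<A> n r h \<kappa>"
    by (rule ex_pullback[of h \<kappa>]) simp_all
  obtain l' where l': "SES \<A> L l' (Dom \<A> r) r (Dom \<A> \<kappa>)" "n \<cdot> l' = l"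
    by (rule pullback_SES[OF pb sh])
  have [simp]: "n \<in> Arr \<A>" "r \<in> Arr \<A>" "Dom \<A> n = Dom \<A> r" "Cod \<A> n = X" "Cod \<A> r = K" "h \<cdot> n = \<kappa> \<cdot> r"
    using pullback_simps[OF pb] by simp_all
  have "SES \<A> (Dom \<A> r) n X (g \<cdot> h) Z"
  proof (rule SESI)
    show "u = Zero \<A> (Dom \<A> u) (Dom \<A> r)"
      if u: "u \<in> Arr \<A>" "Cod \<A> u = Dom \<A> r" "n \<cdot> u = Zero \<A> (Dom \<A> u) X" for u
    proof -
      have "\<kappa> \<cdot> (r \<cdot> u) = h \<cdot> (n \<cdot> u)" using pullback_simps(10)[OF pb, of u] u(1,2) by simp
      then have "\<kappa> \<cdot> (r \<cdot> u) = Zero \<A> (Dom \<A> (r \<cdot> u)) Y" unfolding u(3) using u(1,2) by simp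
      then have "r \<cdot> u = Zero \<A> (Dom \<A> u) K" using SES_mono_Zero[OF sg, of "r \<cdot> u"] u(1,2) by simp
      then show ?thesis using u by - (rule pullback_eqI[OF pb]; simp)
    qed
    show "\<exists>u. u \<in> Arr \<A> \<and> Dom \<A> u = Dom \<A> w \<and> Cod \<A> u = Dom \<A> r \<and> n \<cdot> u = w"
      if w: "w \<in> Arr \<A>" "Cod \<A> w = X" "g \<cdot> h \<cdot> w = Zero \<A> (Dom \<A> w) Z" for w
    proof -
      obtain y where y: "y \<in> Arr \<A>" "Dom \<A> y = Dom \<A> (h \<cdot> w)" "Cod \<A> y = K" "\<kappa> \<cdot> y = h \<cdot> w"
        by (rule SES_lift[OF sg, of "h \<cdot> w"]) (use w in simp_all)
      show ?thesis
        by (rule pullback_lift[OF pb, of w y]) (use w y in auto)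
    qed
    show "x = Zero \<A> Z (Cod \<A> x)"
      if x: "x \<in> Arr \<A>" "Dom \<A> x = Z" "x \<cdot> (g \<cdot> h) = Zero \<A> X (Cod \<A> x)" for x
    proof -
      have "x \<cdot> g = Zero \<A> Y (Cod \<A> x)"
        using SES_epi_Zero[OF sh, of "x \<cdot> g"] x by simp
      then show ?thesis by (rule SES_epi_Zero[OF sg x(1,2)])
    qed
  qed (simp_all add: Comp_reassoc)
  then show ?thesis using that[of "Dom \<A> r" n l' r] l' by simp
qed

lemma SES_comp_monos:
  assumes "SES \<A> Z g Y \<kappa> K" "SES \<A> Y h X l L"
  obtains N n r l' where "SES \<A> Z (h \<cdot> g) X n N" "SES \<A> K r N l' L" "r \<cdot> \<kappa> = n \<cdot> h" "l' \<cdot> n = l"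
  by (rule abelian_category.SES_comp[OF abelian_category_op_cat, of K \<kappa> Y g Z L l X h]) (use assms in auto)

text \<open>Since \<open>\<pi>\<close> annihilates \<open>l \<cdot> \<kappa>\<close>, the morphism
  \<open>l\<close> carries \<open>K\<close> into \<open>A\<close>; with a sign, this is the first
  component of the embedding of \<open>K\<close> into the direct sum, \<open>\<kappa>\<close> being
  the second. The sequence is used both for the horseshoe lemma and for kernels of proper
  epimorphisms.\<close>

lemma SES_lift_sum:
  assumes s: "SES \<A> A i M \<pi> B" and sq: "SES \<A> K \<kappa> C q B"
    and l: "l \<in> Hom \<A> C M" "\<pi> \<cdot> l = q"
    and b: "is_biproduct \<A> A C S i\<^sub>1 i\<^sub>2 p\<^sub>1 p\<^sub>2"
  obtains m where "SES \<A> K m S (Add \<A> (i \<cdot> p\<^sub>1) (l \<cdot> p\<^sub>2)) M"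
proof -
  note [simp] = SES_simps[OF s] SES_simps[OF sq] biproduct_simps[OF b] l(2) Comp_reassoc[OF l(2)]
  have [simp]: "l \<in> Arr \<A>" "Dom \<A> l = C" "Cod \<A> l = M" using l by simp_all
  obtain u where u [simp]: "u \<in> Arr \<A>" "Dom \<A> u = K" "Cod \<A> u = A" and iu: "i \<cdot> u = l \<cdot> \<kappa>"
    by (rule SES_lift[OF s, of "l \<cdot> \<kappa>"]) simp_all
  note [simp] = iu Comp_reassoc[OF iu]
  let ?m = "Add \<A> (i\<^sub>1 \<cdot> neg u) (i\<^sub>2 \<cdot> \<kappa>)" and ?w = "Add \<A> (i \<cdot> p\<^sub>1) (l \<cdot> p\<^sub>2)"
  have "SES \<A> K ?m S ?w M"
  proof (rule SESI)
    show "x = Zero \<A> (Dom \<A> x) K"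
      if x: "x \<in> Arr \<A>" "Cod \<A> x = K" "?m \<cdot> x = Zero \<A> (Dom \<A> x) S" for x
    proof (rule SES_mono_Zero[OF sq x(1,2)])
      have "\<kappa> \<cdot> x = p\<^sub>2 \<cdot> (?m \<cdot> x)" using x(1,2) by simp
      then show "\<kappa> \<cdot> x = Zero \<A> (Dom \<A> x) C" unfolding x(3) using x(1) by simp
    qed
    show "\<exists>y. y \<in> Arr \<A> \<and> Dom \<A> y = Dom \<A> h \<and> Cod \<A> y = K \<and> ?m \<cdot> y = h"
      if h: "h \<in> Arr \<A>" "Cod \<A> h = S" "?w \<cdot> h = Zero \<A> (Dom \<A> h) M" for h
    proof -
      have "q \<cdot> (p\<^sub>2 \<cdot> h) = \<pi> \<cdot> (?w \<cdot> h)" using h(1,2) by simp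
      then have "q \<cdot> (p\<^sub>2 \<cdot> h) = Zero \<A> (Dom \<A> (p\<^sub>2 \<cdot> h)) B" unfolding h(3) using h(1,2) by simp
      then obtain y where y [simp]: "y \<in> Arr \<A>" "Dom \<A> y = Dom \<A> h" "Cod \<A> y = K" and ky: "\<kappa> \<cdot> y = p\<^sub>2 \<cdot> h"
        using SES_lift[OF sq, of "p\<^sub>2 \<cdot> h"] h(1,2) by auto
      have "Add \<A> (i \<cdot> (p\<^sub>1 \<cdot> h)) (l \<cdot> (p\<^sub>2 \<cdot> h)) = Zero \<A> (Dom \<A> h) M"
        using h by simp
      then have *: "l \<cdot> (\<kappa> \<cdot> y) = neg (i \<cdot> (p\<^sub>1 \<cdot> h))"
        using neg_unique[of "i \<cdot> (p\<^sub>1 \<cdot> h)" "l \<cdot> (\<kappa> \<cdot> y)" "Dom \<A> h" M] h(1,2) ky by simp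
      have "i \<cdot> neg (u \<cdot> y) = neg (l \<cdot> (\<kappa> \<cdot> y))" by simp
      then have "i \<cdot> neg (u \<cdot> y) = i \<cdot> (p\<^sub>1 \<cdot> h)" unfolding * using h(1,2) by simp
      then have "neg (u \<cdot> y) = p\<^sub>1 \<cdot> h" using h(1,2) by - (rule SES_mono[OF s], simp_all)
      then have "i\<^sub>1 \<cdot> neg (u \<cdot> y) = i\<^sub>1 \<cdot> (p\<^sub>1 \<cdot> h)" by (rule arg_cong)
      then have "neg (i\<^sub>1 \<cdot> (u \<cdot> y)) = i\<^sub>1 \<cdot> (p\<^sub>1 \<cdot> h)" by simp
      then have "?m \<cdot> y = h" using biproduct_into[OF b h(1,2)] ky by simp
      then show ?thesis by (intro exI[of _ y]) simp
    qed
    show "x = Zero \<A> M (Cod \<A> x)"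
      if x: "x \<in> Arr \<A>" "Dom \<A> x = M" "x \<cdot> ?w = Zero \<A> S (Cod \<A> x)" for x
    proof -
      have "x \<cdot> i = (x \<cdot> ?w) \<cdot> i\<^sub>1" using x(1,2) by simp
      then have "x \<cdot> i = Zero \<A> A (Cod \<A> x)" unfolding x(3) using x(1) by simp
      then obtain y where y: "y \<in> Arr \<A>" "Dom \<A> y = B" "Cod \<A> y = Cod \<A> x" "y \<cdot> \<pi> = x"
        using SES_desc[OF s x(1,2)] by auto
      have "y \<cdot> q = (y \<cdot> \<pi>) \<cdot> l" using y(1-3) by simp
      also have "\<dots> = (x \<cdot> ?w) \<cdot> i\<^sub>2" unfolding y(4) using x(1,2) by simp
      also have "\<dots> = Zero \<A> C (Cod \<A> y)" unfolding x(3) y(3) using x(1) by simp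
      finally have "y = Zero \<A> B (Cod \<A> y)" by (rule SES_epi_Zero[OF sq y(1,2)])
      then have "y = Zero \<A> B (Cod \<A> x)" unfolding y(3) .
      then have "y \<cdot> \<pi> = Zero \<A> M (Cod \<A> x)" using x(1) by simp
      then show ?thesis unfolding y(4) .
    qed
  qed simp_all
  then show ?thesis by (rule that)
qed

lemma is_biproduct_commute:
  assumes b: "is_biproduct \<A> X Y S i\<^sub>1 i\<^sub>2 p\<^sub>1 p\<^sub>2"
  shows "is_biproduct \<A> Y X S i\<^sub>2 i\<^sub>1 p\<^sub>2 p\<^sub>1"
proof -
  note [simp] = biproduct_simps[OF b]
  have "Add \<A> (i\<^sub>2 \<cdot> p\<^sub>2) (i\<^sub>1 \<cdot> p\<^sub>1) = Add \<A> (i\<^sub>1 \<cdot> p\<^sub>1) (i\<^sub>2 \<cdot> p\<^sub>2)"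
    by (rule Add_commute) simp_all
  then show ?thesis using b by (simp add: is_biproduct_def)
qed

text \<open>The morphism from \<open>C \<oplus> D\<close> to \<open>M\<close> is factored through
  \<open>A \<oplus> D\<close>. Both factors are instances of \<open>SES_lift_sum\<close>, the one
  out of \<open>C \<oplus> D\<close> over the split sequence from \<open>D\<close> through
  \<open>A \<oplus> D\<close> to \<open>A\<close>. The kernel of the composite is then an extension
  of \<open>L\<close> by \<open>K\<close>.\<close>

lemma horseshoe:
  assumes s: "SES \<A> A i M \<pi> B" and sp: "SES \<A> K k C p A" and sq: "SES \<A> L \<kappa> D q B"
    and l: "l \<in> Hom \<A> D M" "\<pi> \<cdot> l = q"
    and b: "is_biproduct \<A> C D S i\<^sub>1 i\<^sub>2 p\<^sub>1 p\<^sub>2"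
  obtains N n r t where "SES \<A> N n S (Add \<A> (i \<cdot> (p \<cdot> p\<^sub>1)) (l \<cdot> p\<^sub>2)) M" "SES \<A> K t N r L"
proof -
  note [simp] = SES_simps[OF s] SES_simps[OF sp] SES_simps[OF sq] biproduct_simps[OF b]
  have [simp]: "l \<in> Arr \<A>" "Dom \<A> l = D" "Cod \<A> l = M" using l by simp_all
  obtain T j\<^sub>1 j\<^sub>2 r\<^sub>1 r\<^sub>2 where b': "is_biproduct \<A> A D T j\<^sub>1 j\<^sub>2 r\<^sub>1 r\<^sub>2"
    by (rule biproduct_E[of A D]) simp_all
  note [simp] = biproduct_simps[OF b']
  let ?w = "Add \<A> (i \<cdot> r\<^sub>1) (l \<cdot> r\<^sub>2)" and ?v = "Add \<A> (j\<^sub>2 \<cdot> p\<^sub>2) ((j\<^sub>1 \<cdot> p) \<cdot> p\<^sub>1)"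
  obtain m where 1: "SES \<A> L m T ?w M" by (rule SES_lift_sum[OF s sq l b'])
  obtain m' where 2: "SES \<A> K m' S ?v T"
    by (rule SES_lift_sum[OF biproduct_SES[OF is_biproduct_commute[OF b']] sp _ _ is_biproduct_commute[OF b],
      of "j\<^sub>1 \<cdot> p"]) simp_all
  obtain N n r t where "SES \<A> N n S (?w \<cdot> ?v) M" "SES \<A> K t N r L"
    by (rule SES_comp[OF 1 2])
  moreover have "?w \<cdot> ?v = Add \<A> (i \<cdot> (p \<cdot> p\<^sub>1)) (l \<cdot> p\<^sub>2)"
    by (simp add: Add_commute)
  ultimately show ?thesis using that by simp
qed

text \<open>This is the snake lemma for a morphism of extensions which is the identity on
  \<open>Z\<close>: kernel and cokernel of \<open>w\<close> are those of \<open>p\<close>. It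
  recognises the special precover constructed in \<open>SPC_extension\<close>.\<close>

lemma SES_map_right:
  assumes s': "SES \<A> G i' G' \<pi>' Z" and s: "SES \<A> A i B \<pi> Z" and sp: "SES \<A> K k G p A"
    and w: "w \<in> Hom \<A> G' B" "w \<cdot> i' = i \<cdot> p" "\<pi> \<cdot> w = \<pi>'"
  shows "SES \<A> K (i' \<cdot> k) G' w B"
proof -
  note [simp] = SES_simps[OF s'] SES_simps[OF s] SES_simps[OF sp] w(2,3) w(2,3)[THEN Comp_reassoc]
  have [simp]: "w \<in> Arr \<A>" "Dom \<A> w = G'" "Cod \<A> w = B" using w by simp_all
  show ?thesis
  proof (rule SESI)
    show "x = Zero \<A> (Dom \<A> x) K"
      if x: "x \<in> Arr \<A>" "Cod \<A> x = K" "(i' \<cdot> k) \<cdot> x = Zero \<A> (Dom \<A> x) G'" for x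
    proof (rule SES_mono_Zero[OF sp x(1,2)])
      show "k \<cdot> x = Zero \<A> (Dom \<A> x) G"
        using SES_mono_Zero[OF s', of "k \<cdot> x"] x by simp
    qed
    show "\<exists>y. y \<in> Arr \<A> \<and> Dom \<A> y = Dom \<A> h \<and> Cod \<A> y = K \<and> (i' \<cdot> k) \<cdot> y = h"
      if h: "h \<in> Arr \<A>" "Cod \<A> h = G'" "w \<cdot> h = Zero \<A> (Dom \<A> h) B" for h
    proof -
      have "\<pi>' \<cdot> h = \<pi> \<cdot> (w \<cdot> h)" using h(1,2) by simp
      then have "\<pi>' \<cdot> h = Zero \<A> (Dom \<A> h) Z" unfolding h(3) using h(1) by simp
      then obtain y where y [simp]: "y \<in> Arr \<A>" "Dom \<A> y = Dom \<A> h" "Cod \<A> y = G" and iy: "i' \<cdot> y = h"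
        using SES_lift[OF s' h(1,2)] by auto
      have "i \<cdot> (p \<cdot> y) = w \<cdot> (i' \<cdot> y)" by simp
      then have "i \<cdot> (p \<cdot> y) = Zero \<A> (Dom \<A> (p \<cdot> y)) B" unfolding iy h(3) by simp
      then have "p \<cdot> y = Zero \<A> (Dom \<A> y) A" using SES_mono_Zero[OF s, of "p \<cdot> y"] by simp
      then obtain z where "z \<in> Arr \<A>" "Dom \<A> z = Dom \<A> y" "Cod \<A> z = K" "k \<cdot> z = y"
        using SES_lift[OF sp y(1,3)] by auto
      then show ?thesis using iy by (intro exI[of _ z]) simp
    qed
    show "x = Zero \<A> B (Cod \<A> x)"
      if x: "x \<in> Arr \<A>" "Dom \<A> x = B" "x \<cdot> w = Zero \<A> G' (Cod \<A> x)" for x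
    proof -
      have "(x \<cdot> i) \<cdot> p = (x \<cdot> w) \<cdot> i'" using x(1,2) by simp
      then have "(x \<cdot> i) \<cdot> p = Zero \<A> G (Cod \<A> (x \<cdot> i))" unfolding x(3) using x(1,2) by simp
      then have "x \<cdot> i = Zero \<A> A (Cod \<A> x)" using SES_epi_Zero[OF sp, of "x \<cdot> i"] x(1,2) by simp
      then obtain y where y: "y \<in> Arr \<A>" "Dom \<A> y = Z" "Cod \<A> y = Cod \<A> x" "y \<cdot> \<pi> = x"
        using SES_desc[OF s x(1,2)] by auto
      have "y \<cdot> \<pi>' = (y \<cdot> \<pi>) \<cdot> w" using y(1-3) by simp
      also have "\<dots> = Zero \<A> G' (Cod \<A> y)" unfolding y(3,4) x(3) ..
      finally have "y = Zero \<A> Z (Cod \<A> y)" by (rule SES_epi_Zero[OF s' y(1,2)])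
      then have "y = Zero \<A> Z (Cod \<A> x)" unfolding y(3) .
      then have "y \<cdot> \<pi> = Zero \<A> B (Cod \<A> x)" using x(1) by simp
      then show ?thesis unfolding y(4) .
    qed
  qed simp_all
qed

lemma SES_iso_left:
  assumes s: "SES \<A> X f Y g Z" and "\<phi> \<in> Hom \<A> X' X" "\<psi> \<in> Hom \<A> X X'"
    "\<psi> \<cdot> \<phi> = Ident \<A> X'" "\<phi> \<cdot> \<psi> = Ident \<A> X"
  shows "SES \<A> X' (f \<cdot> \<phi>) Y g Z"
proof -
  note [simp] = SES_simps[OF s] assms(4,5) assms(4,5)[THEN Comp_reassoc]
  have [simp]: "\<phi> \<in> Arr \<A>" "Dom \<A> \<phi> = X'" "Cod \<A> \<phi> = X" "\<psi> \<in> Arr \<A>" "Dom \<A> \<psi> = X" "Cod \<A> \<psi> = X'"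
    using assms by simp_all
  have [simp]: "X' \<in> Ob \<A>" using Dom_Ob[of \<phi>] by simp
  show ?thesis
  proof (rule SESI)
    show "x = Zero \<A> (Dom \<A> x) X'"
      if x: "x \<in> Arr \<A>" "Cod \<A> x = X'" "(f \<cdot> \<phi>) \<cdot> x = Zero \<A> (Dom \<A> x) Y" for x
    proof -
      have "\<phi> \<cdot> x = Zero \<A> (Dom \<A> x) X" using SES_mono_Zero[OF s, of "\<phi> \<cdot> x"] x by simp
      moreover have "x = \<psi> \<cdot> (\<phi> \<cdot> x)" using x(1,2) by simp
      ultimately show ?thesis using x(1) Zero_simps Comp_Zero by simp
    qed
    show "\<exists>y. y \<in> Arr \<A> \<and> Dom \<A> y = Dom \<A> h \<and> Cod \<A> y = X' \<and> (f \<cdot> \<phi>) \<cdot> y = h"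
      if h: "h \<in> Arr \<A>" "Cod \<A> h = Y" "g \<cdot> h = Zero \<A> (Dom \<A> h) Z" for h
    proof -
      obtain y where "y \<in> Arr \<A>" "Dom \<A> y = Dom \<A> h" "Cod \<A> y = X" "f \<cdot> y = h"
        by (rule SES_lift[OF s h])
      then show ?thesis by (intro exI[of _ "\<psi> \<cdot> y"]) simp
    qed
    show "x = Zero \<A> Z (Cod \<A> x)"
      if x: "x \<in> Arr \<A>" "Dom \<A> x = Z" "x \<cdot> g = Zero \<A> Y (Cod \<A> x)" for x
      by (rule SES_epi_Zero[OF s x])
  qed simp_all
qed

lemma SES_iso_right:
  assumes "SES \<A> X f Y g Z" "\<phi> \<in> Hom \<A> Z Z'" "\<psi> \<in> Hom \<A> Z' Z"
    "\<psi> \<cdot> \<phi> = Ident \<A> Z" "\<phi> \<cdot> \<psi> = Ident \<A> Z'"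
  shows "SES \<A> X f Y (\<phi> \<cdot> g) Z'"
  using abelian_category.SES_iso_left[OF abelian_category_op_cat, of Z g Y f X \<phi> Z' \<psi>] assms by simp

end

section \<open>Vanishing of Ext^1 as splitting\<close>

text \<open>Yoneda classes are replaced by the splitting of each representative, the form in which
  vanishing is applied; \<open>Ext_zero_1_iff\<close> justifies the replacement. Membership in
  \<open>Ob\<close> excludes vacuous vanishing for values that are not objects.\<close>

definition ext1_zero :: "('o, 'm) cat \<Rightarrow> 'o \<Rightarrow> 'o \<Rightarrow> bool" where
  "ext1_zero \<A> X Y \<longleftrightarrow> X \<in> Ob \<A> \<and> Y \<in> Ob \<A> \<and>
     (\<forall>f E g. SES \<A> Y f E g X \<longrightarrow> (\<exists>s \<in> Hom \<A> X E. g \<cdot>\<^bsub>\<A>\<^esub> s = Ident \<A> X))"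

context abelian_category
begin

lemma SES_split':
  assumes "SES \<A> X f Y g Z" "r \<in> Hom \<A> Y X" "r \<cdot> f = Ident \<A> X"
  obtains s where "s \<in> Hom \<A> Z Y" "g \<cdot> s = Ident \<A> Z"
  by (rule abelian_category.SES_split[OF abelian_category_op_cat, of Z g Y f X r]) (use assms in auto)

text \<open>A section of the epimorphism yields a retraction of the monomorphism and conversely, so
  the notion is self-dual although it is phrased with sections.\<close>

lemma ext1_zero_op_cat [simp]: "ext1_zero (op_cat \<A>) Y X \<longleftrightarrow> ext1_zero \<A> X Y"
proof -
  have "(\<exists>s \<in> Hom \<A> X E. g \<cdot> s = Ident \<A> X) \<longleftrightarrow> (\<exists>r \<in> Hom \<A> E Y. r \<cdot> f = Ident \<A> Y)"
    if "SES \<A> Y f E g X" for f E g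
  proof
    assume "\<exists>s \<in> Hom \<A> X E. g \<cdot> s = Ident \<A> X"
    then obtain s where "s \<in> Hom \<A> X E" "g \<cdot> s = Ident \<A> X" by blast
    then show "\<exists>r \<in> Hom \<A> E Y. r \<cdot> f = Ident \<A> Y" by (rule SES_split[OF that]) blast
  next
    assume "\<exists>r \<in> Hom \<A> E Y. r \<cdot> f = Ident \<A> Y"
    then obtain r where "r \<in> Hom \<A> E Y" "r \<cdot> f = Ident \<A> Y" by blast
    then show "\<exists>s \<in> Hom \<A> X E. g \<cdot> s = Ident \<A> X" by (rule SES_split'[OF that]) blast
  qed
  then show ?thesis
    unfolding ext1_zero_def SES_op_cat op_cat_simps by blast
qed

text \<open>Pull the sequence back along \<open>h\<close>: a section of the pullback followed by the
  projection to \<open>E\<close> is a lift. This stands in for exactness of Hom(X, E), Hom(X, Z),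
  Ext^1(X, Y).\<close>

lemma ext1_zero_lift:
  assumes e: "ext1_zero \<A> X Y" and s: "SES \<A> Y f E g Z" and h: "h \<in> Hom \<A> X Z"
  obtains l where "l \<in> Hom \<A> X E" "g \<cdot> l = h"
proof -
  obtain P j p q where P: "SES \<A> Y j P p X" "q \<in> Hom \<A> P E" "g \<cdot> q = h \<cdot> p"
    by (rule SES_pullback[OF s h])
  obtain t where t: "t \<in> Hom \<A> X P" "p \<cdot> t = Ident \<A> X"
    using e P(1) unfolding ext1_zero_def by blast
  note [simp] = SES_simps[OF s] SES_simps[OF P(1)] P(3) Comp_reassoc[OF P(3)]
  have "g \<cdot> (q \<cdot> t) = h" using P(2) t h by simp
  then show ?thesis using that[of "q \<cdot> t"] P(2) t by simp
qed

lemma ext1_zero_extend: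
  assumes "ext1_zero \<A> X Y" "SES \<A> Z f E g X" "h \<in> Hom \<A> Z Y"
  obtains l where "l \<in> Hom \<A> E Y" "l \<cdot> f = h"
  by (rule abelian_category.ext1_zero_lift[OF abelian_category_op_cat, of Y X g E f Z h]) (use assms in auto)

text \<open>Behind this is the exact piece Hom(P, Y), Hom(K, Y), Ext^1(M, Y), Ext^1(P, Y).
  Concretely, \<open>e\<close> lifts to some \<open>l\<close> into a given extension of
  \<open>M\<close> by \<open>Y\<close>; the restriction of \<open>l\<close> to \<open>K\<close>
  lands in \<open>Y\<close> and extends to \<open>P\<close>. Subtracting this extension makes
  \<open>l\<close> vanish on \<open>K\<close>, so it descends to a section.\<close>

lemma ext1_zero_quotient:
  assumes s: "SES \<A> K k P e M" and P: "ext1_zero \<A> P Y"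
    and ex: "\<And>h. h \<in> Hom \<A> K Y \<Longrightarrow> \<exists>v \<in> Hom \<A> P Y. v \<cdot> k = h"
  shows "ext1_zero \<A> M Y"
proof -
  note [simp] = SES_simps[OF s]
  have "\<exists>t \<in> Hom \<A> M E. g \<cdot> t = Ident \<A> M" if s': "SES \<A> Y f E g M" for f E g
  proof -
    note [simp] = SES_simps[OF s']
    obtain l where l: "l \<in> Hom \<A> P E" "g \<cdot> l = e"
      by (rule ext1_zero_lift[OF P s', of e]) simp_all
    note [simp] = l(2) Comp_reassoc[OF l(2)]
    obtain u where u: "u \<in> Arr \<A>" "Dom \<A> u = K" "Cod \<A> u = Y" "f \<cdot> u = l \<cdot> k"
      by (rule SES_lift[OF s', of "l \<cdot> k"]) (use l(1) in simp_all)
    have "u \<in> Hom \<A> K Y" using u by simp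
    then obtain v where v: "v \<in> Hom \<A> P Y" "v \<cdot> k = u" using ex by blast
    obtain t where t: "t \<in> Arr \<A>" "Dom \<A> t = M" "Cod \<A> t = E" "t \<cdot> e = Add \<A> l (neg (f \<cdot> v))"
      by (rule SES_desc[OF s, of "Add \<A> l (neg (f \<cdot> v))"]) (use l v u in simp_all)
    have "(g \<cdot> t) \<cdot> e = Ident \<A> M \<cdot> e" using t l v by simp
    then have "g \<cdot> t = Ident \<A> M"
      by (rule SES_epi[OF s, rotated -1]) (use t in simp_all)
    then show ?thesis using t by auto
  qed
  then show ?thesis using P unfolding ext1_zero_def by simp
qed

lemma ext1_zero_subobject:
  assumes s: "SES \<A> M k Q e N" and Q: "ext1_zero \<A> X Q"
    and ex: "\<And>h. h \<in> Hom \<A> X N \<Longrightarrow> \<exists>v \<in> Hom \<A> X Q. e \<cdot> v = h"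
  shows "ext1_zero \<A> X M"
  using abelian_category.ext1_zero_quotient[OF abelian_category_op_cat, of N e Q k M X] assms by simp

text \<open>Divide the given extension of \<open>X\<close> by \<open>B\<close> further by
  \<open>A\<close>: the quotient \<open>Q\<close> is an extension of \<open>X\<close> by
  \<open>C\<close> and has a section, which lifts to \<open>E\<close> because the kernel of
  \<open>c\<close> is \<open>A\<close>.\<close>

lemma ext1_zero_extension_right:
  assumes A: "ext1_zero \<A> X A" and C: "ext1_zero \<A> X C" and s: "SES \<A> A a B b C"
  shows "ext1_zero \<A> X B"
proof -
  note [simp] = SES_simps[OF s]
  have "\<exists>t \<in> Hom \<A> X E. g \<cdot> t = Ident \<A> X" if s': "SES \<A> B f E g X" for f E g
  proof -
    note [simp] = SES_simps[OF s']
    obtain Q c r q where Q: "SES \<A> A (f \<cdot> a) E c Q" "SES \<A> C r Q q X" "q \<cdot> c = g"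
      by (rule SES_comp_monos[OF s s'])
    note [simp] = SES_simps[OF Q(1)] SES_simps[OF Q(2)]
    obtain t where t: "t \<in> Hom \<A> X Q" "q \<cdot> t = Ident \<A> X"
      using C Q(2) unfolding ext1_zero_def by blast
    obtain u where u: "u \<in> Hom \<A> X E" "c \<cdot> u = t"
      by (rule ext1_zero_lift[OF A Q(1) t(1)])
    note [simp] = Comp_reassoc[OF Q(3)]
    have "g \<cdot> u = Ident \<A> X" using Q(3) t(2) u by (metis Comp_assoc_simp Hom_iff SES_simps(4-6)[OF Q(1)] SES_simps(4,5)[OF Q(2)])
    then show ?thesis using u by blast
  qed
  then show ?thesis using A unfolding ext1_zero_def by simp
qed

lemma ext1_zero_extension_left:
  assumes "ext1_zero \<A> A Y" "ext1_zero \<A> C Y" "SES \<A> A a B b C"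
  shows "ext1_zero \<A> B Y"
  using abelian_category.ext1_zero_extension_right[OF abelian_category_op_cat, of Y C A b B a] assms by simp

end

section \<open>Exactness and extensions\<close>

lemma is_kernelD:
  assumes "is_kernel \<A> k f"
  shows "k \<in> Arr \<A>" "f \<in> Arr \<A>" "Cod \<A> k = Dom \<A> f" "f \<cdot>\<^bsub>\<A>\<^esub> k = Zero \<A> (Dom \<A> k) (Cod \<A> f)"
  using assms by (auto simp: is_kernel_def)

lemma is_cokernelD:
  assumes "is_cokernel \<A> c f"
  shows "c \<in> Arr \<A>" "f \<in> Arr \<A>" "Dom \<A> c = Cod \<A> f" "c \<cdot>\<^bsub>\<A>\<^esub> f = Zero \<A> (Dom \<A> f) (Cod \<A> c)"
  using assms by (auto simp: is_cokernel_def)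

lemma is_cokernel_desc:
  assumes "is_cokernel \<A> c f" "h \<in> Arr \<A>" "Dom \<A> h = Cod \<A> f"
    "h \<cdot>\<^bsub>\<A>\<^esub> f = Zero \<A> (Dom \<A> f) (Cod \<A> h)"
  shows "\<exists>u. u \<in> Arr \<A> \<and> Dom \<A> u = Cod \<A> c \<and> Cod \<A> u = Cod \<A> h \<and> u \<cdot>\<^bsub>\<A>\<^esub> c = h"
  using is_kernel_lift[of "op_cat \<A>" c f h] assms by auto

lemma is_kernel_lift':
  assumes "is_kernel \<A> k f" "h \<in> Arr \<A>" "Cod \<A> h = Dom \<A> f"
    "f \<cdot>\<^bsub>\<A>\<^esub> h = Zero \<A> (Dom \<A> h) (Cod \<A> f)"
  shows "\<exists>u. u \<in> Arr \<A> \<and> Dom \<A> u = Dom \<A> h \<and> Cod \<A> u = Dom \<A> k \<and> k \<cdot>\<^bsub>\<A>\<^esub> u = h"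
  using is_kernel_lift[OF assms] by auto

section \<open>Images and the cutting of exact sequences\<close>

context abelian_category
begin

text \<open>This isolates the only property of a morphism on which its kernels depend; the
  comparisons of kernels and images below reduce to it.\<close>

lemma is_kernel_transfer:
  assumes k: "is_kernel \<A> k f" and g: "g \<in> Arr \<A>" "Dom \<A> g = Dom \<A> f"
    and eq: "\<And>h. \<lbrakk>h \<in> Arr \<A>; Cod \<A> h = Dom \<A> f\<rbrakk> \<Longrightarrow>
      f \<cdot> h = Zero \<A> (Dom \<A> h) (Cod \<A> f) \<longleftrightarrow> g \<cdot> h = Zero \<A> (Dom \<A> h) (Cod \<A> g)"
  shows "is_kernel \<A> k g"
proof -
  note [simp] = is_kernelD[OF k] g
  have "\<exists>!u. u \<in> Hom \<A> W (Dom \<A> k) \<and> k \<cdot> u = h"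
    if "h \<in> Hom \<A> W (Dom \<A> f)" "g \<cdot> h = Zero \<A> W (Cod \<A> g)" for W h
  proof -
    have [simp]: "h \<in> Arr \<A>" "Dom \<A> h = W" "Cod \<A> h = Dom \<A> f" using that by simp_all
    show ?thesis using is_kernel_lift[OF k, of h] eq[of h] that(2) by simp
  qed
  then show ?thesis unfolding is_kernel_def using eq[of k] by (simp del: Hom_iff)
qed

lemma kernel_of_cokernels:
  assumes "is_cokernel \<A> c f" "is_cokernel \<A> c' f" "is_kernel \<A> k c"
  shows "is_kernel \<A> k c'"
proof (rule is_kernel_transfer[OF assms(3)])
  note [simp] = is_cokernelD[OF assms(1)] is_cokernelD[OF assms(2)]
  show "c' \<in> Arr \<A>" "Dom \<A> c' = Dom \<A> c" by simp_all
  obtain u v where uv: "u \<in> Arr \<A>" "Dom \<A> u = Cod \<A> c" "Cod \<A> u = Cod \<A> c'" "u \<cdot> c = c'"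
    "v \<in> Arr \<A>" "Dom \<A> v = Cod \<A> c'" "Cod \<A> v = Cod \<A> c" "v \<cdot> c' = c"
    using is_cokernel_desc[OF assms(1), of c'] is_cokernel_desc[OF assms(2), of c] by auto
  show "c \<cdot> h = Zero \<A> (Dom \<A> h) (Cod \<A> c) \<longleftrightarrow> c' \<cdot> h = Zero \<A> (Dom \<A> h) (Cod \<A> c')"
    if h: "h \<in> Arr \<A>" "Cod \<A> h = Dom \<A> c" for h
  proof
    assume *: "c \<cdot> h = Zero \<A> (Dom \<A> h) (Cod \<A> c)"
    have "c' \<cdot> h = u \<cdot> (c \<cdot> h)" using h uv(1-3) by (subst uv(4)[symmetric]) simp
    then show "c' \<cdot> h = Zero \<A> (Dom \<A> h) (Cod \<A> c')" unfolding * using h uv(1-3) by simp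
  next
    assume *: "c' \<cdot> h = Zero \<A> (Dom \<A> h) (Cod \<A> c')"
    have "c \<cdot> h = v \<cdot> (c' \<cdot> h)" using h uv(5-7) by (subst uv(8)[symmetric]) simp
    then show "c \<cdot> h = Zero \<A> (Dom \<A> h) (Cod \<A> c)" unfolding * using h uv(5-7) by simp
  qed
qed

lemma kernels_transfer:
  assumes "is_kernel \<A> k f" "is_kernel \<A> k' f" "is_kernel \<A> k' g"
  shows "is_kernel \<A> k g"
proof (rule is_kernel_transfer[OF assms(1)])
  have [simp]: "Dom \<A> g = Dom \<A> f"
    using is_kernelD(3)[OF assms(3)] is_kernelD(3)[OF assms(2)] by simp
  note [simp] = is_kernelD[OF assms(2)] is_kernelD(2,4)[OF assms(3)]
    is_kernelD(4)[OF assms(2), THEN Comp_reassoc] is_kernelD(4)[OF assms(3), THEN Comp_reassoc]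
  show "g \<in> Arr \<A>" by simp
  show "Dom \<A> g = Dom \<A> f" by simp
  show "f \<cdot> h = Zero \<A> (Dom \<A> h) (Cod \<A> f) \<longleftrightarrow> g \<cdot> h = Zero \<A> (Dom \<A> h) (Cod \<A> g)"
    if h: "h \<in> Arr \<A>" "Cod \<A> h = Dom \<A> f" for h
  proof
    assume "f \<cdot> h = Zero \<A> (Dom \<A> h) (Cod \<A> f)"
    then obtain u where u: "u \<in> Arr \<A>" "Dom \<A> u = Dom \<A> h" "Cod \<A> u = Dom \<A> k'" "k' \<cdot> u = h"
      using is_kernel_lift'[OF assms(2) h] by auto
    have "g \<cdot> h = (g \<cdot> k') \<cdot> u" using u(1-3) by (subst u(4)[symmetric]) simp
    then show "g \<cdot> h = Zero \<A> (Dom \<A> h) (Cod \<A> g)" using u(1-3) by simp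
  next
    assume "g \<cdot> h = Zero \<A> (Dom \<A> h) (Cod \<A> g)"
    then obtain u where u: "u \<in> Arr \<A>" "Dom \<A> u = Dom \<A> h" "Cod \<A> u = Dom \<A> k'" "k' \<cdot> u = h"
      using is_kernel_lift'[OF assms(3)] h is_kernelD(3)[OF assms(3)] is_kernelD(3)[OF assms(2)] by auto
    have "f \<cdot> h = (f \<cdot> k') \<cdot> u" using u(1-3) by (subst u(4)[symmetric]) simp
    then show "f \<cdot> h = Zero \<A> (Dom \<A> h) (Cod \<A> f)" using u(1-3) by simp
  qed
qed

text \<open>\<open>exact_at\<close> asserts only that some image of \<open>f\<close> is a kernel of
  \<open>g\<close>. Two cokernels of \<open>f\<close> factor through each other and so annihilate
  the same morphisms, and so do two morphisms with a kernel in common; hence the choice of the image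
  is immaterial.\<close>

lemma image_is_kernel:
  assumes "exact_at \<A> f g" "is_image \<A> k f"
  shows "is_kernel \<A> k g"
proof -
  obtain k' c' c where "is_cokernel \<A> c' f" "is_kernel \<A> k' c'" "is_kernel \<A> k' g"
    "is_cokernel \<A> c f" "is_kernel \<A> k c"
    using assms unfolding exact_at_def is_image_def by blast
  then show ?thesis using kernels_transfer kernel_of_cokernels by blast
qed

lemma is_kernel_eqI:
  assumes "is_kernel \<A> k f" "u \<in> Arr \<A>" "v \<in> Arr \<A>" "Dom \<A> u = Dom \<A> v"
    "Cod \<A> u = Dom \<A> k" "Cod \<A> v = Dom \<A> k" "k \<cdot> u = k \<cdot> v"
  shows "u = v"
proof -
  note [simp] = is_kernelD[OF assms(1)]
  have "f \<cdot> (k \<cdot> v) = Zero \<A> (Dom \<A> v) (Cod \<A> f)"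
    using assms(2-6) by (simp add: Comp_reassoc[OF is_kernelD(4)[OF assms(1)]])
  then show ?thesis using is_kernel_lift[OF assms(1), of "k \<cdot> v"] assms(2-7) by auto
qed

text \<open>If \<open>x\<close> annihilates \<open>e\<close>, then \<open>f\<close> factors through
  the subobject \<open>k \<cdot> m\<close>, where \<open>m\<close> is the kernel of
  \<open>x\<close>. By normality this subobject is the kernel of some \<open>y\<close>, which
  annihilates \<open>f\<close> and therefore its image \<open>k\<close>. So \<open>k\<close> factors
  through \<open>k \<cdot> m\<close>; this gives \<open>m\<close> a right inverse and forces
  \<open>x\<close> to be zero.\<close>

lemma image_factorization:
  assumes "is_image \<A> k f"
  obtains e where "epic \<A> e" "Dom \<A> e = Dom \<A> f" "Cod \<A> e = Dom \<A> k" "k \<cdot> e = f"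
proof -
  obtain c where c: "is_cokernel \<A> c f" and k: "is_kernel \<A> k c"
    using assms unfolding is_image_def by blast
  note [simp] = is_cokernelD[OF c] is_kernelD[OF k]
  obtain e where e: "e \<in> Arr \<A>" "Dom \<A> e = Dom \<A> f" "Cod \<A> e = Dom \<A> k" "k \<cdot> e = f"
    using is_kernel_lift'[OF k, of f] by auto
  have "epic \<A> e"
  proof (rule epicI_Zero)
    fix x assume x: "x \<in> Arr \<A>" "Dom \<A> x = Cod \<A> e" "x \<cdot> e = Zero \<A> (Dom \<A> e) (Cod \<A> x)"
    obtain m where m: "is_kernel \<A> m x" using ex_kernel[OF x(1)] by blast
    note [simp] = is_kernelD[OF m] is_kernelD(4)[OF m, THEN Comp_reassoc]
    obtain e' where e': "e' \<in> Arr \<A>" "Dom \<A> e' = Dom \<A> e" "Cod \<A> e' = Dom \<A> m" "m \<cdot> e' = e"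
      using is_kernel_lift'[OF m e(1)] x by auto
    have "monic \<A> (k \<cdot> m)"
      unfolding monic_def
    proof (intro conjI allI ballI impI)
      fix W u v assume *: "u \<in> Hom \<A> W (Dom \<A> (k \<cdot> m))" "v \<in> Hom \<A> W (Dom \<A> (k \<cdot> m))"
        and **: "k \<cdot> m \<cdot> u = k \<cdot> m \<cdot> v"
      have [simp]: "u \<in> Arr \<A>" "Dom \<A> u = W" "Cod \<A> u = Dom \<A> m" "v \<in> Arr \<A>" "Dom \<A> v = W" "Cod \<A> v = Dom \<A> m"
        using * x e by simp_all
      have "m \<cdot> u = m \<cdot> v" by (rule is_kernel_eqI[OF k]) (use x e ** in simp_all)
      then show "u = v" by - (rule is_kernel_eqI[OF m]; simp)
    qed (use x e in simp)
    then obtain y where y: "is_kernel \<A> (k \<cdot> m) y" using monic_normal by blast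
    have km: "k \<cdot> m \<in> Arr \<A>" "Dom \<A> (k \<cdot> m) = Dom \<A> m" "Cod \<A> (k \<cdot> m) = Cod \<A> f"
      using x e by simp_all
    have ya: "y \<in> Arr \<A>" "Dom \<A> y = Cod \<A> f" and y0: "y \<cdot> (k \<cdot> m) = Zero \<A> (Dom \<A> m) (Cod \<A> y)"
      using is_kernelD[OF y] km by simp_all
    have "y \<cdot> f = (y \<cdot> (k \<cdot> m)) \<cdot> e'"
      using km ya e' x e by (simp add: Comp_assoc_simp[symmetric] del: Comp_assoc_simp) (simp add: e'(4) e(4))
    then have "y \<cdot> f = Zero \<A> (Dom \<A> f) (Cod \<A> y)" unfolding y0 using ya e' e by simp
    then obtain z where z: "z \<in> Arr \<A>" "Dom \<A> z = Cod \<A> c" "Cod \<A> z = Cod \<A> y" "z \<cdot> c = y"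
      using is_cokernel_desc[OF c ya] by auto
    have "y \<cdot> k = z \<cdot> (c \<cdot> k)" using z(1-3) by (subst z(4)[symmetric]) simp
    then have "y \<cdot> k = Zero \<A> (Dom \<A> k) (Cod \<A> y)" using z(1-3) by simp
    then obtain t where t: "t \<in> Arr \<A>" "Dom \<A> t = Dom \<A> k" "Cod \<A> t = Dom \<A> m" "k \<cdot> m \<cdot> t = k"
      using is_kernel_lift'[OF y, of k] km ya by auto
    have "m \<cdot> t = Ident \<A> (Dom \<A> k)"
      by (rule is_kernel_eqI[OF k]) (use t x e in simp_all)
    then have "x = x \<cdot> (m \<cdot> t)" using x e by simp
    also have "\<dots> = Zero \<A> (Cod \<A> e) (Cod \<A> x)" using t(1-3) x(1,2) e(3) by simp
    finally show "x = Zero \<A> (Cod \<A> e) (Cod \<A> x)" .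
  qed (use e in simp)
  then show ?thesis using e by (intro that[of e]) simp_all
qed

text \<open>Corestricting \<open>g\<close> to its image makes it epic and keeps its kernel, since
  \<open>k'\<close> is monic. This is the cut that turns a complex into short exact
  sequences.\<close>

lemma exact_at_SES:
  assumes "exact_at \<A> f g" "is_image \<A> k f" "is_image \<A> k' g"
  obtains e where "SES \<A> (Dom \<A> k) k (Dom \<A> g) e (Dom \<A> k')" "k' \<cdot> e = g"
proof -
  obtain e where e: "epic \<A> e" "Dom \<A> e = Dom \<A> g" "Cod \<A> e = Dom \<A> k'" "k' \<cdot> e = g"
    by (rule image_factorization[OF assms(3)])
  have k: "is_kernel \<A> k g" by (rule image_is_kernel[OF assms(1,2)])
  obtain c' where c': "is_kernel \<A> k' c'" using assms(3) unfolding is_image_def by blast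
  have ea: "e \<in> Arr \<A>" using e(1) unfolding epic_def by simp
  note [simp] = is_kernelD[OF k] is_kernelD(1-3)[OF c']
  have [simp]: "Dom \<A> c' = Cod \<A> g" using Comp_simps(3)[OF ea, of k'] e by simp
  have "is_kernel \<A> k e"
  proof (rule is_kernel_transfer[OF k ea e(2)])
    fix h assume h: "h \<in> Arr \<A>" "Cod \<A> h = Dom \<A> g"
    have gh: "g \<cdot> h = k' \<cdot> (e \<cdot> h)" using h ea e(2,3) by (subst e(4)[symmetric]) simp
    show "g \<cdot> h = Zero \<A> (Dom \<A> h) (Cod \<A> g) \<longleftrightarrow> e \<cdot> h = Zero \<A> (Dom \<A> h) (Cod \<A> e)"
    proof
      assume "g \<cdot> h = Zero \<A> (Dom \<A> h) (Cod \<A> g)"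
      then show "e \<cdot> h = Zero \<A> (Dom \<A> h) (Cod \<A> e)"
        using h ea e(2,3) gh by - (rule is_kernel_eqI[OF c'], simp_all)
    next
      assume *: "e \<cdot> h = Zero \<A> (Dom \<A> h) (Cod \<A> e)"
      show "g \<cdot> h = Zero \<A> (Dom \<A> h) (Cod \<A> g)" unfolding gh * using h ea e(2,3) by simp
    qed
  qed
  from SES_kernel_epic[OF this e(1)] show ?thesis using e by (intro that[of e]) simp_all
qed

section \<open>Zero objects and the comparison of the two notions of short exactness\<close>

lemma zero_object_Ob: "is_zero_object \<A> Z \<Longrightarrow> Z \<in> Ob \<A>"
  by (simp add: is_zero_object_def)

lemma zero_object_eq:
  assumes "is_zero_object \<A> Z" "f \<in> Arr \<A>" "Cod \<A> f = Z"
  shows "f = Zero \<A> (Dom \<A> f) Z"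
proof -
  have "f \<in> Hom \<A> (Dom \<A> f) Z" "Zero \<A> (Dom \<A> f) Z \<in> Hom \<A> (Dom \<A> f) Z" "Dom \<A> f \<in> Ob \<A>"
    using assms zero_object_Ob by simp_all
  then show ?thesis using assms(1) unfolding is_zero_object_def by blast
qed

lemma SES_Ident:
  assumes "is_zero_object \<A> Z" "X \<in> Ob \<A>"
  shows "SES \<A> X (Ident \<A> X) X (Zero \<A> X Z) Z"
proof (rule SESI)
  have [simp]: "Z \<in> Ob \<A>" by (rule zero_object_Ob[OF assms(1)])
  note [simp] = assms(2)
  show "Dom \<A> (Zero \<A> X Z) = X" "Zero \<A> X Z \<in> Arr \<A>" "Cod \<A> (Zero \<A> X Z) = Z"
    "Zero \<A> X Z \<cdot> Ident \<A> X = Zero \<A> X Z" by simp_all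
  show "x = Zero \<A> Z (Cod \<A> x)" if x: "x \<in> Arr \<A>" "Dom \<A> x = Z" for x
    using abelian_category.zero_object_eq[OF abelian_category_op_cat, of Z x] that assms(1) by simp
qed (use assms in auto)

lemma SES_Ident':
  assumes "is_zero_object \<A> Z" "X \<in> Ob \<A>"
  shows "SES \<A> Z (Zero \<A> Z X) X (Ident \<A> X) X"
  using abelian_category.SES_Ident[OF abelian_category_op_cat, of Z X] assms by simp

lemma is_kernel_zero:
  assumes "is_zero_object \<A> Z" "SES \<A> X f Y g V"
  shows "is_kernel \<A> (Zero \<A> Z X) f"
proof -
  note [simp] = SES_simps[OF assms(2)] zero_object_Ob[OF assms(1)]
  show ?thesis
  proof (rule is_kernel_transfer[of _ "Ident \<A> X"])
    show "is_kernel \<A> (Zero \<A> Z X) (Ident \<A> X)"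
      using SES_Ident'[OF assms(1), of X] by (simp add: SES_def)
    show "Ident \<A> X \<cdot> h = Zero \<A> (Dom \<A> h) (Cod \<A> (Ident \<A> X)) \<longleftrightarrow> f \<cdot> h = Zero \<A> (Dom \<A> h) (Cod \<A> f)"
      if "h \<in> Arr \<A>" "Cod \<A> h = Dom \<A> (Ident \<A> X)" for h
    proof
      assume "Ident \<A> X \<cdot> h = Zero \<A> (Dom \<A> h) (Cod \<A> (Ident \<A> X))"
      then have "h = Zero \<A> (Dom \<A> h) X" using that by simp
      then have "f \<cdot> h = f \<cdot> Zero \<A> (Dom \<A> h) X" by (rule arg_cong)
      then show "f \<cdot> h = Zero \<A> (Dom \<A> h) (Cod \<A> f)" using that by simp
    next
      assume "f \<cdot> h = Zero \<A> (Dom \<A> h) (Cod \<A> f)"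
      then have "h = Zero \<A> (Dom \<A> h) X" using that by - (rule SES_mono_Zero[OF assms(2)], simp_all)
      then show "Ident \<A> X \<cdot> h = Zero \<A> (Dom \<A> h) (Cod \<A> (Ident \<A> X))" using that by simp
    qed
  qed simp_all
qed

lemma zero_object_is_zero: "is_zero_object \<A> (zero_object \<A>)"
  unfolding zero_object_def using ex_zero_object by (rule someI_ex)

text \<open>Exactness at the outer places makes \<open>f\<close> monic and \<open>g\<close> epic. A
  monomorphism is the kernel of its cokernel, and exactness in the middle identifies this with the
  kernel of \<open>g\<close>.\<close>

lemma short_exact_iff: "short_exact \<A> f g \<longleftrightarrow> SES \<A> (Dom \<A> f) f (Dom \<A> g) g (Cod \<A> g)"
proof
  let ?Z = "zero_object \<A>"
  note z = zero_object_is_zero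
  have [simp]: "?Z \<in> Ob \<A>" by (rule zero_object_Ob[OF z])
  {
    assume "short_exact \<A> f g"
    then have ex: "exact_at \<A> (Zero \<A> ?Z (Dom \<A> f)) f" "exact_at \<A> f g"
      "exact_at \<A> g (Zero \<A> (Cod \<A> g) ?Z)"
      by (simp_all add: short_exact_def exact_def zero_ends_def)
    obtain k c where 1: "is_cokernel \<A> c (Zero \<A> ?Z (Dom \<A> f))" "is_kernel \<A> k c" "is_kernel \<A> k f"
      using ex(1) unfolding exact_at_def is_image_def by blast
    obtain k' c' where 2: "is_cokernel \<A> c' f" "is_kernel \<A> k' c'" "is_kernel \<A> k' g"
      using ex(2) unfolding exact_at_def is_image_def by blast
    obtain k'' c'' where 3: "is_cokernel \<A> c'' g" "is_kernel \<A> k'' c''"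
      "is_kernel \<A> k'' (Zero \<A> (Cod \<A> g) ?Z)"
      using ex(3) unfolding exact_at_def is_image_def by blast
    have fg: "f \<in> Arr \<A>" "g \<in> Arr \<A>" "Cod \<A> f = Dom \<A> g"
      using is_cokernelD[OF 2(1)] is_kernelD[OF 2(2)] is_kernelD[OF 2(3)] by simp_all
    note [simp] = fg
    have f0: "u = Zero \<A> (Dom \<A> u) (Dom \<A> f)"
      if u: "u \<in> Arr \<A>" "Cod \<A> u = Dom \<A> f" "f \<cdot> u = Zero \<A> (Dom \<A> u) (Dom \<A> g)" for u
    proof -
      note c = is_cokernelD[OF 1(1)] and k = is_kernelD[OF 1(2)]
      obtain w where w: "w \<in> Arr \<A>" "Dom \<A> w = Dom \<A> u" "Cod \<A> w = Dom \<A> k" "k \<cdot> w = u"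
        using is_kernel_lift'[OF 1(3) u(1)] u by auto
      \<comment> \<open>The identity annihilates the zero morphism and therefore factors through its
        cokernel \<open>c\<close>. So \<open>c\<close> has a left inverse, and its kernel
        \<open>k\<close>, which is also the kernel of \<open>f\<close>, is zero.\<close>
      obtain v where v: "v \<in> Arr \<A>" "Dom \<A> v = Cod \<A> c" "Cod \<A> v = Dom \<A> f" "v \<cdot> c = Ident \<A> (Dom \<A> f)"
        using is_cokernel_desc[OF 1(1), of "Ident \<A> (Dom \<A> f)"] by auto
      have "u = (v \<cdot> c) \<cdot> u" unfolding v(4) using u by simp
      also have "\<dots> = v \<cdot> (c \<cdot> (k \<cdot> w))" using u c v(1-3) unfolding w(4) by simp
      also have "\<dots> = v \<cdot> ((c \<cdot> k) \<cdot> w)" using w(1-3) v(1-3) c(1-3) k(1-3) by simp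
      also have "\<dots> = Zero \<A> (Dom \<A> u) (Dom \<A> f)" unfolding k(4) using u(1) w(1-3) v(1-3) c(1) by simp
      finally show ?thesis .
    qed
    have "monic \<A> f"
      using abelian_category.epicI_Zero[OF abelian_category_op_cat, of f] f0 by simp
    then obtain C p where fp: "SES \<A> (Dom \<A> f) f (Dom \<A> g) p C" using monic_SES[of f] by auto
    note c' = is_cokernelD[OF 2(1)] is_kernelD[OF 2(2)] is_kernelD[OF 2(3)]
    have "is_kernel \<A> f p" "is_cokernel \<A> p f" using fp by (auto simp: SES_def)
    then have "is_kernel \<A> f g"
      using kernel_of_cokernels[OF _ 2(1)] kernels_transfer[OF _ 2(2,3)] by blast
    moreover have "epic \<A> g"
    proof (rule epicI_Zero)
      fix x assume x: "x \<in> Arr \<A>" "Dom \<A> x = Cod \<A> g" "x \<cdot> g = Zero \<A> (Dom \<A> g) (Cod \<A> x)"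
      note c = is_cokernelD[OF 3(1)] and k = is_kernelD[OF 3(2)]
      obtain w where w: "w \<in> Arr \<A>" "Dom \<A> w = Cod \<A> c''" "Cod \<A> w = Cod \<A> x" "w \<cdot> c'' = x"
        using is_cokernel_desc[OF 3(1) x(1)] x by auto
      \<comment> \<open>The identity factors through the kernel \<open>k''\<close> of a zero
        morphism, so \<open>c''\<close>, which annihilates \<open>k''\<close>, is zero; and
        \<open>x\<close> factors through \<open>c''\<close>.\<close>
      obtain v where v: "v \<in> Arr \<A>" "Dom \<A> v = Cod \<A> g" "Cod \<A> v = Dom \<A> k''" "k'' \<cdot> v = Ident \<A> (Cod \<A> g)"
        using is_kernel_lift'[OF 3(3), of "Ident \<A> (Cod \<A> g)"] by auto
      have "x = x \<cdot> (k'' \<cdot> v)" unfolding v(4) using x by simp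
      also have "\<dots> = w \<cdot> ((c'' \<cdot> k'') \<cdot> v)"
        using w(1-3) v(1-3) c(1-3) k(1-3) by (subst w(4)[symmetric]) simp
      also have "\<dots> = Zero \<A> (Cod \<A> g) (Cod \<A> x)" unfolding k(4) using w(1-3) v(1-3) c(1) by simp
      finally show "x = Zero \<A> (Cod \<A> g) (Cod \<A> x)" .
    qed simp
    ultimately show "SES \<A> (Dom \<A> f) f (Dom \<A> g) g (Cod \<A> g)"
      using SES_kernel_epic[of f g] by simp
  }
  assume s: "SES \<A> (Dom \<A> f) f (Dom \<A> g) g (Cod \<A> g)"
  note [simp] = SES_simps(1,3,4,7,11)[OF s]
  have i1: "SES \<A> ?Z (Zero \<A> ?Z (Dom \<A> f)) (Dom \<A> f) (Ident \<A> (Dom \<A> f)) (Dom \<A> f)"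
    by (rule SES_Ident'[OF z]) simp
  have i2: "SES \<A> (Cod \<A> g) (Ident \<A> (Cod \<A> g)) (Cod \<A> g) (Zero \<A> (Cod \<A> g) ?Z) ?Z"
    by (rule SES_Ident[OF z]) simp
  have "is_kernel \<A> (Zero \<A> ?Z (Dom \<A> f)) f" by (rule is_kernel_zero[OF z s])
  then have "exact_at \<A> (Zero \<A> ?Z (Dom \<A> f)) f"
    using i1 unfolding exact_at_def is_image_def SES_def by blast
  moreover have "exact_at \<A> f g"
    using s unfolding exact_at_def is_image_def SES_def by blast
  moreover have "is_cokernel \<A> (Zero \<A> (Cod \<A> g) ?Z) g"
    using abelian_category.is_kernel_zero[OF abelian_category_op_cat, of ?Z "Cod \<A> g" g "Dom \<A> g" f "Dom \<A> f"] z s by simp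
  then have "exact_at \<A> g (Zero \<A> (Cod \<A> g) ?Z)"
    using i2 unfolding exact_at_def is_image_def SES_def by blast
  ultimately show "short_exact \<A> f g"
    by (simp add: short_exact_def exact_def zero_ends_def)
qed

lemma Hom_exact_at_iff:
  assumes "f \<in> Arr \<A>" "g \<in> Arr \<A>" "Cod \<A> f = Dom \<A> g"
  shows "Hom_exact_at \<A> E f g \<longleftrightarrow>
    (\<forall>x \<in> Hom \<A> E (Dom \<A> g). (g \<cdot> x = Zero \<A> E (Cod \<A> g)) = (\<exists>y \<in> Hom \<A> E (Dom \<A> f). x = f \<cdot> y))"
proof -
  have "(\<lambda>h. f \<cdot> h) ` Hom \<A> E (Dom \<A> f) \<subseteq> Hom \<A> E (Dom \<A> g)" using assms by auto
  then show ?thesis unfolding Hom_exact_at_def kernel_def hom_group_def image_def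
    by (auto simp del: Hom_iff)
qed

lemma Hom_op_exact_at_op_cat: "Hom_op_exact_at \<A> E f g \<longleftrightarrow> Hom_exact_at (op_cat \<A>) E g f"
  by (simp add: Hom_op_exact_at_def Hom_exact_at_def del: Hom_iff)

text \<open>Hom(E, -) is left exact, so of the three exactness conditions only the surjectivity at
  the right end carries information.\<close>

lemma proper_short_exact_iff:
  assumes "\<E> \<subseteq> Ob \<A>"
  shows "proper_short_exact \<A> \<E> f g \<longleftrightarrow> SES \<A> (Dom \<A> f) f (Dom \<A> g) g (Cod \<A> g) \<and>
    (\<forall>E \<in> \<E>. \<forall>h \<in> Hom \<A> E (Cod \<A> g). \<exists>l \<in> Hom \<A> E (Dom \<A> g). g \<cdot> l = h)"
proof (cases "SES \<A> (Dom \<A> f) f (Dom \<A> g) g (Cod \<A> g)")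
  case s: True
  let ?Z = "zero_object \<A>"
  note z = zero_object_is_zero
  note [simp] = SES_simps(1,3,4,7,11)[OF s] zero_object_Ob[OF z]
  have "successively (Hom_exact_at \<A> E) (zero_ends \<A> [f, g]) \<longleftrightarrow>
      (\<forall>h \<in> Hom \<A> E (Cod \<A> g). \<exists>l \<in> Hom \<A> E (Dom \<A> g). g \<cdot> l = h)" if "E \<in> \<E>" for E
  proof -
    have E[simp]: "E \<in> Ob \<A>" using assms that by blast
    have "Hom_exact_at \<A> E (Zero \<A> ?Z (Dom \<A> f)) f"
    proof (subst Hom_exact_at_iff, simp_all del: Hom_iff, intro ballI iffI)
      fix x assume x: "x \<in> Hom \<A> E (Dom \<A> f)" "f \<cdot> x = Zero \<A> E (Dom \<A> g)"
      then have "x = Zero \<A> ?Z (Dom \<A> f) \<cdot> Zero \<A> E ?Z" using SES_mono_Zero[OF s, of x] by simp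
      moreover have "Zero \<A> E ?Z \<in> Hom \<A> E ?Z" by simp
      ultimately show "\<exists>y \<in> Hom \<A> E ?Z. x = Zero \<A> ?Z (Dom \<A> f) \<cdot> y" by blast
    next
      fix x assume "x \<in> Hom \<A> E (Dom \<A> f)" "\<exists>y \<in> Hom \<A> E ?Z. x = Zero \<A> ?Z (Dom \<A> f) \<cdot> y"
      then obtain y where "y \<in> Hom \<A> E ?Z" "x = Zero \<A> ?Z (Dom \<A> f) \<cdot> y" by blast
      then show "f \<cdot> x = Zero \<A> E (Dom \<A> g)" by simp
    qed
    moreover have "Hom_exact_at \<A> E f g"
    proof (subst Hom_exact_at_iff, simp_all del: Hom_iff, intro ballI iffI)
      fix x assume x: "x \<in> Hom \<A> E (Dom \<A> g)" "g \<cdot> x = Zero \<A> E (Cod \<A> g)"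
      then obtain u where "u \<in> Arr \<A>" "Dom \<A> u = Dom \<A> x" "Cod \<A> u = Dom \<A> f" "f \<cdot> u = x"
        using SES_lift[OF s, of x] by auto
      then show "\<exists>y \<in> Hom \<A> E (Dom \<A> f). x = f \<cdot> y" using x(1) by (intro bexI[of _ u]) simp_all
    next
      fix x assume "\<exists>y \<in> Hom \<A> E (Dom \<A> f). x = f \<cdot> y"
      then show "g \<cdot> x = Zero \<A> E (Cod \<A> g)" by auto
    qed
    moreover have "Hom_exact_at \<A> E g (Zero \<A> (Cod \<A> g) ?Z) \<longleftrightarrow>
      (\<forall>h \<in> Hom \<A> E (Cod \<A> g). \<exists>l \<in> Hom \<A> E (Dom \<A> g). g \<cdot> l = h)"
      by (subst Hom_exact_at_iff) auto
    ultimately show ?thesis by (simp add: zero_ends_def del: Hom_iff)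
  qed
  then show ?thesis using s unfolding proper_short_exact_def Hom_exact_def short_exact_iff by blast
qed (simp add: proper_short_exact_def short_exact_iff)

end

section \<open>Yoneda extensions of degree 1\<close>

lemma is_singleton_quotient_iff:
  assumes "a \<in> A"
  shows "is_singleton (A // r) \<longleftrightarrow> (\<forall>x \<in> A. r `` {x} = r `` {a})"
proof -
  have "A // r = (\<lambda>x. r `` {x}) ` A" by (auto simp: quotient_def)
  moreover have "is_singleton (f ` A) \<longleftrightarrow> (\<forall>x \<in> A. f x = f a)" for f :: "'a \<Rightarrow> 'a set"
  proof
    assume "is_singleton (f ` A)"
    then obtain y where y: "f ` A = {y}" by (rule is_singletonE)
    have "f x = y" if "x \<in> A" for x using imageI[OF that, of f] unfolding y by simp
    then show "\<forall>x \<in> A. f x = f a" using assms by simp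
  next
    assume "\<forall>x \<in> A. f x = f a"
    then have "f ` A = (\<lambda>_. f a) ` A" by (intro image_cong refl) blast
    then show "is_singleton (f ` A)" using image_constant[OF assms, of "f a"] by simp
  qed
  ultimately show ?thesis by simp
qed

context abelian_category
begin

lemma extensions_1_iff:
  "fs \<in> extensions \<A> 1 X Y \<longleftrightarrow> (\<exists>f E g. fs = [f, g] \<and> SES \<A> Y f E g X)"
proof
  assume "fs \<in> extensions \<A> 1 X Y"
  then obtain f g where fs: "fs = [f, g]" "Dom \<A> f = Y" "Cod \<A> g = X" "exact \<A> (zero_ends \<A> [f, g])"
    by (auto simp: extensions_def length_Suc_conv)
  then have "SES \<A> Y f (Dom \<A> g) g X" using short_exact_iff unfolding short_exact_def by auto
  then show "\<exists>f E g. fs = [f, g] \<and> SES \<A> Y f E g X" using fs(1) by blast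
next
  assume "\<exists>f E g. fs = [f, g] \<and> SES \<A> Y f E g X"
  then obtain f E g where fs: "fs = [f, g]" and s: "SES \<A> Y f E g X" by blast
  have "short_exact \<A> f g" unfolding short_exact_iff using s SES_simps[OF s] by simp
  then show "fs \<in> extensions \<A> 1 X Y"
    using SES_simps[OF s] by (simp add: fs extensions_def short_exact_def)
qed

lemma extension_morphism_1_iff:
  assumes "SES \<A> Y f E g X" "SES \<A> Y f' E' g' X"
  shows "extension_morphism \<A> 1 X Y [f, g] [f', g'] \<longleftrightarrow>
    (\<exists>h \<in> Hom \<A> E E'. h \<cdot> f = f' \<and> g' \<cdot> h = g)"
proof -
  note [simp] = SES_simps[OF assms(1)] SES_simps[OF assms(2)]
  have all_le: "(\<forall>i\<le>1. P i) \<longleftrightarrow> P 0 \<and> P (Suc 0)" for P :: "nat \<Rightarrow> bool"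
    by (auto simp: le_Suc_eq)
  show ?thesis
  proof
    assume "extension_morphism \<A> 1 X Y [f, g] [f', g']"
    then obtain h :: "nat \<Rightarrow> 'b" where h: "h 0 = Ident \<A> Y" "h (Suc 1) = Ident \<A> X"
      and "\<forall>i \<le> 1. h i \<in> Hom \<A> (Dom \<A> ([f, g] ! i)) (Dom \<A> ([f', g'] ! i)) \<and>
        h (Suc i) \<cdot> [f, g] ! i = [f', g'] ! i \<cdot> h i"
      unfolding extension_morphism_def by blast
    then have "h 1 \<in> Hom \<A> E E'" "h 1 \<cdot> f = f' \<cdot> h 0" "h (Suc 1) \<cdot> g = g' \<cdot> h 1"
      unfolding all_le by simp_all
    with h show "\<exists>h \<in> Hom \<A> E E'. h \<cdot> f = f' \<and> g' \<cdot> h = g" by (intro bexI[of _ "h 1"]) simp_all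
  next
    assume "\<exists>h \<in> Hom \<A> E E'. h \<cdot> f = f' \<and> g' \<cdot> h = g"
    then obtain h where "h \<in> Hom \<A> E E'" "h \<cdot> f = f'" "g' \<cdot> h = g" by blast
    then show "extension_morphism \<A> 1 X Y [f, g] [f', g']"
      unfolding extension_morphism_def all_le
      by (intro exI[of _ "\<lambda>i. if i = 0 then Ident \<A> Y else if i = 1 then h else Ident \<A> X"]) auto
  qed
qed

text \<open>A section is pushed forward along \<open>h\<close> and a retraction is pulled back along
  it. Splitting is thus constant along the relation that generates Yoneda equivalence, without an
  appeal to invertibility of \<open>h\<close>.\<close>

lemma extension_morphism_split_iff:
  assumes s: "SES \<A> Y f E g X" and s': "SES \<A> Y f' E' g' X"
    and h: "h \<in> Hom \<A> E E'" "h \<cdot> f = f'" "g' \<cdot> h = g"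
  shows "(\<exists>t \<in> Hom \<A> X E. g \<cdot> t = Ident \<A> X) \<longleftrightarrow> (\<exists>t \<in> Hom \<A> X E'. g' \<cdot> t = Ident \<A> X)"
proof
  note [simp] = SES_simps[OF s] SES_simps[OF s'] Comp_reassoc[OF h(3)]
  assume "\<exists>t \<in> Hom \<A> X E. g \<cdot> t = Ident \<A> X"
  then obtain t where "t \<in> Hom \<A> X E" "g \<cdot> t = Ident \<A> X" by blast
  then show "\<exists>t \<in> Hom \<A> X E'. g' \<cdot> t = Ident \<A> X"
    using h(1) by (intro bexI[of _ "h \<cdot> t"]) simp_all
next
  note [simp] = SES_simps[OF s] SES_simps[OF s'] h(2)
  assume "\<exists>t \<in> Hom \<A> X E'. g' \<cdot> t = Ident \<A> X"
  then obtain t where "t \<in> Hom \<A> X E'" "g' \<cdot> t = Ident \<A> X" by blast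
  then obtain r where r: "r \<in> Hom \<A> E' Y" "r \<cdot> f' = Ident \<A> Y" by (rule SES_split[OF s'])
  then have "r \<cdot> h \<in> Hom \<A> E Y" "(r \<cdot> h) \<cdot> f = Ident \<A> Y" using h(1) by simp_all
  then show "\<exists>t \<in> Hom \<A> X E. g \<cdot> t = Ident \<A> X" by (rule SES_split'[OF s]) blast
qed

text \<open>The direct sum is the base point among the classes. Splitting is invariant under Yoneda
  equivalence and holds at the base point; conversely, a split extension maps to the direct
  sum.\<close>

lemma Ext_zero_1_iff:
  assumes "X \<in> Ob \<A>" "Y \<in> Ob \<A>"
  shows "Ext_zero \<A> 1 X Y \<longleftrightarrow> ext1_zero \<A> X Y"
proof -
  let ?S = "extensions \<A> 1 X Y" and ?r = "extension_rel \<A> 1 X Y"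
  let ?R = "(?r \<union> ?r\<inverse>)\<^sup>*"
  define split where "split fs \<longleftrightarrow>
    (\<exists>t \<in> Hom \<A> X (Dom \<A> (fs ! 1)). fs ! 1 \<cdot> t = Ident \<A> X)" for fs
  have split_SES: "split [f, g] \<longleftrightarrow> (\<exists>t \<in> Hom \<A> X E. g \<cdot> t = Ident \<A> X)" if "SES \<A> Y f E g X" for f E g
    using SES_simps[OF that] by (simp add: split_def)
  obtain S i\<^sub>1 i\<^sub>2 p\<^sub>1 p\<^sub>2 where b: "is_biproduct \<A> Y X S i\<^sub>1 i\<^sub>2 p\<^sub>1 p\<^sub>2"
    by (rule biproduct_E[OF assms(2,1)])
  let ?f0 = "[i\<^sub>1, p\<^sub>2]"
  have f0: "?f0 \<in> ?S" "split ?f0"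
    using biproduct_SES[OF b] biproduct_simps[OF b] unfolding extensions_1_iff split_def
    by (auto intro: bexI[of _ i\<^sub>2])
  have split_rel: "split fs \<longleftrightarrow> split gs" if "(fs, gs) \<in> ?r" for fs gs
  proof -
    have "fs \<in> ?S" "gs \<in> ?S" "extension_morphism \<A> 1 X Y fs gs"
      using that unfolding extension_rel_def by blast+
    then obtain f E g f' E' g' where *: "fs = [f, g]" "SES \<A> Y f E g X" "gs = [f', g']" "SES \<A> Y f' E' g' X"
      "extension_morphism \<A> 1 X Y fs gs"
      unfolding extensions_1_iff by blast
    then obtain h where "h \<in> Hom \<A> E E'" "h \<cdot> f = f'" "g' \<cdot> h = g"
      using extension_morphism_1_iff[OF *(2,4)] by blast
    from extension_morphism_split_iff[OF *(2,4) this] show ?thesis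
      unfolding *(1,3) split_SES[OF *(2)] split_SES[OF *(4)] .
  qed
  have split_R: "split fs \<longleftrightarrow> split gs" if "(fs, gs) \<in> ?R" for fs gs
    using that by (induction rule: rtrancl_induct) (use split_rel in blast)+
  \<comment> \<open>The closure is an equivalence on all lists, extensions or not, so equality of
    classes is plain relatedness.\<close>
  have "equiv UNIV ?R"
    unfolding equiv_def by (auto intro: sym_rtrancl sym_Un_converse refl_rtrancl trans_rtrancl)
  then have R_iff: "?R `` {fs} = ?R `` {gs} \<longleftrightarrow> (fs, gs) \<in> ?R" for fs gs
    by (simp add: eq_equiv_class_iff del: One_nat_def)
  have "Ext_zero \<A> 1 X Y \<longleftrightarrow> (\<forall>fs \<in> ?S. ?R `` {fs} = ?R `` {?f0})"
    unfolding Ext_zero_def Ext_def by (rule is_singleton_quotient_iff[OF f0(1)])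
  also have "\<dots> \<longleftrightarrow> (\<forall>fs \<in> ?S. (fs, ?f0) \<in> ?R)" unfolding R_iff ..
  also have "\<dots> \<longleftrightarrow> (\<forall>fs \<in> ?S. split fs)"
  proof
    assume "\<forall>fs \<in> ?S. (fs, ?f0) \<in> ?R"
    then show "\<forall>fs \<in> ?S. split fs" using split_R f0(2) by blast
  next
    assume *: "\<forall>fs \<in> ?S. split fs"
    show "\<forall>fs \<in> ?S. (fs, ?f0) \<in> ?R"
    proof
      fix fs assume fs: "fs \<in> ?S"
      then obtain f E g where fg: "fs = [f, g]" and s: "SES \<A> Y f E g X" unfolding extensions_1_iff by blast
      note [simp] = SES_simps[OF s] biproduct_simps[OF b]
      obtain t where "t \<in> Hom \<A> X E" "g \<cdot> t = Ident \<A> X"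
        using * fs split_SES[OF s] fg by blast
      then obtain r where r: "r \<in> Hom \<A> E Y" "r \<cdot> f = Ident \<A> Y" by (rule SES_split[OF s])
      have "extension_morphism \<A> 1 X Y fs ?f0"
        \<comment> \<open>The components of the morphism to the direct sum are the retraction
          \<open>r\<close> and the given epimorphism \<open>g\<close>.\<close>
        unfolding fg extension_morphism_1_iff[OF s biproduct_SES[OF b]]
        by (rule bexI[of _ "Add \<A> (i\<^sub>1 \<cdot> r) (i\<^sub>2 \<cdot> g)"]) (use r in simp_all)
      then have "(fs, ?f0) \<in> ?r" using fs f0(1) by (simp add: extension_rel_def)
      then show "(fs, ?f0) \<in> ?R" by blast
    qed
  qed
  also have "\<dots> \<longleftrightarrow> ext1_zero \<A> X Y"
  proof
    assume *: "\<forall>fs \<in> ?S. split fs"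
    have "\<exists>t \<in> Hom \<A> X E. g \<cdot> t = Ident \<A> X" if "SES \<A> Y f E g X" for f E g
    proof -
      have "[f, g] \<in> ?S" unfolding extensions_1_iff using that by blast
      then show ?thesis using * split_SES[OF that] by blast
    qed
    then show "ext1_zero \<A> X Y" using assms unfolding ext1_zero_def by blast
  next
    assume *: "ext1_zero \<A> X Y"
    show "\<forall>fs \<in> ?S. split fs"
    proof
      fix fs assume "fs \<in> ?S"
      then obtain f E g where "fs = [f, g]" "SES \<A> Y f E g X" unfolding extensions_1_iff by blast
      then show "split fs" using * split_SES[of f E g] unfolding ext1_zero_def by blast
    qed
  qed
  finally show ?thesis .
qed

section \<open>Splicing short exact sequences\<close>

lemma is_kernel_comp_mono:
  assumes s: "SES \<A> X k Y g Z" and m: "SES \<A> Z m V n U"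
  shows "is_kernel \<A> k (m \<cdot> g)"
proof (rule is_kernel_transfer)
  note [simp] = SES_simps[OF s] SES_simps[OF m]
  show "is_kernel \<A> k g" using s by (simp add: SES_def)
  show "m \<cdot> g \<in> Arr \<A>" "Dom \<A> (m \<cdot> g) = Dom \<A> g" by simp_all
  fix h assume h: "h \<in> Arr \<A>" "Cod \<A> h = Dom \<A> g"
  show "g \<cdot> h = Zero \<A> (Dom \<A> h) (Cod \<A> g) \<longleftrightarrow> m \<cdot> g \<cdot> h = Zero \<A> (Dom \<A> h) (Cod \<A> (m \<cdot> g))"
  proof
    assume "m \<cdot> g \<cdot> h = Zero \<A> (Dom \<A> h) (Cod \<A> (m \<cdot> g))"
    then show "g \<cdot> h = Zero \<A> (Dom \<A> h) (Cod \<A> g)"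
      using SES_mono_Zero[OF m, of "g \<cdot> h"] h by simp
  qed (use h in simp)
qed

lemma is_cokernel_comp_epi:
  assumes "SES \<A> X k Y g Z" and "SES \<A> P n A e X"
  shows "is_cokernel \<A> g (k \<cdot> e)"
  using abelian_category.is_kernel_comp_mono[OF abelian_category_op_cat, of Z g Y k X e A n P] assms by simp

text \<open>The two composites are consecutive differentials of a spliced complex. A morphism
  annihilated by the second one factors through \<open>k\<close>, so Hom-exactness at
  \<open>Y\<close> only asks that morphisms into the image \<open>X\<close> lift along
  \<open>e\<close>.\<close>

lemma Hom_exact_at_splice:
  assumes s: "SES \<A> X k Y g Z" and e: "SES \<A> P n A e X" and m: "SES \<A> Z m V q U"
  shows "Hom_exact_at \<A> E (k \<cdot> e) (m \<cdot> g) \<longleftrightarrow> (\<forall>h \<in> Hom \<A> E X. \<exists>v \<in> Hom \<A> E A. e \<cdot> v = h)"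
proof -
  note [simp] = SES_simps[OF s] SES_simps[OF e] SES_simps[OF m]
  have mg: "m \<cdot> g \<cdot> x = Zero \<A> E V \<longleftrightarrow> (\<exists>y \<in> Hom \<A> E X. x = k \<cdot> y)" if x: "x \<in> Hom \<A> E Y" for x
  proof
    assume "m \<cdot> g \<cdot> x = Zero \<A> E V"
    then obtain y where "y \<in> Arr \<A>" "Dom \<A> y = E" "Cod \<A> y = X" "k \<cdot> y = x"
      using is_kernel_lift'[OF is_kernel_comp_mono[OF s m], of x] x by auto
    then show "\<exists>y \<in> Hom \<A> E X. x = k \<cdot> y" by (intro bexI[of _ y]) simp_all
  next
    assume "\<exists>y \<in> Hom \<A> E X. x = k \<cdot> y"
    then show "m \<cdot> g \<cdot> x = Zero \<A> E V" by auto
  qed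
  have "Hom_exact_at \<A> E (k \<cdot> e) (m \<cdot> g) \<longleftrightarrow>
    (\<forall>x \<in> Hom \<A> E Y. (\<exists>y \<in> Hom \<A> E X. x = k \<cdot> y) = (\<exists>v \<in> Hom \<A> E A. x = k \<cdot> e \<cdot> v))"
    using mg by (subst Hom_exact_at_iff) (simp_all del: Hom_iff)
  also have "\<dots> \<longleftrightarrow> (\<forall>h \<in> Hom \<A> E X. \<exists>v \<in> Hom \<A> E A. e \<cdot> v = h)"
  proof (intro iffI ballI)
    fix h assume *: "\<forall>x \<in> Hom \<A> E Y. (\<exists>y \<in> Hom \<A> E X. x = k \<cdot> y) = (\<exists>v \<in> Hom \<A> E A. x = k \<cdot> e \<cdot> v)"
      and h: "h \<in> Hom \<A> E X"
    have "k \<cdot> h \<in> Hom \<A> E Y" using h by simp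
    then obtain v where v: "v \<in> Hom \<A> E A" "k \<cdot> h = k \<cdot> e \<cdot> v" using * h by blast
    have "h = e \<cdot> v" by (rule SES_mono[OF s]) (use h v in simp_all)
    then show "\<exists>v \<in> Hom \<A> E A. e \<cdot> v = h" using v by blast
  next
    fix x assume *: "\<forall>h \<in> Hom \<A> E X. \<exists>v \<in> Hom \<A> E A. e \<cdot> v = h"
    assume "\<exists>y \<in> Hom \<A> E X. x = k \<cdot> y"
    then obtain y where y: "y \<in> Hom \<A> E X" "x = k \<cdot> y" by blast
    then obtain v where "v \<in> Hom \<A> E A" "e \<cdot> v = y" using * by blast
    then show "\<exists>v \<in> Hom \<A> E A. x = k \<cdot> e \<cdot> v" using y(2) by (intro bexI[of _ v]) auto
  next
    fix x assume "\<exists>v \<in> Hom \<A> E A. x = k \<cdot> e \<cdot> v"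
    then obtain v where "v \<in> Hom \<A> E A" "x = k \<cdot> e \<cdot> v" by blast
    then show "\<exists>y \<in> Hom \<A> E X. x = k \<cdot> y" by (intro bexI[of _ "e \<cdot> v"]) simp_all
  qed
  finally show ?thesis .
qed

lemma Hom_op_exact_at_splice:
  assumes "SES \<A> X k Y g Z" and "SES \<A> P n A e X" and "SES \<A> Z m V q U"
  shows "Hom_op_exact_at \<A> E (k \<cdot> e) (m \<cdot> g) \<longleftrightarrow> (\<forall>h \<in> Hom \<A> Z E. \<exists>v \<in> Hom \<A> V E. v \<cdot> m = h)"
  using abelian_category.Hom_exact_at_splice[OF abelian_category_op_cat, of Z g Y k X U q V m e A n P E] assms
  by (simp add: Hom_op_exact_at_op_cat del: Hom_iff)

end

text \<open>
  The short exact sequences into which a complex d as in the definition of \<open>Gorenstein\<close> decomposes: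
  \<open>d i = k i \<cdot> e (i - 1)\<close>, with image \<open>I i\<close>.
\<close>

definition Gorenstein_chain ::
  "('o, 'm) cat \<Rightarrow> 'o set \<Rightarrow> (int \<Rightarrow> 'o) \<Rightarrow> (int \<Rightarrow> 'm) \<Rightarrow> (int \<Rightarrow> 'o) \<Rightarrow> (int \<Rightarrow> 'm) \<Rightarrow> bool" where
  "Gorenstein_chain \<A> \<C> I k c e \<longleftrightarrow> (\<forall>i. SES \<A> (I i) (k i) (c i) (e i) (I (i + 1)) \<and> c i \<in> \<C> \<and>
      (\<forall>E \<in> \<C>. \<forall>h \<in> Hom \<A> E (I (i + 1)). \<exists>v \<in> Hom \<A> E (c i). e i \<cdot>\<^bsub>\<A>\<^esub> v = h) \<and>
      (\<forall>E \<in> \<C>. \<forall>h \<in> Hom \<A> (I i) E. \<exists>v \<in> Hom \<A> (c i) E. v \<cdot>\<^bsub>\<A>\<^esub> k i = h))"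

context abelian_category
begin

text \<open>An exact complex is cut at its images, and the pieces are spliced back to a complex.
  Under this translation the two Hom-exactness conditions become lifting along the epimorphisms and
  extension along the monomorphisms of the pieces, the form used from here on.\<close>

lemma Gorenstein_iff:
  "M \<in> Gorenstein \<A> \<C> \<longleftrightarrow>
    (\<exists>I k c e. isomorphic \<A> M (I 0) \<and> Gorenstein_chain \<A> \<C> I k c e)"
proof
  assume "M \<in> Gorenstein \<A> \<C>"
  then obtain d :: "int \<Rightarrow> 'b" where d: "\<And>i. Dom \<A> (d i) \<in> \<C>" "\<And>i. exact_at \<A> (d i) (d (i + 1))"
    and He: "\<And>E i. E \<in> \<C> \<Longrightarrow> Hom_exact_at \<A> E (d i) (d (i + 1))"
    and Ho: "\<And>E i. E \<in> \<C> \<Longrightarrow> Hom_op_exact_at \<A> E (d i) (d (i + 1))"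
    and "\<exists>k. is_image \<A> k (d 0) \<and> isomorphic \<A> M (Dom \<A> k)"
    unfolding Gorenstein_def by blast
  \<comment> \<open>Images are determined only up to isomorphism; in degree 0 the choice is pinned
    to the one isomorphic to \<open>M\<close>.\<close>
  then have "\<forall>i. \<exists>k. is_image \<A> k (d i) \<and> (i = 0 \<longrightarrow> isomorphic \<A> M (Dom \<A> k))"
    unfolding exact_at_def by metis
  then obtain k where k: "\<And>i. is_image \<A> (k i) (d i)" "isomorphic \<A> M (Dom \<A> (k 0))" by metis
  \<comment> \<open>The image of \<open>d i\<close> is a subobject of the domain of
    \<open>d (i + 1)\<close>, which accounts for the shift of the middle term.\<close>
  have "\<exists>e. SES \<A> (Dom \<A> (k i)) (k i) (Dom \<A> (d (i + 1))) e (Dom \<A> (k (i + 1))) \<and> k (i + 1) \<cdot> e = d (i + 1)" for i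
    by (rule exact_at_SES[OF d(2) k(1) k(1)]) blast
  then obtain e where e: "\<And>i. SES \<A> (Dom \<A> (k i)) (k i) (Dom \<A> (d (i + 1))) (e i) (Dom \<A> (k (i + 1)))"
    and ke: "\<And>i. k (i + 1) \<cdot> e i = d (i + 1)" by metis
  have lift: "\<forall>h \<in> Hom \<A> E (Dom \<A> (k (i + 1))). \<exists>v \<in> Hom \<A> E (Dom \<A> (d (i + 1))). e i \<cdot> v = h"
    if "E \<in> \<C>" for E i
    using Hom_exact_at_splice[OF e[of "i + 1"] e[of i] e[of "i + 1 + 1"], of E] He[OF that, of "i + 1"]
    unfolding ke by blast
  have ext: "\<forall>h \<in> Hom \<A> (Dom \<A> (k (i + 1 + 1))) E. \<exists>v \<in> Hom \<A> (Dom \<A> (d (i + 1 + 1 + 1))) E. v \<cdot> k (i + 1 + 1) = h"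
    if "E \<in> \<C>" for E i
    using Hom_op_exact_at_splice[OF e[of "i + 1"] e[of i] e[of "i + 1 + 1"], of E] Ho[OF that, of "i + 1"]
    unfolding ke by blast
  \<comment> \<open>Splicing at the sequence with index \<open>i + 1\<close> speaks of extension
    along the next monomorphism, that of index \<open>i + 2\<close>; hence the substitution of
    \<open>i - 2\<close>.\<close>
  have "\<forall>h \<in> Hom \<A> (Dom \<A> (k i)) E. \<exists>v \<in> Hom \<A> (Dom \<A> (d (i + 1))) E. v \<cdot> k i = h"
    if "E \<in> \<C>" for E i
    using ext[OF that, of "i - 2"] by (simp del: Hom_iff)
  then have "Gorenstein_chain \<A> \<C> (\<lambda>i. Dom \<A> (k i)) k (\<lambda>i. Dom \<A> (d (i + 1))) e"
    unfolding Gorenstein_chain_def using e d(1) lift by blast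
  with k(2) show "\<exists>I k c e. isomorphic \<A> M (I 0) \<and> Gorenstein_chain \<A> \<C> I k c e"
    by (intro exI[of _ "\<lambda>i. Dom \<A> (k i)"] exI[of _ "\<lambda>i. Dom \<A> (d (i + 1))"] exI conjI)
next
  assume "\<exists>I k c e. isomorphic \<A> M (I 0) \<and> Gorenstein_chain \<A> \<C> I k c e"
  then obtain I k c e where iso: "isomorphic \<A> M (I 0)" and s: "\<And>i :: int. SES \<A> (I i) (k i) (c i) (e i) (I (i + 1))"
    and c: "\<And>i. c i \<in> \<C>"
    and lift: "\<And>i E. E \<in> \<C> \<Longrightarrow> \<forall>h \<in> Hom \<A> E (I (i + 1)). \<exists>v \<in> Hom \<A> E (c i). e i \<cdot> v = h"
    and ext: "\<And>i E. E \<in> \<C> \<Longrightarrow> \<forall>h \<in> Hom \<A> (I i) E. \<exists>v \<in> Hom \<A> (c i) E. v \<cdot> k i = h"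
    unfolding Gorenstein_chain_def by blast
  define d where "d i = k i \<cdot> e (i - 1)" for i
  have d_Suc: "d (i + 1) = k (i + 1) \<cdot> e i" for i by (simp add: d_def)
  have s': "SES \<A> (I (i - 1)) (k (i - 1)) (c (i - 1)) (e (i - 1)) (I i)" for i using s[of "i - 1"] by simp
  note [simp] = SES_simps(1-6)[OF s] SES_simps(1-6)[OF s']
  have im: "is_image \<A> (k i) (d i)" for i
    unfolding is_image_def d_def using is_cokernel_comp_epi[OF s s'] s[of i] by (auto simp: SES_def)
  have "exact_at \<A> (d i) (d (i + 1))" for i
    unfolding exact_at_def d_Suc using im[of i] is_kernel_comp_mono[OF s s] by blast
  moreover have "Hom_exact_at \<A> E (d i) (d (i + 1))" if "E \<in> \<C>" for E i
    unfolding d_Suc d_def[of i] Hom_exact_at_splice[OF s s' s] using lift[OF that, of "i - 1"] by (simp del: Hom_iff)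
  moreover have "Hom_op_exact_at \<A> E (d i) (d (i + 1))" if "E \<in> \<C>" for E i
    unfolding d_Suc d_def[of i] Hom_op_exact_at_splice[OF s s' s] using ext[OF that] by blast
  moreover have "Dom \<A> (d i) \<in> \<C>" for i using c by (simp add: d_def)
  moreover have "isomorphic \<A> M (Dom \<A> (k 0))" "M \<in> Ob \<A>" using iso by (simp_all add: isomorphic_def)
  ultimately show "M \<in> Gorenstein \<A> \<C>"
    unfolding Gorenstein_def using im[of 0] by blast
qed

end

section \<open>Gorenstein subcategories\<close>

text \<open>Two dependent choices start at \<open>a\<close>, one following \<open>R\<close> forwards
  and the other backwards, and are glued at 0.\<close>

lemma int_chain:
  assumes succ: "\<And>x. x \<in> S \<Longrightarrow> \<exists>y \<in> S. R x y" and pred: "\<And>y. y \<in> S \<Longrightarrow> \<exists>x \<in> S. R x y"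
    and a: "a \<in> S"
  obtains I :: "int \<Rightarrow> 'a" where "I 0 = a" "\<And>i. I i \<in> S" "\<And>i. R (I i) (I (i + 1))"
proof -
  obtain f :: "nat \<Rightarrow> 'a" where f: "f 0 = a" "\<And>n. f n \<in> S" "\<And>n. R (f n) (f (Suc n))"
    \<comment> \<open>The condition at \<open>n = 0\<close> pins the start of the sequence to
      \<open>a\<close>.\<close>
    using dependent_nat_choice[of "\<lambda>n x. x \<in> S \<and> (n = 0 \<longrightarrow> x = a)" "\<lambda>n. R"] succ a
    by (metis nat.distinct(1))
  obtain g :: "nat \<Rightarrow> 'a" where g: "g 0 = a" "\<And>n. g n \<in> S" "\<And>n. R (g (Suc n)) (g n)"
    using dependent_nat_choice[of "\<lambda>n x. x \<in> S \<and> (n = 0 \<longrightarrow> x = a)" "\<lambda>n x y. R y x"] pred a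
    by (metis nat.distinct(1))
  let ?I = "\<lambda>i. if i \<ge> 0 then f (nat i) else g (nat (- i))"
  have "R (?I i) (?I (i + 1))" for i :: int
  proof (cases "i \<ge> 0")
    case True
    then show ?thesis using f(3)[of "nat i"] by (simp add: nat_add_distrib)
  next
    case False
    then have "nat (- i) = Suc (nat (- (i + 1)))" by simp
    \<comment> \<open>For \<open>i = -1\<close> the right neighbour is \<open>f 0\<close>, which
      agrees with \<open>g 0\<close>.\<close>
    then show ?thesis using False f(1) g(1) g(3)[of "nat (- (i + 1))"] by (auto simp: not_le)
  qed
  then show ?thesis using f g by (intro that[of ?I]) simp_all
qed

context abelian_category
begin

lemma horseshoe_dual:
  assumes s: "SES \<A> A i M \<pi> B" and sp: "SES \<A> A k C p K" and sq: "SES \<A> B \<kappa> D q L"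
    and l: "l \<in> Hom \<A> M C" "l \<cdot> i = k"
    and b: "is_biproduct \<A> C D S i\<^sub>1 i\<^sub>2 p\<^sub>1 p\<^sub>2"
  obtains f N n t r where "SES \<A> M f S n N" "SES \<A> K t N r L"
proof -
  have b': "is_biproduct (op_cat \<A>) D C S p\<^sub>2 p\<^sub>1 i\<^sub>2 i\<^sub>1"
    using is_biproduct_commute[OF b] by simp
  show thesis
    by (rule abelian_category.horseshoe[OF abelian_category_op_cat _ _ _ _ _ b', of B \<pi> M i A L q \<kappa> K p k l])
      (use s sp sq l that in auto)
qed

end

section \<open>The Gorenstein subcategory of a self-orthogonal subcategory\<close>

locale self_orthogonal_subcategory = abelian_category +
  fixes \<C> :: "'a set"
  assumes subcategory_C: "subcategory \<A> \<C>"
    and ext_C: "\<lbrakk>X \<in> \<C>; Y \<in> \<C>\<rbrakk> \<Longrightarrow> ext1_zero \<A> X Y"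
begin

abbreviation \<G> :: "'a set" where "\<G> \<equiv> Gorenstein \<A> \<C>"

abbreviation \<R> :: "'a set" where "\<R> \<equiv> right_perp1 \<A> \<G>"

lemma C_Ob: "X \<in> \<C> \<Longrightarrow> X \<in> Ob \<A>"
  using subcategory_C unfolding subcategory_def by blast

lemma C_biproduct: "\<lbrakk>X \<in> \<C>; Y \<in> \<C>; is_biproduct \<A> X Y S i\<^sub>1 i\<^sub>2 p\<^sub>1 p\<^sub>2\<rbrakk> \<Longrightarrow> S \<in> \<C>"
  using subcategory_C unfolding subcategory_def by blast

lemma C_zero: obtains Z where "is_zero_object \<A> Z" "Z \<in> \<C>"
  using subcategory_C unfolding subcategory_def by blast

lemma Gorenstein_Ob: "M \<in> \<G> \<Longrightarrow> M \<in> Ob \<A>"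
  by (simp add: Gorenstein_def)

lemma Gorenstein_chain_shift:
  "Gorenstein_chain \<A> \<C> I k c e \<Longrightarrow>
    Gorenstein_chain \<A> \<C> (\<lambda>i. I (i + j)) (\<lambda>i. k (i + j)) (\<lambda>i. c (i + j)) (\<lambda>i. e (i + j))"
  unfolding Gorenstein_chain_def by (simp add: add.assoc add.commute[of 1 j] del: Hom_iff)
    (simp add: add.assoc[symmetric] del: Hom_iff)

lemma isomorphic_refl: "X \<in> Ob \<A> \<Longrightarrow> isomorphic \<A> X X"
  unfolding isomorphic_def by (auto intro!: bexI[of _ "Ident \<A> X"])

text \<open>Shifting the indices by \<open>j\<close> moves the image in degree \<open>j\<close> to
  degree 0. This puts syzygies and cosyzygies back into \<open>\<G>\<close>.\<close>

lemma Gorenstein_chain_Gorenstein: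
  assumes ch: "Gorenstein_chain \<A> \<C> I k c e"
  shows "I j \<in> \<G>"
proof -
  have "SES \<A> (I j) (k j) (c j) (e j) (I (j + 1))" using ch unfolding Gorenstein_chain_def by blast
  then have "isomorphic \<A> (I j) (I (0 + j))" using isomorphic_refl SES_simps(8) by simp
  with Gorenstein_chain_shift[OF ch, of j] show ?thesis
    unfolding Gorenstein_iff by (intro exI[of _ "\<lambda>i. I (i + j)"] exI conjI)
qed

text \<open>Write \<open>M\<close> as a quotient of a term of \<open>\<C>\<close>.
  Self-orthogonality handles Ext^1 of that term, and Hom-exactness extends morphisms from the
  syzygy, so \<open>ext1_zero_quotient\<close> applies; the second vanishing is dual. The
  isomorphism with \<open>I 0\<close> is absorbed into the sequences. The four facts match the
  closure conditions of \<open>Gorenstein_coinduct\<close>.\<close>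

lemma Gorenstein_steps:
  assumes "M \<in> \<G>"
  shows Gorenstein_coresolution: "\<exists>k C e N. SES \<A> M k C e N \<and> C \<in> \<C> \<and> N \<in> \<G>"
    and Gorenstein_resolution: "\<exists>N k C e. SES \<A> N k C e M \<and> C \<in> \<C> \<and> N \<in> \<G>"
    and ext_Gorenstein_C: "E \<in> \<C> \<Longrightarrow> ext1_zero \<A> M E"
    and ext_C_Gorenstein: "E \<in> \<C> \<Longrightarrow> ext1_zero \<A> E M"
proof -
  obtain I k c e where "isomorphic \<A> M (I 0)" and ch: "Gorenstein_chain \<A> \<C> I k c e"
    using assms unfolding Gorenstein_iff by blast
  then obtain \<phi> \<psi> where iso: "\<phi> \<in> Hom \<A> M (I 0)" "\<psi> \<in> Hom \<A> (I 0) M"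
    "\<psi> \<cdot> \<phi> = Ident \<A> M" "\<phi> \<cdot> \<psi> = Ident \<A> (I 0)"
    unfolding isomorphic_def by blast
  have s: "SES \<A> (I i) (k i) (c i) (e i) (I (i + 1))" and c: "c i \<in> \<C>"
    and lift: "\<And>h. \<lbrakk>E \<in> \<C>; h \<in> Hom \<A> E (I (i + 1))\<rbrakk> \<Longrightarrow> \<exists>v \<in> Hom \<A> E (c i). e i \<cdot> v = h"
    and ext: "\<And>h. \<lbrakk>E \<in> \<C>; h \<in> Hom \<A> (I i) E\<rbrakk> \<Longrightarrow> \<exists>v \<in> Hom \<A> (c i) E. v \<cdot> k i = h" for i E
    using ch unfolding Gorenstein_chain_def by blast+
  have r: "SES \<A> M (k 0 \<cdot> \<phi>) (c 0) (e 0) (I (0 + 1))"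
    by (rule SES_iso_left[OF s iso])
  have "SES \<A> (I (- 1)) (k (- 1)) (c (- 1)) (e (- 1)) (I 0)"
    using s[of "- 1"] by simp
  then have l: "SES \<A> (I (- 1)) (k (- 1)) (c (- 1)) (\<psi> \<cdot> e (- 1)) M"
    by (rule SES_iso_right[OF _ iso(2,1,4,3)])
  show "\<exists>k C e N. SES \<A> M k C e N \<and> C \<in> \<C> \<and> N \<in> \<G>"
    using r c Gorenstein_chain_Gorenstein[OF ch] by blast
  show "\<exists>N k C e. SES \<A> N k C e M \<and> C \<in> \<C> \<and> N \<in> \<G>"
    using l c Gorenstein_chain_Gorenstein[OF ch] by blast
  show "ext1_zero \<A> M E" if "E \<in> \<C>"
    by (rule ext1_zero_quotient[OF l ext_C[OF c that] ext[OF that]])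
  show "ext1_zero \<A> E M" if "E \<in> \<C>"
    by (rule ext1_zero_subobject[OF r ext_C[OF that c] lift[OF that]])
qed

text \<open>The steps are chosen one degree at a time and spliced. Both kinds of Hom-exactness then
  follow from the vanishing of Ext^1 at each image, so no compatibility between choices in different
  degrees is required.\<close>

lemma Gorenstein_coinduct:
  assumes "M \<in> S"
    and extl: "\<And>M E. \<lbrakk>M \<in> S; E \<in> \<C>\<rbrakk> \<Longrightarrow> ext1_zero \<A> M E"
    and extr: "\<And>M E. \<lbrakk>M \<in> S; E \<in> \<C>\<rbrakk> \<Longrightarrow> ext1_zero \<A> E M"
    and cores: "\<And>M. M \<in> S \<Longrightarrow> \<exists>k C e N. SES \<A> M k C e N \<and> C \<in> \<C> \<and> N \<in> S"
    and res: "\<And>M. M \<in> S \<Longrightarrow> \<exists>N k C e. SES \<A> N k C e M \<and> C \<in> \<C> \<and> N \<in> S"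
  shows "M \<in> \<G>"
proof -
  let ?R = "\<lambda>x y. \<exists>k C e. SES \<A> x k C e y \<and> C \<in> \<C>"
  obtain I :: "int \<Rightarrow> 'a" where I: "I 0 = M" "\<And>i. I i \<in> S" "\<And>i. ?R (I i) (I (i + 1))"
  proof (rule int_chain[of S ?R M])
    show "\<exists>y \<in> S. ?R x y" if "x \<in> S" for x using cores[OF that] by blast
    show "\<exists>x \<in> S. ?R x y" if "y \<in> S" for y using res[OF that] by blast
  qed (rule assms(1), rule that)
  then obtain k c e where s: "\<And>i. SES \<A> (I i) (k i) (c i) (e i) (I (i + 1))" and c: "\<And>i. c i \<in> \<C>"
    by metis
  have "\<exists>v \<in> Hom \<A> E (c i). e i \<cdot> v = h" if "E \<in> \<C>" "h \<in> Hom \<A> E (I (i + 1))" for E h i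
    by (rule ext1_zero_lift[OF extr[OF I(2) that(1)] s that(2)]) blast
  moreover have "\<exists>v \<in> Hom \<A> (c i) E. v \<cdot> k i = h" if "E \<in> \<C>" "h \<in> Hom \<A> (I i) E" for E h i
    by (rule ext1_zero_extend[OF extl[OF I(2) that(1)] s that(2)]) blast
  ultimately have "Gorenstein_chain \<A> \<C> I k c e"
    unfolding Gorenstein_chain_def using s c by blast
  then show ?thesis using Gorenstein_chain_Gorenstein[of I k c e 0] I(1) by simp
qed

text \<open>Identity morphisms and the zero object of \<open>\<C>\<close> provide the steps,
  self-orthogonality the vanishing.\<close>

lemma C_subset_Gorenstein: "\<C> \<subseteq> \<G>"
proof
  fix M assume "M \<in> \<C>"
  obtain Z where Z: "is_zero_object \<A> Z" "Z \<in> \<C>" by (rule C_zero)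
  show "M \<in> \<G>"
  proof (rule Gorenstein_coinduct[of M \<C>])
    show "\<exists>k C e N. SES \<A> M k C e N \<and> C \<in> \<C> \<and> N \<in> \<C>" if "M \<in> \<C>" for M
      using SES_Ident[OF Z(1) C_Ob[OF that]] that Z(2) by blast
    show "\<exists>N k C e. SES \<A> N k C e M \<and> C \<in> \<C> \<and> N \<in> \<C>" if "M \<in> \<C>" for M
      using SES_Ident'[OF Z(1) C_Ob[OF that]] that Z(2) by blast
  qed (use ext_C \<open>M \<in> \<C>\<close> in simp_all)
qed

lemma Gorenstein_extension:
  assumes "SES \<A> A i M \<pi> B" "A \<in> \<G>" "B \<in> \<G>"
  shows "M \<in> \<G>"
proof -
  \<comment> \<open>The invariant is the class of all extensions of objects of \<open>\<G>\<close>,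
    because the horseshoe step leaves a syzygy or cosyzygy known only to be such an
    extension.\<close>
  let ?S = "{M. \<exists>A i \<pi> B. SES \<A> A i M \<pi> B \<and> A \<in> \<G> \<and> B \<in> \<G>}"
  show ?thesis
  proof (rule Gorenstein_coinduct[of M ?S])
    show "M \<in> ?S" using assms by blast
  next
    fix M E assume "M \<in> ?S" and E: "E \<in> \<C>"
    then obtain A i \<pi> B where s: "SES \<A> A i M \<pi> B" and G: "A \<in> \<G>" "B \<in> \<G>" by blast
    show "ext1_zero \<A> M E"
      by (rule ext1_zero_extension_left[OF ext_Gorenstein_C[OF G(1) E] ext_Gorenstein_C[OF G(2) E] s])
    show "ext1_zero \<A> E M"
      by (rule ext1_zero_extension_right[OF ext_C_Gorenstein[OF G(1) E] ext_C_Gorenstein[OF G(2) E] s])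
  next
    fix M assume "M \<in> ?S"
    then obtain A i \<pi> B where s: "SES \<A> A i M \<pi> B" and G: "A \<in> \<G>" "B \<in> \<G>" by blast
    note [simp] = SES_simps[OF s]
    show "\<exists>k C e N. SES \<A> M k C e N \<and> C \<in> \<C> \<and> N \<in> ?S"
    proof -
      obtain k C p K where A: "SES \<A> A k C p K" "C \<in> \<C>" "K \<in> \<G>" using Gorenstein_coresolution[OF G(1)] by blast
      obtain \<kappa> D q L where B: "SES \<A> B \<kappa> D q L" "D \<in> \<C>" "L \<in> \<G>" using Gorenstein_coresolution[OF G(2)] by blast
      \<comment> \<open>Vanishing of Ext^1(B, C) extends \<open>k\<close> from \<open>A\<close> to
        \<open>M\<close>, the input that the dual horseshoe lemma needs.\<close>
      obtain l where l: "l \<in> Hom \<A> M C" "l \<cdot> i = k"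
        by (rule ext1_zero_extend[OF ext_Gorenstein_C[OF G(2) A(2)] s, of k]) (use SES_simps[OF A(1)] in simp_all)
      obtain S i\<^sub>1 i\<^sub>2 p\<^sub>1 p\<^sub>2 where b: "is_biproduct \<A> C D S i\<^sub>1 i\<^sub>2 p\<^sub>1 p\<^sub>2"
        by (rule biproduct_E[OF C_Ob[OF A(2)] C_Ob[OF B(2)]])
      obtain f N n t r where "SES \<A> M f S n N" "SES \<A> K t N r L"
        by (rule horseshoe_dual[OF s A(1) B(1) l b])
      then show ?thesis using C_biproduct[OF A(2) B(2) b] A(3) B(3) by blast
    qed
    show "\<exists>N k C e. SES \<A> N k C e M \<and> C \<in> \<C> \<and> N \<in> ?S"
    proof -
      obtain K k C p where A: "SES \<A> K k C p A" "C \<in> \<C>" "K \<in> \<G>" using Gorenstein_resolution[OF G(1)] by blast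
      obtain L \<kappa> D q where B: "SES \<A> L \<kappa> D q B" "D \<in> \<C>" "L \<in> \<G>" using Gorenstein_resolution[OF G(2)] by blast
      obtain l where l: "l \<in> Hom \<A> D M" "\<pi> \<cdot> l = q"
        by (rule ext1_zero_lift[OF ext_C_Gorenstein[OF G(1) B(2)] s, of q]) (use SES_simps[OF B(1)] in simp_all)
      obtain S i\<^sub>1 i\<^sub>2 p\<^sub>1 p\<^sub>2 where b: "is_biproduct \<A> C D S i\<^sub>1 i\<^sub>2 p\<^sub>1 p\<^sub>2"
        by (rule biproduct_E[OF C_Ob[OF A(2)] C_Ob[OF B(2)]])
      obtain N n r t where "SES \<A> N n S (Add \<A> (i \<cdot> (p \<cdot> p\<^sub>1)) (l \<cdot> p\<^sub>2)) M" "SES \<A> K t N r L"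
        by (rule horseshoe[OF s A(1) B(1) l b])
      then show ?thesis using C_biproduct[OF A(2) B(2) b] A(3) B(3) by blast
    qed
  qed
qed

section \<open>Special precovers by the Gorenstein subcategory\<close>

lemma right_perp1_iff: "M \<in> \<R> \<longleftrightarrow> M \<in> Ob \<A> \<and> (\<forall>G \<in> \<G>. ext1_zero \<A> G M)"
  unfolding right_perp1_def using Ext_zero_1_iff Gorenstein_Ob by blast

lemma C_subset_right_perp1: "\<C> \<subseteq> \<R>"
  using ext_Gorenstein_C C_Ob by (auto simp: right_perp1_iff)

lemma right_perp1_extension:
  assumes "SES \<A> A a B b C" "A \<in> \<R>" "C \<in> \<R>"
  shows "B \<in> \<R>"
  using assms ext1_zero_extension_right[OF _ _ assms(1)] SES_simps(9)[OF assms(1)]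
  unfolding right_perp1_iff by blast

text \<open>A kernel in \<open>\<R>\<close> makes morphisms from objects of \<open>\<G>\<close>
  lift, so the precover condition follows. The closure proofs then only have to produce a short
  exact sequence.\<close>

lemma SPC_iff: "T \<in> SPC \<A> \<G> \<longleftrightarrow> (\<exists>K k G f. SES \<A> K k G f T \<and> K \<in> \<R> \<and> G \<in> \<G>)"
proof
  assume "T \<in> SPC \<A> \<G>"
  then obtain f k where f: "precover \<A> \<G> f T" "epic \<A> f" "is_kernel \<A> k f" "Dom \<A> k \<in> \<R>"
    unfolding SPC_def special_precover_def by blast
  then have "SES \<A> (Dom \<A> k) k (Dom \<A> f) f T" "Dom \<A> f \<in> \<G>"
    using SES_kernel_epic[OF f(3,2)] unfolding precover_def by simp_all
  then show "\<exists>K k G f. SES \<A> K k G f T \<and> K \<in> \<R> \<and> G \<in> \<G>" using f(4) by blast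
next
  assume "\<exists>K k G f. SES \<A> K k G f T \<and> K \<in> \<R> \<and> G \<in> \<G>"
  then obtain K k G f where s: "SES \<A> K k G f T" and K: "K \<in> \<R>" and G: "G \<in> \<G>" by blast
  note [simp] = SES_simps[OF s]
  have "\<exists>l \<in> Hom \<A> X G. f \<cdot> l = h" if "X \<in> \<G>" "h \<in> Hom \<A> X T" for X h
  proof -
    have "ext1_zero \<A> X K" using K that(1) by (simp add: right_perp1_iff)
    then show ?thesis by (rule ext1_zero_lift[OF _ s that(2)]) blast
  qed
  then have "Hom \<A> X T \<subseteq> (\<lambda>h. f \<cdot> h) ` Hom \<A> X G" if "X \<in> \<G>" for X
    using that by (auto simp only: image_iff)
  moreover have "(\<lambda>h. f \<cdot> h) ` Hom \<A> X G \<subseteq> Hom \<A> X T" for X by auto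
  ultimately have "(\<lambda>h. f \<cdot> h) ` Hom \<A> X (Dom \<A> f) = Hom \<A> X T" if "X \<in> \<G>" for X
    using that by (simp add: subset_antisym del: Hom_iff)
  then have "precover \<A> \<G> f T" unfolding precover_def using G by simp
  moreover have "is_kernel \<A> k f" using s by (simp add: SES_def)
  ultimately have "special_precover \<A> \<G> f T"
    unfolding special_precover_def using SES_epic[OF s] K by auto
  then show "T \<in> SPC \<A> \<G>" unfolding SPC_def by auto
qed

lemma SPC_lift:
  assumes "SES \<A> K k G f T" "K \<in> \<R>" "X \<in> \<G>" "h \<in> Hom \<A> X T"
  obtains l where "l \<in> Hom \<A> X G" "f \<cdot> l = h"
proof -
  have "ext1_zero \<A> X K" using assms by (simp add: right_perp1_iff)
  then show ?thesis by (rule ext1_zero_lift[OF _ assms(1,4)]) (rule that)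
qed

section \<open>Closure properties of the objects with a special precover\<close>

text \<open>Compose a special precover of \<open>Y\<close> with \<open>f\<close>: the new kernel is
  an extension of \<open>K\<close> by the old one, and \<open>\<R>\<close> is closed under
  extensions.\<close>

lemma SPC_quotient:
  assumes s: "SES \<A> K k Y f Z" and "K \<in> \<R>" "Y \<in> SPC \<A> \<G>"
  shows "Z \<in> SPC \<A> \<G>"
proof -
  obtain L l G h where h: "SES \<A> L l G h Y" "L \<in> \<R>" "G \<in> \<G>" using assms(3) unfolding SPC_iff by blast
  obtain N n r l' where N: "SES \<A> N n G (f \<cdot> h) Z" "SES \<A> L l' N r K"
    by (rule SES_comp[OF s h(1)])
  then show ?thesis
    using right_perp1_extension[OF N(2) h(2) assms(2)] h(3) unfolding SPC_iff by blast
qed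

text \<open>Pull the sequence back along a special precover \<open>H\<close> of \<open>S\<close>.
  The pullback is an extension of \<open>H\<close> by \<open>G\<close>, hence in
  \<open>\<G>\<close>, and its projection to \<open>T\<close> inherits the kernel in
  \<open>\<R>\<close>.\<close>

lemma SPC_extension_by_Gorenstein:
  assumes s: "SES \<A> G i T p S" and "G \<in> \<G>" "S \<in> SPC \<A> \<G>"
  shows "T \<in> SPC \<A> \<G>"
proof -
  obtain K k H f where f: "SES \<A> K k H f S" "K \<in> \<R>" "H \<in> \<G>" using assms(3) unfolding SPC_iff by blast
  have "f \<in> Hom \<A> H S" using SES_simps[OF f(1)] by simp
  then obtain P j p' q where P: "SES \<A> G j P p' H" "\<exists>j'. SES \<A> K j' P q T"
    by (rule SES_pullback[OF s]) (use f(1) in blast)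
  then have "P \<in> \<G>" using Gorenstein_extension[OF P(1) assms(2) f(3)] by blast
  then show ?thesis using P(2) f(2) unfolding SPC_iff by blast
qed

lemma C_subset_SPC: "\<C> \<subseteq> SPC \<A> \<G>"
proof
  fix X assume X: "X \<in> \<C>"
  obtain Z where "is_zero_object \<A> Z" "Z \<in> \<C>" by (rule C_zero)
  then show "X \<in> SPC \<A> \<G>"
    unfolding SPC_iff using SES_Ident'[OF _ C_Ob[OF X]] X C_subset_Gorenstein C_subset_right_perp1 by blast
qed

lemma SPC_Ob: "SPC \<A> \<G> \<subseteq> Ob \<A>"
  by (auto simp: SPC_def)

text \<open>An isomorphism is an epimorphism whose kernel is a zero object, and
  \<open>\<C> \<subseteq> \<R>\<close> contains one; so this is a case of
  \<open>SPC_quotient\<close>.\<close>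

lemma SPC_isomorphic:
  assumes "X \<in> SPC \<A> \<G>" "isomorphic \<A> X Y"
  shows "Y \<in> SPC \<A> \<G>"
proof -
  obtain Z where Z: "is_zero_object \<A> Z" "Z \<in> \<C>" by (rule C_zero)
  obtain \<phi> \<psi> where "\<phi> \<in> Hom \<A> X Y" "\<psi> \<in> Hom \<A> Y X" "\<psi> \<cdot> \<phi> = Ident \<A> X" "\<phi> \<cdot> \<psi> = Ident \<A> Y"
    and X: "X \<in> Ob \<A>"
    using assms(2) unfolding isomorphic_def by blast
  from SES_iso_right[OF SES_Ident'[OF Z(1) X] this(1-4)] show ?thesis
    using SPC_quotient[OF _ _ assms(1)] Z(2) C_subset_right_perp1 by blast
qed

text \<open>Properness enters through a single lift, that of the composite from \<open>C\<close>
  through \<open>G\<close> to \<open>Z\<close>. It encodes the pulled-back extension in a morphism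
  out of \<open>G'\<close>, and \<open>G' \<in> \<G>\<close> is what allows this morphism to be
  lifted along \<open>p\<close>.\<close>

lemma SPC_extension:
  assumes s: "SES \<A> X f Y g Z" and XZ: "X \<in> SPC \<A> \<G>" "Z \<in> SPC \<A> \<G>"
    and lift: "\<And>E h. \<lbrakk>E \<in> \<C>; h \<in> Hom \<A> E Z\<rbrakk> \<Longrightarrow> \<exists>l \<in> Hom \<A> E Y. g \<cdot> l = h"
  shows "Y \<in> SPC \<A> \<G>"
proof -
  obtain K k G h where Z: "SES \<A> K k G h Z" "K \<in> \<R>" "G \<in> \<G>" using XZ(2) unfolding SPC_iff by blast
  obtain L l H p where X: "SES \<A> L l H p X" "L \<in> \<R>" "H \<in> \<G>" using XZ(1) unfolding SPC_iff by blast
  obtain G' \<kappa> C e where G: "SES \<A> G' \<kappa> C e G" "C \<in> \<C>" "G' \<in> \<G>" using Gorenstein_resolution[OF Z(3)] by blast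
  note [simp] = SES_simps[OF s] SES_simps[OF Z(1)] SES_simps[OF X(1)] SES_simps[OF G(1)]
  have "h \<in> Hom \<A> G Z" by simp
  then obtain B j \<pi> q where B: "SES \<A> X j B \<pi> G" "q \<in> Hom \<A> B Y" "\<exists>j'. SES \<A> K j' B q Y"
    and univ: "\<And>W x y. \<lbrakk>x \<in> Hom \<A> W Y; y \<in> Hom \<A> W G; g \<cdot> x = h \<cdot> y\<rbrakk>
      \<Longrightarrow> \<exists>w \<in> Hom \<A> W B. q \<cdot> w = x \<and> \<pi> \<cdot> w = y"
    by (rule SES_pullback[OF s]) (use Z(1) in blast)
  note [simp] = SES_simps[OF B(1)]
  have "h \<cdot> e \<in> Hom \<A> C Z" "e \<in> Hom \<A> C G" by simp_all
  \<comment> \<open>Properness lifts \<open>h \<cdot> e\<close> to \<open>Y\<close>; together with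
    \<open>e\<close> this lift defines \<open>t\<close> into the pullback \<open>B\<close>.\<close>
  then obtain t where t: "t \<in> Hom \<A> C B" "\<pi> \<cdot> t = e" using lift[OF G(2)] univ by blast
  note t' = t(1)[unfolded Hom_iff]
  note [simp] = t' t(2) Comp_reassoc[OF t(2)]
  \<comment> \<open>The restriction of \<open>t\<close> to \<open>G'\<close> lands in
    \<open>X\<close>; \<open>u\<close> is the morphism along which \<open>B\<close> is a pushout of
    \<open>\<kappa>\<close>.\<close>
  obtain u where u: "u \<in> Arr \<A>" "Dom \<A> u = G'" "Cod \<A> u = X" "j \<cdot> u = t \<cdot> \<kappa>"
    by (rule SES_lift[OF B(1), of "t \<cdot> \<kappa>"]) simp_all
  then have "u \<in> Hom \<A> G' X" by simp
  then obtain v where v: "v \<in> Hom \<A> G' H" "p \<cdot> v = u" by (rule SPC_lift[OF X(1,2) G(3)])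
  obtain P i \<rho> r where P: "SES \<A> H i P \<rho> G" "r \<in> Hom \<A> C P" "r \<cdot> \<kappa> = i \<cdot> v" "\<rho> \<cdot> r = e"
    and univ': "\<And>W x y. \<lbrakk>x \<in> Hom \<A> C W; y \<in> Hom \<A> H W; x \<cdot> \<kappa> = y \<cdot> v\<rbrakk>
      \<Longrightarrow> \<exists>w \<in> Hom \<A> P W. w \<cdot> r = x \<and> w \<cdot> i = y"
    and eqI: "\<And>W u v. \<lbrakk>u \<in> Hom \<A> P W; v \<in> Hom \<A> P W; u \<cdot> r = v \<cdot> r; u \<cdot> i = v \<cdot> i\<rbrakk> \<Longrightarrow> u = v"
    using v(1) by (rule SES_pushout[OF G(1)]) blast
  note [simp] = SES_simps[OF P(1)]
  have jp: "j \<cdot> p \<in> Hom \<A> H B" by simp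
  have "t \<cdot> \<kappa> = (j \<cdot> p) \<cdot> v" using u(4) v by simp
  \<comment> \<open>\<open>w\<close> glues \<open>t\<close> on \<open>C\<close> with
    \<open>j \<cdot> p\<close> on \<open>H\<close>; they are compatible on \<open>G'\<close> because
    \<open>v\<close> lifts \<open>u\<close>.\<close>
  then obtain w where w: "w \<in> Hom \<A> P B" "w \<cdot> r = t" "w \<cdot> i = j \<cdot> p"
    using univ'[OF t(1) jp] by blast
  \<comment> \<open>Both sides give \<open>e\<close> on \<open>C\<close> and zero on
    \<open>H\<close>, and these two test morphisms determine a morphism out of the pushout.\<close>
  have "\<pi> \<cdot> w = \<rho>"
    by (rule eqI) (use w P(2,4) in simp_all)
  then have "SES \<A> L (i \<cdot> l) P w B"
    by (rule SES_map_right[OF P(1) B(1) X(1) w(1,3)])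
  moreover have "P \<in> \<G>" by (rule Gorenstein_extension[OF P(1) X(3) Z(3)])
  ultimately have "B \<in> SPC \<A> \<G>" using X(2) unfolding SPC_iff by blast
  then show ?thesis using B(3) SPC_quotient Z(2) by blast
qed

lemma SPC_proper_resolution:
  assumes gen: "\<And>K. K \<in> \<R> \<Longrightarrow> \<exists>L l C p. SES \<A> L l C p K \<and> L \<in> \<R> \<and> C \<in> \<C>"
    and T: "T \<in> SPC \<A> \<G>"
  shows "\<exists>N n C g. SES \<A> N n C g T \<and> N \<in> SPC \<A> \<G> \<and> C \<in> \<C> \<and>
    (\<forall>E \<in> \<C>. \<forall>h \<in> Hom \<A> E T. \<exists>l \<in> Hom \<A> E C. g \<cdot> l = h)"
proof -
  obtain K k G f where f: "SES \<A> K k G f T" "K \<in> \<R>" "G \<in> \<G>" using T unfolding SPC_iff by blast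
  obtain G' \<kappa> C e where e: "SES \<A> G' \<kappa> C e G" "C \<in> \<C>" "G' \<in> \<G>" using Gorenstein_resolution[OF f(3)] by blast
  note [simp] = SES_simps[OF f(1)] SES_simps[OF e(1)]
  obtain N n r l where N: "SES \<A> N n C (f \<cdot> e) T" "SES \<A> G' l N r K"
    by (rule SES_comp[OF f(1) e(1)])
  \<comment> \<open>The sequence supplied by \<open>gen\<close> is already a special precover, as
    \<open>\<C> \<subseteq> \<G>\<close>.\<close>
  have "K \<in> SPC \<A> \<G>" unfolding SPC_iff using gen[OF f(2)] C_subset_Gorenstein by blast
  then have "N \<in> SPC \<A> \<G>" by (rule SPC_extension_by_Gorenstein[OF N(2) e(3)])
  moreover have "\<exists>l \<in> Hom \<A> E C. (f \<cdot> e) \<cdot> l = h" if E: "E \<in> \<C>" and h: "h \<in> Hom \<A> E T" for E h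
  proof -
    \<comment> \<open>The lift is made in two stages: along the special precover, since
      \<open>E \<in> \<G>\<close>, and then along \<open>e\<close>, since Ext^1(E, G')
      vanishes.\<close>
    have "E \<in> \<G>" using E C_subset_Gorenstein by blast
    then obtain y where y: "y \<in> Hom \<A> E G" "f \<cdot> y = h" using h by (rule SPC_lift[OF f(1,2)])
    obtain l where "l \<in> Hom \<A> E C" "e \<cdot> l = y"
      by (rule ext1_zero_lift[OF ext_C_Gorenstein[OF e(3) E] e(1) y(1)])
    then show ?thesis using y(2) by (intro bexI[of _ l]) simp_all
  qed
  ultimately show ?thesis using N(1) e(2) by blast
qed

lemma SPC_kernel:
  assumes gen: "\<And>K. K \<in> \<R> \<Longrightarrow> \<exists>L l C p. SES \<A> L l C p K \<and> L \<in> \<R> \<and> C \<in> \<C>"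
    and s: "SES \<A> X f Y g Z" and YZ: "Y \<in> SPC \<A> \<G>" "Z \<in> SPC \<A> \<G>"
    and lift: "\<And>E h. \<lbrakk>E \<in> \<C>; h \<in> Hom \<A> E Z\<rbrakk> \<Longrightarrow> \<exists>l \<in> Hom \<A> E Y. g \<cdot> l = h"
  shows "X \<in> SPC \<A> \<G>"
proof -
  obtain N n C q where N: "SES \<A> N n C q Z" "N \<in> SPC \<A> \<G>" "C \<in> \<C>"
    and lift': "\<And>E h. \<lbrakk>E \<in> \<C>; h \<in> Hom \<A> E Z\<rbrakk> \<Longrightarrow> \<exists>l \<in> Hom \<A> E C. q \<cdot> l = h"
    using SPC_proper_resolution[OF gen YZ(2)] by blast
  note [simp] = SES_simps[OF s] SES_simps[OF N(1)]
  have "q \<in> Hom \<A> C Z" by simp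
  \<comment> \<open>The term \<open>C\<close> is itself a test object, so properness of the given
    sequence applies to \<open>q\<close>.\<close>
  then obtain t where t: "t \<in> Hom \<A> C Y" "g \<cdot> t = q" using lift[OF N(3)] by blast
  note [simp] = t(1)[unfolded Hom_iff] t(2) Comp_reassoc[OF t(2)]
  obtain S i\<^sub>1 i\<^sub>2 p\<^sub>1 p\<^sub>2 where b: "is_biproduct \<A> X C S i\<^sub>1 i\<^sub>2 p\<^sub>1 p\<^sub>2"
    by (rule biproduct_E[of X C]) simp_all
  note [simp] = biproduct_simps[OF b]
  obtain m where m: "SES \<A> N m S (Add \<A> (f \<cdot> p\<^sub>1) (t \<cdot> p\<^sub>2)) Y"
    by (rule SES_lift_sum[OF s N(1) t b])
  have "\<exists>l \<in> Hom \<A> E S. Add \<A> (f \<cdot> p\<^sub>1) (t \<cdot> p\<^sub>2) \<cdot> l = h" if E: "E \<in> \<C>" and h: "h \<in> Hom \<A> E Y" for E h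
  proof -
    note [simp] = h[unfolded Hom_iff]
    have "g \<cdot> h \<in> Hom \<A> E Z" by simp
    then obtain y where y: "y \<in> Hom \<A> E C" "q \<cdot> y = g \<cdot> h" using lift'[OF E] by blast
    note [simp] = y(1)[unfolded Hom_iff] y(2)
    have "E \<in> Ob \<A>" using C_Ob[OF E] .
    note [simp] = this
    \<comment> \<open>The difference is annihilated by \<open>g\<close>, because
      \<open>g \<cdot> t = q\<close> and \<open>q \<cdot> y = g \<cdot> h\<close>. Hence
      \<open>h\<close> is \<open>f \<cdot> z\<close> corrected by \<open>t \<cdot> y\<close>, and
      the pair of \<open>z\<close> and \<open>y\<close> is the lift to \<open>S\<close> that shows
      properness.\<close>
    obtain z where z: "z \<in> Arr \<A>" "Dom \<A> z = E" "Cod \<A> z = X" "f \<cdot> z = Add \<A> h (neg (t \<cdot> y))"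
      by (rule SES_lift[OF s, of "Add \<A> h (neg (t \<cdot> y))"]) simp_all
    have "Add \<A> (f \<cdot> p\<^sub>1) (t \<cdot> p\<^sub>2) \<cdot> Add \<A> (i\<^sub>1 \<cdot> z) (i\<^sub>2 \<cdot> y) = h"
      using z by (simp add: Add_assoc)
    then show ?thesis using z by (intro bexI[of _ "Add \<A> (i\<^sub>1 \<cdot> z) (i\<^sub>2 \<cdot> y)"]) simp_all
  qed
  then have "S \<in> SPC \<A> \<G>" by (rule SPC_extension[OF m N(2) YZ(1)])
  moreover have "SES \<A> C i\<^sub>2 S p\<^sub>1 X" by (rule biproduct_SES[OF is_biproduct_commute[OF b]])
  ultimately show ?thesis using SPC_quotient N(3) C_subset_right_perp1 by blast
qed

text \<open>A direct sum is a split extension, and every morphism to the second summand lifts along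
  its injection; so direct sums are covered by \<open>SPC_extension\<close>.\<close>

lemma SPC_subcategory: "subcategory \<A> (SPC \<A> \<G>)"
  unfolding subcategory_def
proof (intro conjI ballI allI impI)
  show "\<exists>Z \<in> SPC \<A> \<G>. is_zero_object \<A> Z"
    by (rule C_zero) (use C_subset_SPC in blast)
  show "S \<in> SPC \<A> \<G>" if XY: "X \<in> SPC \<A> \<G>" "Y \<in> SPC \<A> \<G>"
    and b: "is_biproduct \<A> X Y S i\<^sub>1 i\<^sub>2 p\<^sub>1 p\<^sub>2" for X Y S i\<^sub>1 i\<^sub>2 p\<^sub>1 p\<^sub>2
  proof (rule SPC_extension[OF biproduct_SES[OF b] XY])
    note [simp] = biproduct_simps[OF b]
    show "\<exists>l \<in> Hom \<A> E S. p\<^sub>2 \<cdot> l = h" if "h \<in> Hom \<A> E Y" for E h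
      using that by (intro bexI[of _ "i\<^sub>2 \<cdot> h"]) simp_all
  qed
qed (use SPC_Ob SPC_isomorphic in auto)

end

section \<open>Return to the original notions of exactness, Ext and generators\<close>

theorem theorem4p12:
  fixes \<A> :: "('o, 'm) cat" and \<C> :: "'o set"
  assumes "abelian_category \<A>"
    and "subcategory \<A> \<C>"
    and "ext_orthogonal \<A> \<C> \<C>"
    and "generator \<A> (projectives \<A>) \<C>"
    and "generator \<A> \<C> (right_perp1 \<A> (Gorenstein \<A> \<C>))"
  shows "resolving \<A> \<C> (SPC \<A> (Gorenstein \<A> \<C>)) \<and>
    proper_generator \<A> \<C> \<C> (SPC \<A> (Gorenstein \<A> \<C>))"
proof -
  interpret abelian_category \<A> by fact
  have C: "\<C> \<subseteq> Ob \<A>" using assms(2) unfolding subcategory_def by blast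
  interpret self_orthogonal_subcategory \<A> \<C>
  proof
    show "subcategory \<A> \<C>" by fact
    show "ext1_zero \<A> X Y" if XY: "X \<in> \<C>" "Y \<in> \<C>" for X Y
    proof -
      have "Ext_zero \<A> 1 X Y"
        by (rule assms(3)[unfolded ext_orthogonal_def, rule_format, OF XY order_refl])
      moreover have "X \<in> Ob \<A>" "Y \<in> Ob \<A>" using XY C by blast+
      ultimately show ?thesis using Ext_zero_1_iff by blast
    qed
  qed
  have gen: "\<exists>L l C p. SES \<A> L l C p K \<and> L \<in> \<R> \<and> C \<in> \<C>" if K: "K \<in> \<R>" for K
  proof -
    obtain f g where fg: "short_exact \<A> f g" "Dom \<A> f \<in> \<R>" "Dom \<A> g \<in> \<C>" "Cod \<A> g = K"
      using assms(5) K unfolding generator_def by blast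
    have "SES \<A> (Dom \<A> f) f (Dom \<A> g) g K" using fg(1) unfolding short_exact_iff fg(4) .
    with fg(2,3) show ?thesis by (intro exI conjI)
  qed
  have "\<exists>f g. proper_short_exact \<A> \<C> f g \<and> Dom \<A> f \<in> SPC \<A> \<G> \<and> Dom \<A> g \<in> \<C> \<and> Cod \<A> g = T"
    if T: "T \<in> SPC \<A> \<G>" for T
  proof -
    obtain N n D g where *: "SES \<A> N n D g T" "N \<in> SPC \<A> \<G>" "D \<in> \<C>"
      "\<forall>E \<in> \<C>. \<forall>h \<in> Hom \<A> E T. \<exists>l \<in> Hom \<A> E D. g \<cdot>\<^bsub>\<A>\<^esub> l = h"
      using SPC_proper_resolution[OF gen T] by blast
    note s = SES_simps(2,5,6)[OF *(1)]
    have "proper_short_exact \<A> \<C> n g" unfolding proper_short_exact_iff[OF C] s using *(1,4) by blast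
    then show ?thesis using s *(2,3) by blast
  qed
  then have pg: "proper_generator \<A> \<C> \<C> (SPC \<A> \<G>)"
    unfolding proper_generator_def using C_subset_SPC by blast
  moreover have "Dom \<A> g \<in> SPC \<A> \<G>"
    if "proper_short_exact \<A> \<C> f g" "Dom \<A> f \<in> SPC \<A> \<G>" "Cod \<A> g \<in> SPC \<A> \<G>" for f g
    using that SPC_extension[of "Dom \<A> f" f "Dom \<A> g" g "Cod \<A> g"]
    unfolding proper_short_exact_iff[OF C] by blast
  moreover have "Dom \<A> f \<in> SPC \<A> \<G>"
    if "proper_short_exact \<A> \<C> f g" "Dom \<A> g \<in> SPC \<A> \<G>" "Cod \<A> g \<in> SPC \<A> \<G>" for f g
    using that SPC_kernel[OF gen, of "Dom \<A> f" f "Dom \<A> g" g "Cod \<A> g"]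
    unfolding proper_short_exact_iff[OF C] by blast
  ultimately show ?thesis
    \<comment> \<open>\<open>\<C>\<close> itself witnesses the existential over proper generators in
      \<open>resolving\<close>.\<close>
    unfolding resolving_def using SPC_subcategory assms(2) by blast
qed

end
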